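(* Let $k:\mathbb{R}^n\to\mathbb{R}$ be smooth outside the origin and positive homogeneous of degree one. Assume that $\operatorname{graph} k\subset\mathbb{R}^{n+1}$ is contained in a half-space and that it has positive mean curvature outside the origin, i.e. $H[k]>0$ on $\mathbb{R}^n\setminus\{0\}$. Let $U$ be the homothetically expanding solution to graphical mean curvature flow with $U(\cdot,0)=k$. Let $u\in C^\infty_{loc}(\mathbb{R}^n\times(0,\infty))\cap C^0_{loc}(\mathbb{R}^n\times[0,\infty))$ be a solution to graphical mean curvature flow whose initial value $u_0=u(\cdot,0)\in C^0_{loc}(\mathbb{R}^n)$ satisfies $$\sup_{\mathbb{R}^n\setminus B_r(0)}|u_0-k|\to0\quad\text{as}\quad r\to\infty.$$ Then $$\sup_{\mathbb{R}^n}|u(\cdot,t)-U(\cdot,t)|\to0\quad\text{as}\quad t\to\infty.$$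
   Context: For a function $v$, $H[v]=\operatorname{div}\left(\frac{Dv}{\sqrt{1+|Dv|^2}}\right)$ denotes the mean curvature of its graph. Graphical mean curvature flow is the equation $\dot u=\sqrt{1+|Du|^2}\,\operatorname{div}\left(\frac{Du}{\sqrt{1+|Du|^2}}\right)=\sqrt{1+|Du|^2}\,H[u]$ on $\mathbb{R}^n\times(0,\infty)$. A function $k$ is positive homogeneous of degree one if $k(\lambda x)=\lambda k(x)$ for all $\lambda>0$, $x\in\mathbb{R}^n$. For $k$ smooth outside the origin and positive homogeneous of degree one, the homothetically expanding solution $U$ with $U(\cdot,0)=k$ is the unique solution $U\in C^\infty_{loc}(\mathbb{R}^n\times(0,\infty))\cap C^0_{loc}(\mathbb{R}^n\times[0,\infty))$ of this equation with initial value $k$; it satisfies $U(x,t)=\sqrt t\,U\left(\frac{x}{\sqrt t},1\right)$ for all $x\in\mathbb{R}^n$, $t>0$. *)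

theory Defs
  imports "HOL-Analysis.Analysis"
begin

text \<open>Functions of class \<open>C\<^sup>m\<close> and \<open>C\<^sup>\<infinity>\<close> on a set \<open>S\<close>, which is meant to be open: the derivatives are
  taken in the whole space. All local bounds (the subscript in \<open>C\<^sup>\<infinity>\<^sub>l\<^sub>o\<^sub>c\<close>) follow from continuity of
  the derivatives.\<close>

primrec C_on :: "nat \<Rightarrow> 'a::real_normed_vector set \<Rightarrow> ('a \<Rightarrow> 'b::real_normed_vector) \<Rightarrow> bool" where
  "C_on 0 S f \<longleftrightarrow> continuous_on S f"
| "C_on (Suc m) S f \<longleftrightarrow>
     (\<forall>x\<in>S. f differentiable (at x)) \<and> (\<forall>v. C_on m S (\<lambda>x. frechet_derivative f (at x) v))"

definition smooth_on :: "'a::real_normed_vector set \<Rightarrow> ('a \<Rightarrow> 'b::real_normed_vector) \<Rightarrow> bool" where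
  "smooth_on S f \<longleftrightarrow> (\<forall>m. C_on m S f)"

definition grad :: "(real ^ 'n \<Rightarrow> real) \<Rightarrow> real ^ 'n \<Rightarrow> real ^ 'n" where
  "grad v x = (\<chi> i. frechet_derivative v (at x) (axis i 1))"

definition divergence :: "(real ^ 'n \<Rightarrow> real ^ 'n) \<Rightarrow> real ^ 'n \<Rightarrow> real" where
  "divergence F x = (\<Sum>i\<in>UNIV. frechet_derivative F (at x) (axis i 1) $ i)"

definition mean_curvature :: "(real ^ 'n \<Rightarrow> real) \<Rightarrow> real ^ 'n \<Rightarrow> real" where
  "mean_curvature v = divergence (\<lambda>y. grad v y /\<^sub>R sqrt (1 + (norm (grad v y))\<^sup>2))"

definition pos_homogeneous :: "('a::real_vector \<Rightarrow> real) \<Rightarrow> bool" where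
  "pos_homogeneous k \<longleftrightarrow> (\<forall>l>0. \<forall>x. k (l *\<^sub>R x) = l * k x)"

definition halfspace :: "'a::real_inner set \<Rightarrow> bool" where
  "halfspace S \<longleftrightarrow> (\<exists>a c. a \<noteq> 0 \<and> S = {z. a \<bullet> z \<le> c})"

text \<open>Solutions are curried, \<open>u x t\<close>; values at negative times are irrelevant.\<close>

definition gmcf_solution :: "(real ^ 'n \<Rightarrow> real \<Rightarrow> real) \<Rightarrow> bool" where
  "gmcf_solution u \<longleftrightarrow>
     smooth_on (UNIV \<times> {0<..}) (\<lambda>(x, t). u x t) \<and>
     continuous_on (UNIV \<times> {0..}) (\<lambda>(x, t). u x t) \<and>
     (\<forall>x. \<forall>t>0. ((\<lambda>s. u x s) has_real_derivative
        sqrt (1 + (norm (grad (\<lambda>y. u y t) x))\<^sup>2) * mean_curvature (\<lambda>y. u y t) x) (at t))"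

text \<open>For \<open>k\<close> smooth outside the origin and positive homogeneous, the solution with initial value
  \<open>k\<close> is known to be unique and is then automatically self-similar. Uniqueness is not required
  here: the definition covers every self-similar solution starting from \<open>k\<close>.\<close>

definition homothetically_expanding_solution ::
    "(real ^ 'n \<Rightarrow> real) \<Rightarrow> (real ^ 'n \<Rightarrow> real \<Rightarrow> real) \<Rightarrow> bool" where
  "homothetically_expanding_solution k U \<longleftrightarrow>
     gmcf_solution U \<and> (\<forall>x. U x 0 = k x) \<and>
     (\<forall>x. \<forall>t>0. U x t = sqrt t * U (x /\<^sub>R sqrt t) 1)"

end

theory Submission
  imports Defs
begin

text \<open>Solutions obey a comparison principle with a Lipschitz modulus: \<open>u x 0 - v y 0 \<le> m + L |x - y|\<close> is
  preserved in time. It is proved by doubling the variables; the linear growth that this needs comes from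
  explicit local barriers that blow up on the boundary of a shrinking ball, so no growth of \<open>u\<close> is assumed.

  Upper bound: a mean convex cone lies below no linear function, hence no smooth function touches it from
  above at the origin. So \<open>k\<close> is a subsolution, \<open>U \<ge> k\<close> and \<open>U 0 1 > 0\<close>. Therefore \<open>U (\<cdot>, \<tau>) + \<epsilon>\<close> lies
  above \<open>u0\<close> for large \<open>\<tau>\<close>, and comparison gives \<open>u (\<cdot>, t) \<le> U (\<cdot>, t + \<tau>) + \<epsilon>\<close>.

  Lower bound: strict mean convexity makes \<open>k - \<epsilon> - b\<close> a subsolution for every flat, slowly decaying Gaussian
  \<open>b\<close>, so \<open>u (\<cdot>, T) \<ge> k - 2 \<epsilon>\<close> for some \<open>T\<close>, and comparison gives \<open>u (\<cdot>, t + T) \<ge> U (\<cdot>, t) - 2 \<epsilon>\<close>.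

  Both bounds reduce the theorem to \<open>sup (U (\<cdot>, t + \<tau>) - U (\<cdot>, t)) \<longrightarrow> 0\<close>. For \<open>|x| \<le> \<delta> t\<close> this follows from
  self-similarity and the Lipschitz bound; for \<open>|x| \<ge> \<delta> t\<close> from self-similarity and the expansion
  \<open>U (\<omega>, s) = k \<omega> + s \<kappa> \<omega> + o(s)\<close>, uniform over unit vectors \<open>\<omega>\<close>. No derivative estimates for \<open>U\<close> are needed.\<close>

section \<open>Second-order jets along lines\<close>

text \<open>As a trace the equation reads \<open>u' = mc_op p X\<close>, with p the gradient and X
  the Hessian form, and each maximum principle inspects it at one contact point only; jets along
  lines carry the data used there.

  The two bounds differ because the vertex obstructs contact from one side only. From above,
  \<open>U 0 (a\<^sup>2) = a * U 0 1\<close> grows without bound, so a time shift lifts the expander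
  over any bump of the initial value on a compact set. From below a bump has to diffuse away. The
  slope of the correction enters the operator next to the Hessian of k; as the gradient of k has
  degree 0 and its Hessian degree -1, compactness of the unit sphere yields one admissible slope at
  all scales. The decay exponent comes from the smallest eigenvalue of the inverse metric.

  The splitting at |x| = \<delta> t is forced by the o(s) term: scaled back it costs \<eta> t / |x|,
  which needs |x| at least comparable to t. For smaller |x| a shift by \<tau> changes U by about
  \<tau> L |x| / t, plus a term of order 1 / sqrt t from the value at the vertex.\<close>

definition d2 :: "(real \<Rightarrow> real) \<Rightarrow> real \<Rightarrow> real \<Rightarrow> bool" where
  "d2 g a b \<longleftrightarrow> (\<exists>g'. (\<forall>\<^sub>F s in nhds 0. (g has_real_derivative g' s) (at s)) \<and> g' 0 = a \<and>
     (g' has_real_derivative b) (at 0))"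

lemma d2_deriv: "d2 g a b \<Longrightarrow> (g has_real_derivative a) (at 0)"
  unfolding d2_def using eventually_nhds_x_imp_x by fastforce

lemma d2_const: "d2 (\<lambda>s. c) 0 0"
  unfolding d2_def by (rule exI[of _ "\<lambda>s. 0"]) (auto intro!: always_eventually derivative_eq_intros)

lemma d2_linear: "d2 (\<lambda>s. c + s * a) a 0"
  unfolding d2_def by (rule exI[of _ "\<lambda>s. a"]) (auto intro!: always_eventually derivative_eq_intros)

lemma d2_quadratic: "d2 (\<lambda>s. c + s * a + s\<^sup>2 * b) a (2 * b)"
  unfolding d2_def
  by (rule exI[of _ "\<lambda>s. a + 2 * s * b"]) (auto intro!: always_eventually derivative_eq_intros)

lemma d2_add:
  assumes "d2 f a b" "d2 g c d"
  shows "d2 (\<lambda>s. f s + g s) (a + c) (b + d)"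
proof -
  from assms obtain f' g' where *:
    "\<forall>\<^sub>F s in nhds 0. (f has_real_derivative f' s) (at s)" "f' 0 = a" "(f' has_real_derivative b) (at 0)"
    "\<forall>\<^sub>F s in nhds 0. (g has_real_derivative g' s) (at s)" "g' 0 = c" "(g' has_real_derivative d) (at 0)"
    unfolding d2_def by blast
  show ?thesis unfolding d2_def
    by (rule exI[of _ "\<lambda>s. f' s + g' s"])
       (use * in \<open>auto intro!: derivative_eq_intros elim: eventually_elim2\<close>)
qed

lemma d2_cmult:
  assumes "d2 f a b"
  shows "d2 (\<lambda>s. c * f s) (c * a) (c * b)"
proof -
  from assms obtain f' where *:
    "\<forall>\<^sub>F s in nhds 0. (f has_real_derivative f' s) (at s)" "f' 0 = a" "(f' has_real_derivative b) (at 0)"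
    unfolding d2_def by blast
  show ?thesis unfolding d2_def
    by (rule exI[of _ "\<lambda>s. c * f' s"])
       (use * in \<open>auto intro!: derivative_eq_intros elim: eventually_mono\<close>)
qed

lemma d2_minus: "d2 f a b \<Longrightarrow> d2 (\<lambda>s. - f s) (- a) (- b)"
  using d2_cmult[of f a b "-1"] by simp

lemma d2_diff: "d2 f a b \<Longrightarrow> d2 g c d \<Longrightarrow> d2 (\<lambda>s. f s - g s) (a - c) (b - d)"
  using d2_add[of f a b "\<lambda>s. - g s" "-c" "-d"] d2_minus[of g c d] by simp

lemma d2_scale_arg:
  assumes "d2 f a b"
  shows "d2 (\<lambda>s. f (c * s)) (c * a) (c\<^sup>2 * b)"
proof -
  from assms obtain f' where *:
    "\<forall>\<^sub>F s in nhds 0. (f has_real_derivative f' s) (at s)" "f' 0 = a" "(f' has_real_derivative b) (at 0)"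
    unfolding d2_def by blast
  have lim: "filterlim (\<lambda>s::real. c * s) (nhds 0) (nhds 0)"
    using tendsto_mult_right_zero[of "\<lambda>s. s" "nhds 0" c] by (simp add: filterlim_def)
  have lin: "((\<lambda>s. c * s) has_real_derivative c) (at s)" for s
    by (auto intro!: derivative_eq_intros)
  have "\<forall>\<^sub>F s in nhds 0. (f has_real_derivative f' (c * s)) (at (c * s))"
    using eventually_compose_filterlim[OF *(1) lim] .
  then have "\<forall>\<^sub>F s in nhds 0. ((\<lambda>s. f (c * s)) has_real_derivative c * f' (c * s)) (at s)"
  proof eventually_elim
    case (elim s)
    show ?case using DERIV_chain2[OF elim lin] by (simp add: mult.commute)
  qed
  moreover have "((\<lambda>s. c * f' (c * s)) has_real_derivative c\<^sup>2 * b) (at 0)"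
    using *(3) DERIV_cmult[OF DERIV_chain2[OF _ lin, of f' b 0], of c]
    by (simp add: power2_eq_square mult_ac)
  ultimately show ?thesis unfolding d2_def using *(2)
    by (intro exI[of _ "\<lambda>s. c * f' (c * s)"]) auto
qed

lemma d2_compose:
  assumes "d2 g a b"
    and F: "\<forall>\<^sub>F y in nhds (g 0). (F has_real_derivative F' y) (at y)"
    and F2: "(F' has_real_derivative F2) (at (g 0))"
  shows "d2 (\<lambda>s. F (g s)) (F' (g 0) * a) (F' (g 0) * b + F2 * a\<^sup>2)"
proof -
  from assms(1) obtain g' where *:
    "\<forall>\<^sub>F s in nhds 0. (g has_real_derivative g' s) (at s)" "g' 0 = a" "(g' has_real_derivative b) (at 0)"
    unfolding d2_def by blast
  have g0: "(g has_real_derivative a) (at 0)" using assms(1) by (rule d2_deriv)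
  then have "(g \<longlongrightarrow> g 0) (nhds 0)"
    using DERIV_isCont isCont_def tendsto_at_iff_tendsto_nhds by blast
  then have "\<forall>\<^sub>F s in nhds 0. (F has_real_derivative F' (g s)) (at (g s))"
    using eventually_compose_filterlim[OF F] by blast
  with *(1) have "\<forall>\<^sub>F s in nhds 0. ((\<lambda>s. F (g s)) has_real_derivative F' (g s) * g' s) (at s)"
    by eventually_elim (rule DERIV_chain2)
  moreover have "((\<lambda>s. F' (g s) * g' s) has_real_derivative F' (g 0) * b + F2 * a\<^sup>2) (at 0)"
    using DERIV_mult[OF DERIV_chain2[OF F2 g0] *(3)] *(2)
    by (simp add: power2_eq_square algebra_simps)
  ultimately show ?thesis unfolding d2_def using *(2)
    by (intro exI[of _ "\<lambda>s. F' (g s) * g' s"]) auto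
qed

lemma d2_unique: "d2 g a b \<Longrightarrow> d2 g c d \<Longrightarrow> a = c \<and> b = d"
proof -
  assume A: "d2 g a b" "d2 g c d"
  then obtain f' g' where *:
    "\<forall>\<^sub>F s in nhds 0. (g has_real_derivative f' s) (at s)" "f' 0 = a" "(f' has_real_derivative b) (at 0)"
    "\<forall>\<^sub>F s in nhds 0. (g has_real_derivative g' s) (at s)" "g' 0 = c" "(g' has_real_derivative d) (at 0)"
    unfolding d2_def by blast
  have "\<forall>\<^sub>F s in nhds 0. f' s = g' s"
    using *(1,4) by eventually_elim (rule DERIV_unique)
  then have "(g' has_real_derivative b) (at 0)"
    using *(3) DERIV_cong_ev by blast
  then show ?thesis using * DERIV_unique d2_deriv A by blast
qed

lemma d2_local_max:
  assumes "d2 g a b" and max: "\<forall>\<^sub>F s in nhds 0. g s \<le> g 0"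
  shows "a = 0" "b \<le> 0"
proof -
  from assms(1) obtain g' where *:
    "\<forall>\<^sub>F s in nhds 0. (g has_real_derivative g' s) (at s)" "g' 0 = a" "(g' has_real_derivative b) (at 0)"
    unfolding d2_def by blast
  from *(1) max have "\<forall>\<^sub>F s in nhds 0. (g has_real_derivative g' s) (at s) \<and> g s \<le> g 0"
    by eventually_elim auto
  then obtain e where e: "e > 0"
    "\<And>s. \<bar>s\<bar> < e \<Longrightarrow> (g has_real_derivative g' s) (at s)" "\<And>s. \<bar>s\<bar> < e \<Longrightarrow> g s \<le> g 0"
    unfolding eventually_nhds_metric dist_real_def by auto
  show a: "a = 0"
    using DERIV_local_max[OF d2_deriv[OF assms(1)] e(1)] e(3) by auto
  show "b \<le> 0"
  proof (rule ccontr)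
    assume "\<not> b \<le> 0"
    then obtain d where d: "d > 0" "\<And>h. 0 < h \<Longrightarrow> h < d \<Longrightarrow> g' 0 < g' (0 + h)"
      using DERIV_pos_inc_right[OF *(3)] by force
    define h where "h = min d e / 2"
    have h: "0 < h" "h < d" "h < e" using d(1) e(1) by (auto simp: h_def)
    \<comment> \<open>As \<open>g' 0 = 0\<close> and b > 0, \<open>g'\<close> is positive just to
      the right of 0, so the mean value theorem lifts g above \<open>g 0\<close>.\<close>
    have "\<exists>z>0. z < h \<and> g h - g 0 = (h - 0) * g' z"
      using h e(2) by (intro MVT2) auto
    then obtain z where z: "0 < z" "z < h" "g h - g 0 = h * g' z" by auto
    then have "g' z > 0" using d(2)[of z] h a *(2) by auto
    then have "g h > g 0" using z h mult_pos_pos[of h "g' z"] by linarith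
    then show False using e(3)[of h] h by auto
  qed
qed

text \<open>One-sided in time: a maximum over a time interval may sit at its right end, where only
  earlier times can be compared.\<close>

lemma deriv_nonneg_if_left_max:
  assumes "(g has_real_derivative d) (at t)" "e > 0" "\<And>s. t - e \<le> s \<Longrightarrow> s \<le> t \<Longrightarrow> g s \<le> g t"
  shows "d \<ge> (0::real)"
proof (rule ccontr)
  assume "\<not> d \<ge> 0"
  then obtain c where c: "c > 0" "\<And>h. 0 < h \<Longrightarrow> h < c \<Longrightarrow> g t < g (t - h)"
    using DERIV_neg_dec_left[OF assms(1)] by auto
  define h where "h = min c e / 2"
  have "0 < h" "h < c" "h < e" using c(1) assms(2) by (auto simp: h_def)
  then show False
    using c(2)[of h] assms(3)[of "t - h"] by auto
qed

text \<open>\<open>p\<close> is the gradient of \<open>w\<close> at \<open>x\<close>, and \<open>X\<close> is the quadratic form (not the bilinear one) of its Hessian.\<close>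

definition jet2 :: "('a::real_inner \<Rightarrow> real) \<Rightarrow> 'a \<Rightarrow> 'a \<Rightarrow> ('a \<Rightarrow> real) \<Rightarrow> bool" where
  "jet2 w x p X \<longleftrightarrow> (\<forall>\<xi>. d2 (\<lambda>s. w (x + s *\<^sub>R \<xi>)) (p \<bullet> \<xi>) (X \<xi>))"

lemma jet2_const: "jet2 (\<lambda>y. c) x 0 (\<lambda>\<xi>. 0)"
  by (simp add: jet2_def d2_const)

lemma jet2_inner: "jet2 (\<lambda>y. p \<bullet> y) x p (\<lambda>\<xi>. 0)"
  unfolding jet2_def using d2_linear[of "p \<bullet> x"] by (simp add: inner_add_right)

lemma jet2_add:
  "jet2 v x p X \<Longrightarrow> jet2 w x q Y \<Longrightarrow> jet2 (\<lambda>y. v y + w y) x (p + q) (\<lambda>\<xi>. X \<xi> + Y \<xi>)"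
  by (simp add: jet2_def inner_add_left d2_add)

lemma jet2_diff:
  "jet2 v x p X \<Longrightarrow> jet2 w x q Y \<Longrightarrow> jet2 (\<lambda>y. v y - w y) x (p - q) (\<lambda>\<xi>. X \<xi> - Y \<xi>)"
  by (simp add: jet2_def inner_diff_left d2_diff)

lemma jet2_cmult: "jet2 v x p X \<Longrightarrow> jet2 (\<lambda>y. c * v y) x (c *\<^sub>R p) (\<lambda>\<xi>. c * X \<xi>)"
  by (simp add: jet2_def d2_cmult)

lemma jet2_minus: "jet2 v x p X \<Longrightarrow> jet2 (\<lambda>y. - v y) x (- p) (\<lambda>\<xi>. - X \<xi>)"
  by (simp add: jet2_def d2_minus)

lemma jet2_norm_sq: "jet2 (\<lambda>y. (norm (y - c))\<^sup>2) x (2 *\<^sub>R (x - c)) (\<lambda>\<xi>. 2 * (norm \<xi>)\<^sup>2)"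
  unfolding jet2_def
proof
  fix \<xi>
  have "(norm (x + s *\<^sub>R \<xi> - c))\<^sup>2 = (norm (x - c))\<^sup>2 + s * (2 * ((x - c) \<bullet> \<xi>)) + s\<^sup>2 * (norm \<xi>)\<^sup>2" for s
    unfolding power2_norm_eq_inner
    by (simp add: algebra_simps inner_commute power2_eq_square)
  then show "d2 (\<lambda>s. (norm (x + s *\<^sub>R \<xi> - c))\<^sup>2) ((2 *\<^sub>R (x - c)) \<bullet> \<xi>) (2 * (norm \<xi>)\<^sup>2)"
    using d2_quadratic[of "(norm (x - c))\<^sup>2" "2 * ((x - c) \<bullet> \<xi>)" "(norm \<xi>)\<^sup>2"] by simp
qed

lemma jet2_compose:
  assumes "jet2 v x p X"
    and "\<forall>\<^sub>F y in nhds (v x). (F has_real_derivative F' y) (at y)"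
    and "(F' has_real_derivative F2) (at (v x))"
  shows "jet2 (\<lambda>y. F (v y)) x (F' (v x) *\<^sub>R p) (\<lambda>\<xi>. F' (v x) * X \<xi> + F2 * (p \<bullet> \<xi>)\<^sup>2)"
  unfolding jet2_def
proof
  fix \<xi>
  show "d2 (\<lambda>s. F (v (x + s *\<^sub>R \<xi>))) ((F' (v x) *\<^sub>R p) \<bullet> \<xi>) (F' (v x) * X \<xi> + F2 * (p \<bullet> \<xi>)\<^sup>2)"
    using d2_compose[of "\<lambda>s. v (x + s *\<^sub>R \<xi>)" "p \<bullet> \<xi>" "X \<xi>" F F' F2] assms by (simp add: jet2_def)
qed

lemma jet2_unique:
  assumes "jet2 v x p X" "jet2 v x q Y"
  shows "p = q" "X = Y"
proof -
  have "p \<bullet> \<xi> = q \<bullet> \<xi> \<and> X \<xi> = Y \<xi>" for \<xi>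
    using assms d2_unique unfolding jet2_def by blast
  then show "p = q" "X = Y" by (auto intro: vector_eq_rdot[THEN iffD1])
qed

lemma eventually_nhds_line:
  fixes x :: "'a::real_normed_vector"
  assumes "\<forall>\<^sub>F y in nhds x. P y"
  shows "\<forall>\<^sub>F s in nhds 0. P (x + s *\<^sub>R \<xi>)"
proof -
  have "((\<lambda>s::real. s) \<longlongrightarrow> 0) (nhds 0)" by (rule filterlim_ident)
  from tendsto_add[OF tendsto_const tendsto_scaleR[OF this tendsto_const]]
  have "((\<lambda>s. x + s *\<^sub>R \<xi>) \<longlongrightarrow> x + 0 *\<^sub>R \<xi>) (nhds 0)" .
  then show ?thesis using assms by (simp add: filterlim_iff)
qed

lemma jet2_local_max:
  assumes "jet2 v x p X" and "\<forall>\<^sub>F y in nhds x. v y \<le> v x"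
  shows "p = 0" "X \<xi> \<le> 0"
proof -
  have *: "d2 (\<lambda>s. v (x + s *\<^sub>R \<xi>)) (p \<bullet> \<xi>) (X \<xi>)" "\<forall>\<^sub>F s in nhds 0. v (x + s *\<^sub>R \<xi>) \<le> v (x + 0 *\<^sub>R \<xi>)" for \<xi>
    using assms eventually_nhds_line[OF assms(2)] by (auto simp: jet2_def)
  show "p = 0" using d2_local_max(1)[OF *, of p] by simp
  show "X \<xi> \<le> 0" using d2_local_max(2)[OF *, of \<xi>] .
qed

lemma jet2_dilation:
  assumes "jet2 v x p X"
    and "c *\<^sub>R y = x"
  shows "jet2 (\<lambda>y. v (c *\<^sub>R y)) y (c *\<^sub>R p) (\<lambda>\<xi>. c\<^sup>2 * X \<xi>)"
  unfolding jet2_def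
proof
  fix \<xi>
  have "d2 (\<lambda>s. v (x + s *\<^sub>R \<xi>)) (p \<bullet> \<xi>) (X \<xi>)" using assms by (simp add: jet2_def)
  from d2_scale_arg[OF this, of c]
  show "d2 (\<lambda>s. v (c *\<^sub>R (y + s *\<^sub>R \<xi>))) ((c *\<^sub>R p) \<bullet> \<xi>) (c\<^sup>2 * X \<xi>)"
    using assms(2) by (simp add: scaleR_add_right)
qed

section \<open>The mean curvature operator and classical solutions\<close>

definition slope_factor :: "'a::real_inner \<Rightarrow> real" where
  "slope_factor p = sqrt (1 + (norm p)\<^sup>2)"

text \<open>The square root of the inverse metric \<open>1 - p p\<^sup>T / (1 + |p|\<^sup>2)\<close> of a graph with gradient \<open>p\<close>. Taking the trace
  as a sum of values of the quadratic form makes the operator monotone at a glance, and in the doubling argument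
  it allows different roots to be used at the two points.\<close>

definition metric_root :: "'a::real_inner \<Rightarrow> 'a \<Rightarrow> 'a" where
  "metric_root p \<xi> = \<xi> - ((p \<bullet> \<xi>) / (slope_factor p * (slope_factor p + 1))) *\<^sub>R p"

definition mc_op :: "'a::euclidean_space \<Rightarrow> ('a \<Rightarrow> real) \<Rightarrow> real" where
  "mc_op p X = (\<Sum>b\<in>Basis. X (metric_root p b))"

lemma slope_factor_ge_1: "slope_factor p \<ge> 1"
  by (simp add: slope_factor_def)

lemma slope_factor_pos: "slope_factor p > 0"
  using slope_factor_ge_1[of p] by linarith

lemma slope_factor_sq: "(slope_factor p)\<^sup>2 = 1 + (norm p)\<^sup>2"
  by (simp add: slope_factor_def add_nonneg_nonneg)

text \<open>Squaring I - c p p^T gives I - (2 c - c^2 |p|^2) p p^T, so this is what makes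
  \<open>metric_root\<close> a root of the inverse metric.\<close>

lemma slope_factor_identity:
  fixes p :: "'a::real_inner"
  defines "c \<equiv> 1 / (slope_factor p * (slope_factor p + 1))"
  shows "2 * c - c\<^sup>2 * (norm p)\<^sup>2 = 1 / (slope_factor p)\<^sup>2"
proof -
  let ?W = "slope_factor p"
  have W: "?W > 0" "?W + 1 > 0" using slope_factor_pos[of p] by auto
  have n: "(norm p)\<^sup>2 = (?W - 1) * (?W + 1)" using slope_factor_sq[of p] by (simp add: power2_eq_square algebra_simps)
  have "2 * c - c\<^sup>2 * (norm p)\<^sup>2 = (2 * (?W * (?W + 1)) - (?W - 1) * (?W + 1)) / (?W * (?W + 1))\<^sup>2"
    unfolding n c_def using W by (simp add: divide_simps power2_eq_square) (simp add: algebra_simps)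
  also have "2 * (?W * (?W + 1)) - (?W - 1) * (?W + 1) = (?W + 1)\<^sup>2"
    by (simp add: power2_eq_square algebra_simps)
  also have "(?W + 1)\<^sup>2 / (?W * (?W + 1))\<^sup>2 = 1 / ?W\<^sup>2"
    using W by (simp add: power_mult_distrib)
  finally show ?thesis .
qed

lemma metric_root_selfadjoint: "q \<bullet> metric_root p \<xi> = metric_root p q \<bullet> \<xi>"
  by (simp add: metric_root_def inner_diff_right inner_diff_left inner_commute)

lemma metric_root_inner_sq:
  "metric_root p \<xi> \<bullet> metric_root p \<xi> = \<xi> \<bullet> \<xi> - (p \<bullet> \<xi>)\<^sup>2 / (slope_factor p)\<^sup>2"
proof -
  define c where "c = 1 / (slope_factor p * (slope_factor p + 1))"
  have r: "metric_root p \<xi> = \<xi> - (c * (p \<bullet> \<xi>)) *\<^sub>R p"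
    by (simp add: metric_root_def c_def)
  have "metric_root p \<xi> \<bullet> metric_root p \<xi> = \<xi> \<bullet> \<xi> - (p \<bullet> \<xi>)\<^sup>2 * (2 * c - c\<^sup>2 * (norm p)\<^sup>2)"
    unfolding r power2_norm_eq_inner inner_diff_right inner_diff_left inner_scaleR_left inner_scaleR_right
      inner_commute[of \<xi> p]
    by algebra
  then show ?thesis using slope_factor_identity[of p] by (simp add: c_def)
qed

lemma norm_metric_root_le: "norm (metric_root p \<xi>) \<le> norm \<xi>"
  unfolding norm_le metric_root_inner_sq by simp

lemma mc_op_minus: "mc_op (- p) (\<lambda>\<xi>. - X \<xi>) = - mc_op p X"
  by (simp add: mc_op_def metric_root_def slope_factor_def sum_negf)

lemma mc_op_mono: "(\<And>\<xi>. X \<xi> \<le> Y \<xi>) \<Longrightarrow> mc_op p X \<le> mc_op p Y"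
  by (simp add: mc_op_def sum_mono)

lemma mc_op_add: "mc_op p (\<lambda>\<xi>. X \<xi> + Y \<xi>) = mc_op p X + mc_op p Y"
  by (simp add: mc_op_def sum.distrib)

lemma mc_op_cmult: "mc_op p (\<lambda>\<xi>. c * X \<xi>) = c * mc_op p X"
  by (simp add: mc_op_def sum_distrib_left)

lemma mc_op_inner_sq: "mc_op p (\<lambda>\<xi>. (q \<bullet> \<xi>)\<^sup>2) = (norm q)\<^sup>2 - (p \<bullet> q)\<^sup>2 / (slope_factor p)\<^sup>2"
proof -
  have "mc_op p (\<lambda>\<xi>. (q \<bullet> \<xi>)\<^sup>2) = (\<Sum>b\<in>Basis. (metric_root p q \<bullet> b) * (metric_root p q \<bullet> b))"
    unfolding mc_op_def metric_root_selfadjoint power2_eq_square ..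
  also have "\<dots> = metric_root p q \<bullet> metric_root p q"
    by (rule euclidean_inner[symmetric])
  finally have "mc_op p (\<lambda>\<xi>. (q \<bullet> \<xi>)\<^sup>2) = metric_root p q \<bullet> metric_root p q" .
  then show ?thesis by (simp add: metric_root_inner_sq power2_norm_eq_inner)
qed

lemma mc_op_inner_sq_le: "mc_op p (\<lambda>\<xi>. (q \<bullet> \<xi>)\<^sup>2) \<le> (norm q)\<^sup>2"
  by (simp add: mc_op_inner_sq)

lemma mc_op_norm_sq:
  fixes p :: "'a::euclidean_space"
  shows "mc_op p (\<lambda>\<xi>. (norm \<xi>)\<^sup>2) = DIM('a) - (norm p)\<^sup>2 / (slope_factor p)\<^sup>2"
proof -
  have "(\<Sum>b\<in>Basis. (p \<bullet> b)\<^sup>2) = (norm p)\<^sup>2"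
    unfolding power2_norm_eq_inner euclidean_inner[of p p] by (simp only: power2_eq_square)
  then show ?thesis
    unfolding mc_op_def power2_norm_eq_inner metric_root_inner_sq
    by (simp add: sum_subtractf sum_divide_distrib[symmetric] power2_norm_eq_inner)
qed

lemma mc_op_norm_sq_le:
  fixes p :: "'a::euclidean_space"
  shows "mc_op p (\<lambda>\<xi>. (norm \<xi>)\<^sup>2) \<le> DIM('a)"
  by (simp add: mc_op_norm_sq)

text \<open>The eigenvalue of the inverse metric in direction p is 1 / (1 + |p|^2), the others are
  1. Keeping only the smallest one gives a bound valid in every dimension; it fixes the exponents
  allowed in \<open>gauss_barrier\<close>.\<close>

lemma mc_op_norm_sq_ge:
  fixes p :: "'a::euclidean_space"
  assumes "norm p \<le> L"
  shows "mc_op p (\<lambda>\<xi>. (norm \<xi>)\<^sup>2) \<ge> 1 / (1 + L\<^sup>2)"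
proof -
  have D: "real (DIM('a)) \<ge> 1"
    using DIM_positive[where 'a = 'a] by linarith
  have pos: "1 + (norm p)\<^sup>2 > 0" by (simp add: add_pos_nonneg)
  have "1 / (1 + L\<^sup>2) \<le> 1 / (1 + (norm p)\<^sup>2)"
    using assms pos by (intro divide_left_mono) (auto simp: power_mono add_pos_nonneg)
  also have "\<dots> = 1 - (norm p)\<^sup>2 / (1 + (norm p)\<^sup>2)"
    using pos by (simp add: field_simps)
  finally show ?thesis using D unfolding mc_op_norm_sq slope_factor_sq by linarith
qed

text \<open>The bridge from the sum over root vectors to the usual trace of A against the inverse
  metric. The skew part of \<open>A\<close> drops out of both sides, so \<open>A\<close> may be any
  linear map.\<close>

lemma mc_op_bilinear:
  fixes A :: "'a::euclidean_space \<Rightarrow> 'a"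
  assumes "linear A"
  shows "mc_op p (\<lambda>\<xi>. A \<xi> \<bullet> \<xi>) = (\<Sum>b\<in>Basis. A b \<bullet> b) - (A p \<bullet> p) / (slope_factor p)\<^sup>2"
proof -
  define c where "c = 1 / (slope_factor p * (slope_factor p + 1))"
  interpret linear A by fact
  have r: "metric_root p b = b - (c * (p \<bullet> b)) *\<^sub>R p" for b
    by (simp add: metric_root_def c_def)
  have "A (metric_root p b) \<bullet> metric_root p b
      = A b \<bullet> b - c * ((A p \<bullet> b) * (p \<bullet> b)) - c * ((p \<bullet> b) * (A b \<bullet> p)) + c\<^sup>2 * (A p \<bullet> p) * ((p \<bullet> b) * (p \<bullet> b))" for b
    unfolding r diff scale inner_diff_left inner_diff_right inner_scaleR_left inner_scaleR_right by algebra
  then have "mc_op p (\<lambda>\<xi>. A \<xi> \<bullet> \<xi>) = (\<Sum>b\<in>Basis. A b \<bullet> b) - c * (\<Sum>b\<in>Basis. (A p \<bullet> b) * (p \<bullet> b))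
      - c * (\<Sum>b\<in>Basis. (p \<bullet> b) * (A b \<bullet> p)) + c\<^sup>2 * (A p \<bullet> p) * (\<Sum>b\<in>Basis. (p \<bullet> b) * (p \<bullet> b))"
    by (simp add: mc_op_def sum.distrib sum_subtractf sum_distrib_left)
  also have "(\<Sum>b\<in>Basis. (A p \<bullet> b) * (p \<bullet> b)) = A p \<bullet> p"
    unfolding euclidean_inner[of "A p" p] ..
  also have "(\<Sum>b\<in>Basis. (p \<bullet> b) * (p \<bullet> b)) = (norm p)\<^sup>2"
    unfolding power2_norm_eq_inner euclidean_inner[of p p] ..
  also have "(\<Sum>b\<in>Basis. (p \<bullet> b) * (A b \<bullet> p)) = A p \<bullet> p"
  proof -
    have "A p = A (\<Sum>b\<in>Basis. (p \<bullet> b) *\<^sub>R b)" by (simp add: euclidean_representation)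
    also have "\<dots> = (\<Sum>b\<in>Basis. (p \<bullet> b) *\<^sub>R A b)" by (simp add: sum scale)
    finally show ?thesis by (simp add: inner_sum_left)
  qed
  finally have "mc_op p (\<lambda>\<xi>. A \<xi> \<bullet> \<xi>)
      = (\<Sum>b\<in>Basis. A b \<bullet> b) - (A p \<bullet> p) * (2 * c - c\<^sup>2 * (norm p)\<^sup>2)"
    by (simp add: algebra_simps)
  then show ?thesis using slope_factor_identity[of p] by (simp add: c_def)
qed

lemma continuous_on_metric_root:
  assumes "continuous_on S f"
  shows "continuous_on S (\<lambda>x. metric_root (f x) \<xi>)"
proof -
  have "slope_factor (f x) * (slope_factor (f x) + 1) > 0" for x
    using slope_factor_pos[of "f x"] by (intro mult_pos_pos) linarith+
  then have "\<forall>x\<in>S. slope_factor (f x) * (slope_factor (f x) + 1) \<noteq> 0" by (metis less_irrefl)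
  moreover have "continuous_on S (\<lambda>x. slope_factor (f x))"
    unfolding slope_factor_def by (intro continuous_intros assms)
  ultimately show ?thesis
    unfolding metric_root_def by (intro continuous_intros assms)
qed

text \<open>A pointwise form of being a classical solution, closed under reflection and time shift:
  a spatial jet and a time derivative at each point, with continuity up to time 0.\<close>

definition mcf :: "('a::euclidean_space \<Rightarrow> real \<Rightarrow> real) \<Rightarrow> bool" where
  "mcf u \<longleftrightarrow> continuous_on (UNIV \<times> {0..}) (\<lambda>(x, t). u x t) \<and>
    (\<forall>x. \<forall>t>0. \<exists>p X. jet2 (\<lambda>y. u y t) x p X \<and> ((\<lambda>s. u x s) has_real_derivative mc_op p X) (at t))"

lemma mcf_continuous:
  assumes "mcf u" "continuous_on S f" "continuous_on S g" "\<And>z. z \<in> S \<Longrightarrow> g z \<ge> 0"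
  shows "continuous_on S (\<lambda>z. u (f z) (g z))"
proof -
  have "continuous_on S ((\<lambda>(x, t). u x t) \<circ> (\<lambda>z. (f z, g z)))"
  proof (rule continuous_on_compose)
    show "continuous_on S (\<lambda>z. (f z, g z))" using assms(2,3) by (rule continuous_on_Pair)
    show "continuous_on ((\<lambda>z. (f z, g z)) ` S) (\<lambda>(x, t). u x t)"
      using assms(1,4) by (auto simp: mcf_def elim!: continuous_on_subset)
  qed
  then show ?thesis by (simp add: o_def)
qed

lemma mcf_minus:
  assumes "mcf u"
  shows "mcf (\<lambda>x t. - u x t)"
  unfolding mcf_def
proof (intro conjI allI impI)
  show "continuous_on (UNIV \<times> {0..}) (\<lambda>(x, t). - u x t)"
    using assms continuous_on_minus unfolding mcf_def split_def by blast
  fix x t assume "t > (0::real)"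
  then obtain p X where *: "jet2 (\<lambda>y. u y t) x p X" "((\<lambda>s. u x s) has_real_derivative mc_op p X) (at t)"
    using assms unfolding mcf_def by blast
  show "\<exists>p X. jet2 (\<lambda>y. - u y t) x p X \<and> ((\<lambda>s. - u x s) has_real_derivative mc_op p X) (at t)"
    using jet2_minus[OF *(1)] DERIV_minus[OF *(2)] unfolding mc_op_minus[symmetric] by blast
qed

lemma mcf_time_shift:
  assumes "mcf u" "\<tau> \<ge> 0"
  shows "mcf (\<lambda>x t. u x (t + \<tau>))"
  unfolding mcf_def
proof (intro conjI allI impI)
  show "continuous_on (UNIV \<times> {0..}) (\<lambda>(x, t). u x (t + \<tau>))"
    unfolding split_def by (intro mcf_continuous[OF assms(1)] continuous_intros) (use assms in auto)
  fix x t assume "t > (0::real)"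
  then have "t + \<tau> > 0" using assms by simp
  then obtain p X where *: "jet2 (\<lambda>y. u y (t + \<tau>)) x p X" "((\<lambda>s. u x s) has_real_derivative mc_op p X) (at (t + \<tau>))"
    using assms unfolding mcf_def by blast
  have "((\<lambda>s. u x (s + \<tau>)) has_real_derivative mc_op p X) (at t)"
    using *(2) unfolding DERIV_shift .
  then show "\<exists>p X. jet2 (\<lambda>y. u y (t + \<tau>)) x p X \<and> ((\<lambda>s. u x (s + \<tau>)) has_real_derivative mc_op p X) (at t)"
    using * by blast
qed

text \<open>At a spatial maximum of u - w the gradients agree and the Hessians are ordered; being a
  maximum over earlier times as well makes the time derivative of u at least d. Strict
  supersolutions w are thereby excluded.\<close>

lemma mcf_touch_above:
  assumes u: "mcf u" and t: "t > 0"
    and jet: "jet2 (\<lambda>y. w y t) x p X" and dt: "((\<lambda>s. w x s) has_real_derivative d) (at t)"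
    and space: "\<forall>\<^sub>F y in nhds x. u y t - w y t \<le> u x t - w x t"
    and time: "e > 0" "\<And>s. t - e \<le> s \<Longrightarrow> s \<le> t \<Longrightarrow> u x s - w x s \<le> u x t - w x t"
  shows "d \<le> mc_op p X"
proof -
  obtain q Y where *: "jet2 (\<lambda>y. u y t) x q Y" "((\<lambda>s. u x s) has_real_derivative mc_op q Y) (at t)"
    using u t unfolding mcf_def by blast
  from jet2_local_max[OF jet2_diff[OF *(1) jet] space] have pq: "q = p" and XY: "\<And>\<xi>. Y \<xi> \<le> X \<xi>"
    by auto
  have "0 \<le> mc_op q Y - d"
    by (rule deriv_nonneg_if_left_max[OF DERIV_diff[OF *(2) dt] time(1)]) (use time(2) in auto)
  then show ?thesis using mc_op_mono[of Y X p] XY pq by auto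
qed

section \<open>Local bounds and the comparison principle\<close>

text \<open>For a function \<open>F(|x|\<^sup>2)\<close>, with \<open>a = F'\<close>, \<open>b = F''\<close> and \<open>q = 2 x\<close>; spheres are the case \<open>F'' = 2 F'\<^sup>3\<close>.\<close>

lemma mc_op_radial_le:
  fixes q :: "'a::euclidean_space" and a b :: real
  assumes "a \<ge> 0" "b \<le> 2 * a ^ 3"
  shows "mc_op (a *\<^sub>R q) (\<lambda>\<xi>. a * (2 * (norm \<xi>)\<^sup>2) + b * (q \<bullet> \<xi>)\<^sup>2) \<le> 2 * DIM('a) * a"
proof -
  define p where "p = a *\<^sub>R q"
  let ?V = "(slope_factor p)\<^sup>2"
  have V: "?V > 0" using slope_factor_pos[of p] by simp
  have V': "?V = 1 + a\<^sup>2 * (norm q)\<^sup>2"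
    by (simp add: slope_factor_sq p_def power_mult_distrib)
  have "mc_op p (\<lambda>\<xi>. a * (2 * (norm \<xi>)\<^sup>2) + b * (q \<bullet> \<xi>)\<^sup>2)
      = a * (2 * (DIM('a) - (norm p)\<^sup>2 / ?V)) + b * ((norm q)\<^sup>2 - (p \<bullet> q)\<^sup>2 / ?V)"
    by (simp only: mc_op_add mc_op_cmult mc_op_norm_sq mc_op_inner_sq)
  also have "(norm q)\<^sup>2 - (p \<bullet> q)\<^sup>2 / ?V = (norm q)\<^sup>2 / ?V"
  proof -
    have "(p \<bullet> q)\<^sup>2 = a\<^sup>2 * (norm q)\<^sup>2 * (norm q)\<^sup>2"
      by (simp add: p_def power_mult_distrib power2_norm_eq_inner[symmetric])
    then show ?thesis using V V' by (simp add: field_simps)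
  qed
  also have "a * (2 * (DIM('a) - (norm p)\<^sup>2 / ?V)) + b * ((norm q)\<^sup>2 / ?V)
      = 2 * DIM('a) * a + (b - 2 * a ^ 3) * ((norm q)\<^sup>2 / ?V)"
  proof -
    have "(norm p)\<^sup>2 / ?V = a\<^sup>2 * ((norm q)\<^sup>2 / ?V)" by (simp add: p_def power_mult_distrib)
    moreover have "a * (2 * (D - a\<^sup>2 * N)) + b * N = 2 * D * a + (b - 2 * a ^ 3) * N" for D N :: real
      by (simp add: algebra_simps power2_eq_square power3_eq_cube)
    ultimately show ?thesis by (simp only: of_nat_mult of_nat_numeral)
  qed
  also have "\<dots> \<le> 2 * DIM('a) * a"
    using mult_nonpos_nonneg[of "b - 2 * a ^ 3" "(norm q)\<^sup>2 / ?V"] assms(2) V by simp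
  finally show ?thesis by (simp add: p_def)
qed

text \<open>The barrier is \<open>h - \<rho> ln (1 - (|x - c|\<^sup>2 + 2 n t) / \<rho>\<^sup>2) + \<eta> t\<close>: a shrinking sphere with the profile of the
  lower hemisphere replaced by one that is infinite on the boundary.\<close>

lemma mcf_local_upper_bound:
  fixes u :: "'a::euclidean_space \<Rightarrow> real \<Rightarrow> real" and t \<rho> :: real
  assumes u: "mcf u" and \<rho>: "\<rho> > 0" and init: "\<And>x. dist x c \<le> \<rho> \<Longrightarrow> u x 0 \<le> h"
    and t: "t \<ge> 0" "4 * DIM('a) * t \<le> \<rho>\<^sup>2"
  shows "u c t \<le> h + \<rho>"
proof (rule ccontr)
  assume neg: "\<not> u c t \<le> h + \<rho>"
  define n where "n = real DIM('a)"
  have n: "n > 0" by (simp add: n_def)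
  \<comment> \<open>The excess of \<open>u c t\<close> over \<open>h + \<rho>\<close> becomes a
    strict slope in time; the denominator t + 1 keeps \<eta> t below the excess and covers t =
    0.\<close>
  define \<eta> where "\<eta> = (u c t - h - \<rho>) / (t + 1)"
  have \<eta>: "\<eta> > 0" using neg t by (simp add: \<eta>_def)
  have \<eta>t: "u c t - h - \<rho> - \<eta> * t > 0"
    using neg t \<eta> 
  proof -
    have "\<eta> * t < \<eta> * (t + 1)" using \<eta> by simp
    also have "\<dots> = u c t - h - \<rho>" using t by (simp add: \<eta>_def)
    finally show ?thesis by simp
  qed
  define s2 where "s2 x s = (norm (x - c))\<^sup>2 + 2 * n * s" for x :: 'a and s
  define K where "K r = {z. 0 \<le> snd z \<and> s2 (fst z) (snd z) \<le> r}" for r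
  have cpt: "compact (K r)" for r
  proof -
    have "K r \<subseteq> cball c (sqrt r) \<times> {0..r / (2 * n)}"
    proof
      fix z assume z: "z \<in> K r"
      then have "2 * n * snd z \<ge> 0" "(norm (fst z - c))\<^sup>2 + 2 * n * snd z \<le> r"
        using n by (auto simp: K_def s2_def)
      then have "(norm (fst z - c))\<^sup>2 \<le> r" "2 * n * snd z \<le> r"
        using zero_le_power2[of "norm (fst z - c)"] by linarith+
      then have "norm (fst z - c) \<le> sqrt r" "snd z \<le> r / (2 * n)"
        using n by (simp_all add: real_le_rsqrt pos_le_divide_eq mult.commute)
      then show "z \<in> cball c (sqrt r) \<times> {0..r / (2 * n)}"
        using z by (auto simp: K_def mem_Times_iff dist_norm norm_minus_commute)
    qed
    then have "bounded (K r)"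
      by (rule bounded_subset[rotated]) (intro bounded_Times bounded_cball bounded_closed_interval)
    moreover have "closed (K r)"
      unfolding K_def s2_def by (intro closed_Collect_conj closed_Collect_le continuous_intros)
    ultimately show ?thesis using compact_eq_bounded_closed by blast
  qed
  have cont: "continuous_on (K r) (\<lambda>z. u (fst z) (snd z))" for r
    by (rule mcf_continuous[OF u]) (auto intro!: continuous_intros simp: K_def)
  have ct: "s2 c t \<le> \<rho>\<^sup>2 / 2" using t by (simp add: s2_def n_def)
  obtain M where M: "\<And>x s. s \<ge> 0 \<Longrightarrow> s2 x s \<le> \<rho>\<^sup>2 \<Longrightarrow> u x s \<le> M"
  proof -
    have "bounded ((\<lambda>z. u (fst z) (snd z)) ` K (\<rho>\<^sup>2))"
      using compact_continuous_image[OF cont cpt] compact_imp_bounded by blast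
    then obtain M where "\<And>z. z \<in> K (\<rho>\<^sup>2) \<Longrightarrow> \<bar>u (fst z) (snd z)\<bar> \<le> M"
      unfolding bounded_iff by auto
    then have "u x s \<le> M" if "s \<ge> 0" "s2 x s \<le> \<rho>\<^sup>2" for x s
      using that by (force simp: K_def dest: abs_le_D1)
    then show ?thesis using that[of M] by blast
  qed
  \<comment> \<open>On the level \<open>s2 = r\<close> the logarithm contributes exactly \<rho> k,
    which is at least |M - h|, so the barrier exceeds M there. The summand ln 2 forces r >= \<rho>^2
    / 2, which keeps (c, t) in the domain.\<close>
  define k where "k = \<bar>M - h\<bar> / \<rho> + ln 2"
  define r where "r = \<rho>\<^sup>2 * (1 - exp (- k))"
  have "exp (- k) \<le> exp (- ln 2)" using \<rho> by (simp add: k_def)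
  then have ek: "exp (- k) \<le> 1/2" by (simp add: exp_minus)
  have r: "r \<ge> \<rho>\<^sup>2 / 2" "r < \<rho>\<^sup>2" "r > 0"
  proof -
    have "\<rho>\<^sup>2 > 0" using \<rho> by simp
    moreover have "\<rho>\<^sup>2 * (1/2) \<le> r" unfolding r_def using ek by (intro mult_left_mono) auto
    moreover have "r < \<rho>\<^sup>2 * 1" unfolding r_def using \<rho> by (intro mult_strict_left_mono) auto
    ultimately show "r \<ge> \<rho>\<^sup>2 / 2" "r < \<rho>\<^sup>2" "r > 0" by linarith+
  qed
  define w where "w x s = h - \<rho> * ln (1 - s2 x s / \<rho>\<^sup>2) + \<eta> * s" for x s
  have cw: "continuous_on (K r) (\<lambda>z. u (fst z) (snd z) - w (fst z) (snd z))"
  proof -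
    have "1 - s2 (fst z) (snd z) / \<rho>\<^sup>2 > 0" if "z \<in> K r" for z
      using that r \<rho> by (simp add: K_def field_simps)
    then show ?thesis
      unfolding w_def s2_def
      by (intro continuous_intros cont) (use \<rho> in \<open>force simp: s2_def\<close>)+
  qed
  have "(c, t) \<in> K r" using ct r t by (simp add: K_def)
  then obtain z where z: "z \<in> K r"
    "\<And>z'. z' \<in> K r \<Longrightarrow> u (fst z') (snd z') - w (fst z') (snd z') \<le> u (fst z) (snd z) - w (fst z) (snd z)"
    using continuous_attains_sup[OF cpt _ cw] by blast
  define x s where "x = fst z" and "s = snd z"
  have xs: "s \<ge> 0" "s2 x s \<le> r"
    and mx: "\<And>x' s'. s' \<ge> 0 \<Longrightarrow> s2 x' s' \<le> r \<Longrightarrow> u x' s' - w x' s' \<le> u x s - w x s"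
    using z by (auto simp: K_def x_def s_def)
  \<comment> \<open>At (c, t) at most half of \<rho>^2 is used up, so the logarithm costs at most
    \<rho> ln 2, hence at most \<rho>.\<close>
  have "u c t - w c t > 0"
  proof -
    have "s2 c t / \<rho>\<^sup>2 \<le> 1/2" using ct \<rho> by (simp add: pos_divide_le_eq)
    then have "ln (1/2) \<le> ln (1 - s2 c t / \<rho>\<^sup>2)"
      by (subst ln_le_cancel_iff) linarith+
    moreover have "ln (1/2::real) \<ge> -1" using ln_add_one_self_le_self[of 1] by (simp add: ln_div)
    ultimately have "\<rho> * ln (1 - s2 c t / \<rho>\<^sup>2) \<ge> \<rho> * (-1)" using \<rho> by (intro mult_left_mono) auto
    then show ?thesis using \<eta>t by (simp add: w_def)
  qed
  then have pos: "u x s - w x s > 0" using mx[of t c] ct r t by force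
  have s2pos: "s2 x s \<ge> 0" using xs n by (simp add: s2_def)
  have lnneg: "ln (1 - s2 x s / \<rho>\<^sup>2) \<le> 0" using s2pos xs r \<rho> by (simp add: ln_le_zero_iff field_simps)
  have "s \<noteq> 0"
  proof
    assume [simp]: "s = 0"
    have "(norm (x - c))\<^sup>2 \<le> \<rho>\<^sup>2" using xs r by (simp add: s2_def)
    then have "u x 0 \<le> h" using \<rho> by (intro init) (simp add: dist_norm)
    moreover have "w x 0 \<ge> h" using lnneg \<rho> by (simp add: w_def mult_nonneg_nonpos)
    ultimately show False using pos by simp
  qed
  then have s: "s > 0" using xs by simp
  have lt: "s2 x s < r"
  proof (rule ccontr)
    assume "\<not> s2 x s < r"
    then have [simp]: "s2 x s = r" using xs by simp
    have "1 - r / \<rho>\<^sup>2 = exp (- k)" using \<rho> by (simp add: r_def)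
    then have "w x s = h + \<rho> * k + \<eta> * s" by (simp add: w_def)
    moreover have "\<rho> * k \<ge> \<bar>M - h\<bar>" using \<rho> by (simp add: k_def field_simps)
    moreover have "\<eta> * s \<ge> 0" using \<eta> s by simp
    moreover have "u x s \<le> M" using M[of s x] xs r by simp
    ultimately show False using pos by linarith
  qed
  define F where "F y = h - \<rho> * ln (1 - (y + 2 * n * s) / \<rho>\<^sup>2) + \<eta> * s" for y
  define F' where "F' y = \<rho> / (\<rho>\<^sup>2 - (y + 2 * n * s))" for y
  define a where "a = \<rho> / (\<rho>\<^sup>2 - s2 x s)"
  have den: "\<rho>\<^sup>2 - s2 x s > 0" using lt r by simp
  have a: "a > 0" using den \<rho> by (simp add: a_def)
  have dF: "(F has_real_derivative F' y) (at y)" if "y + 2 * n * s < \<rho>\<^sup>2" for y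
    unfolding F_def F'_def using that \<rho>
    by (auto intro!: derivative_eq_intros simp: field_simps power2_eq_square)
  have d2F: "(F' has_real_derivative a\<^sup>2 / \<rho>) (at ((norm (x - c))\<^sup>2))"
  proof -
    define y0 K where "y0 = (norm (x - c))\<^sup>2" and "K = \<rho>\<^sup>2 - 2 * n * s"
    have K: "K - y0 = \<rho>\<^sup>2 - s2 x s" by (simp add: K_def y0_def s2_def)
    then have "K - y0 > 0" using den by simp
    then have "((\<lambda>y. \<rho> / (K - y)) has_real_derivative \<rho> / ((K - y0) * (K - y0))) (at y0)"
      by (auto intro!: derivative_eq_intros)
    moreover have "(\<lambda>y. \<rho> / (K - y)) = F'" by (simp add: F'_def K_def fun_eq_iff algebra_simps)
    moreover have "\<rho> / ((K - y0) * (K - y0)) = a\<^sup>2 / \<rho>"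
      using \<rho> unfolding K by (simp add: a_def power2_eq_square)
    ultimately show ?thesis by (simp add: y0_def)
  qed
  have aF: "F' ((norm (x - c))\<^sup>2) = a" by (simp add: F'_def a_def s2_def)
  have "\<forall>\<^sub>F y in nhds ((norm (x - c))\<^sup>2). y + 2 * n * s < \<rho>\<^sup>2"
    using den by (intro order_tendstoD[of _ "(norm (x - c))\<^sup>2 + 2 * n * s"] tendsto_add filterlim_ident tendsto_const)
      (auto simp: s2_def)
  then have ev: "\<forall>\<^sub>F y in nhds ((norm (x - c))\<^sup>2). (F has_real_derivative F' y) (at y)"
    by eventually_elim (rule dF)
  have w: "w y s = F ((norm (y - c))\<^sup>2)" for y by (simp add: w_def F_def s2_def)
  from jet2_compose[OF jet2_norm_sq ev d2F]
  have jet: "jet2 (\<lambda>y. w y s) x (a *\<^sub>R (2 *\<^sub>R (x - c)))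
      (\<lambda>\<xi>. a * (2 * (norm \<xi>)\<^sup>2) + a\<^sup>2 / \<rho> * ((2 *\<^sub>R (x - c)) \<bullet> \<xi>)\<^sup>2)"
    unfolding w aF .
  have dt: "((\<lambda>s. w x s) has_real_derivative 2 * n * a + \<eta>) (at s)"
    unfolding w_def s2_def a_def using den \<rho>
    by (auto intro!: derivative_eq_intros simp: s2_def field_simps power2_eq_square)
  \<comment> \<open>The summand 2 n s in \<open>s2\<close> lifts the barrier at speed 2 n a, the
    upper bound that \<open>mc_op_radial_le\<close> gives for its curvature; \<eta> is the strict
    margin.\<close>
  have "2 * n * a + \<eta> \<le> mc_op (a *\<^sub>R (2 *\<^sub>R (x - c)))
      (\<lambda>\<xi>. a * (2 * (norm \<xi>)\<^sup>2) + a\<^sup>2 / \<rho> * ((2 *\<^sub>R (x - c)) \<bullet> \<xi>)\<^sup>2)"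
  proof (rule mcf_touch_above[OF u s jet dt _ s])
    have "\<forall>\<^sub>F y in nhds x. s2 y s < r"
    proof (rule order_tendstoD(2)[OF _ lt])
      have "isCont (\<lambda>y. s2 y s) x" unfolding s2_def by (intro continuous_intros)
      then show "((\<lambda>y. s2 y s) \<longlongrightarrow> s2 x s) (nhds x)"
        using tendsto_at_iff_tendsto_nhds[of "\<lambda>y. s2 y s" x] by (simp add: isCont_def)
    qed
    then show "\<forall>\<^sub>F y in nhds x. u y s - w y s \<le> u x s - w x s"
      by eventually_elim (rule mx, use s in auto)
    fix s' assume "s - s \<le> s'" "s' \<le> s"
    then have "0 \<le> s'" "s2 x s' \<le> s2 x s" using n by (auto simp: s2_def)
    then show "u x s' - w x s' \<le> u x s - w x s"
      using lt by (intro mx) auto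
  qed
  also have "\<dots> \<le> 2 * DIM('a) * a"
  proof (rule mc_op_radial_le)
    \<comment> \<open>Here F'' = a^2 / \<rho>, so the criterion F'' <= 2 F'^3 asks for 1 <= 2 a
      \<rho>; the steepness a is at least 1 / \<rho> because \<open>s2\<close> is
      nonnegative.\<close>
    have "a * \<rho> \<ge> 1" using den \<rho> s2pos by (simp add: a_def field_simps power2_eq_square)
    then have "1 / \<rho> \<le> 2 * a" using \<rho> a by (simp add: field_simps)
    then have "a\<^sup>2 * (1 / \<rho>) \<le> a\<^sup>2 * (2 * a)" by (rule mult_left_mono) simp
    then show "a\<^sup>2 / \<rho> \<le> 2 * a ^ 3" by (simp add: power2_eq_square power3_eq_cube)
  qed (use a in simp)
  finally show False using \<eta> by (simp add: n_def)
qed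

section \<open>Comparison of two solutions by doubling the variables\<close>

lemma jet2_sqrt_one_norm_sq:
  fixes x :: "'a::euclidean_space"
  obtains p X where "jet2 (\<lambda>y. sqrt (1 + (norm y)\<^sup>2)) x p X" "norm p \<le> 1" "\<And>\<xi>. X \<xi> \<le> (norm \<xi>)\<^sup>2"
proof -
  let ?F = "\<lambda>y::real. sqrt (1 + y)" and ?F' = "\<lambda>y::real. inverse (2 * sqrt (1 + y))"
  let ?y = "(norm x)\<^sup>2" and ?r = "sqrt (1 + (norm x)\<^sup>2)"
  have r: "?r \<ge> 1" by simp
  have y: "1 + ?y > 0" by (rule add_pos_nonneg) auto
  have d: "(?F has_real_derivative ?F' y) (at y)" if "y > -1" for y
    using that by (auto intro!: derivative_eq_intros simp: field_simps)
  have "-1 < ?y" by (rule order_less_le_trans[of _ 0]) auto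
  then have "\<forall>\<^sub>F y in nhds ?y. y > -1"
    by (intro order_tendstoD[OF filterlim_ident])
  then have ev: "\<forall>\<^sub>F y in nhds ?y. (?F has_real_derivative ?F' y) (at y)"
    by eventually_elim (rule d)
  obtain F2 where F2: "(?F' has_real_derivative F2) (at ?y)" "F2 \<le> 0"
  proof (rule that)
    show "(?F' has_real_derivative - (inverse (2 * ?r) * (2 * inverse (2 * ?r)) * inverse (2 * ?r))) (at ?y)"
      using y by (auto intro!: derivative_eq_intros simp: field_simps)
    show "- (inverse (2 * ?r) * (2 * inverse (2 * ?r)) * inverse (2 * ?r)) \<le> 0"
      using r by simp
  qed
  from jet2_norm_sq[of 0 x] have "jet2 (\<lambda>y. (norm y)\<^sup>2) x (2 *\<^sub>R x) (\<lambda>\<xi>. 2 * (norm \<xi>)\<^sup>2)" by simp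
  from jet2_compose[OF this ev F2(1)]
  have "jet2 (\<lambda>y. sqrt (1 + (norm y)\<^sup>2)) x (inverse (2 * ?r) *\<^sub>R (2 *\<^sub>R x))
    (\<lambda>\<xi>. inverse (2 * ?r) * (2 * (norm \<xi>)\<^sup>2) + F2 * ((2 *\<^sub>R x) \<bullet> \<xi>)\<^sup>2)" .
  then show ?thesis
  proof (rule that)
    have "norm x \<le> ?r" by (simp add: real_le_rsqrt)
    then show "norm (inverse (2 * ?r) *\<^sub>R (2 *\<^sub>R x)) \<le> 1" using r y
      by (simp add: divide_simps)
    fix \<xi> :: 'a
    have "inverse (2 * ?r) * (2 * (norm \<xi>)\<^sup>2) = (norm \<xi>)\<^sup>2 / ?r" by (simp add: field_simps)
    also have "\<dots> \<le> (norm \<xi>)\<^sup>2 / 1" using y by (intro divide_left_mono) auto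
    finally show "inverse (2 * ?r) * (2 * (norm \<xi>)\<^sup>2) + F2 * ((2 *\<^sub>R x) \<bullet> \<xi>)\<^sup>2 \<le> (norm \<xi>)\<^sup>2"
      using mult_nonpos_nonneg[OF F2(2), of "((2 *\<^sub>R x) \<bullet> \<xi>)\<^sup>2"] by simp
  qed
qed

text \<open>Since \<alpha> stays fixed, both gradients at a maximum equal (x - y) / \<alpha> up to
  the slope of the penalty. Testing the Hessian inequality on the pairs
  \<open>metric_root pu b\<close>, \<open>metric_root pv b\<close> bounds the difference of the two
  curvatures by the squared distance of the roots over \<alpha>, which is below the strict slope
  \<mu> once the penalty is small.\<close>

lemma mcf_doubling:
  fixes u v :: "'a::euclidean_space \<Rightarrow> real \<Rightarrow> real"
  assumes u: "mcf u" and v: "mcf v" and \<alpha>: "\<alpha> > 0" and \<mu>: "\<mu> > 0" and L: "L \<ge> 0"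
    and growth: "\<And>x y t. 0 \<le> t \<Longrightarrow> t \<le> T \<Longrightarrow> u x t - v y t \<le> C + L * norm (x - y)"
    and init: "\<And>x y. u x 0 - v y 0 \<le> S + (norm (x - y))\<^sup>2 / (2 * \<alpha>)"
    and t1: "0 \<le> t1" "t1 \<le> T"
  shows "u x1 t1 - v y1 t1 \<le> S + (norm (x1 - y1))\<^sup>2 / (2 * \<alpha>) + \<mu> * t1"
proof (rule ccontr)
  assume neg: "\<not> ?thesis"
  define \<Delta> where "\<Delta> = u x1 t1 - v y1 t1 - (norm (x1 - y1))\<^sup>2 / (2 * \<alpha>) - \<mu> * t1 - S"
  have \<Delta>: "\<Delta> > 0" using neg by (simp add: \<Delta>_def)
  define n where "n = real DIM('a)"
  have n: "n > 0" by (simp add: n_def)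
  \<comment> \<open>The penalty grows linearly, which confines the maximum to a compact set, while
    its slope is at most 1 and its Hessian form at most |\<xi>|^2, so that \<eta> controls all its
    effects.\<close>
  define \<phi> where "\<phi> x = sqrt (1 + (norm x)\<^sup>2)" for x :: 'a
  have \<phi>: "\<phi> x > 0" "norm x \<le> \<phi> x" for x
    by (auto simp: \<phi>_def real_le_rsqrt add_pos_nonneg)
  \<comment> \<open>Linear growth against a quadratic penalty keeps |x - y| below R wherever the
    doubled function exceeds S. R is free of \<eta>, so the slope bound P and the modulus d are
    fixed before \<eta> is chosen; the 1 in P absorbs the slope of the penalty.\<close>
  define R where "R = 1 + 2 * \<alpha> * (L + \<bar>C - S\<bar>)"
  define P where "P = R / \<alpha> + 1"
  define H where "H z = (\<Sum>b\<in>Basis. (norm (metric_root (fst z) b - metric_root (snd z) b))\<^sup>2)" for z :: "'a \<times> 'a"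
  have "uniformly_continuous_on (cball 0 P \<times> cball 0 P) H"
    unfolding H_def
    by (intro compact_uniformly_continuous compact_Times compact_cball continuous_intros
        continuous_on_metric_root)
  moreover have "\<alpha> * \<mu> / 2 > 0" using \<alpha> \<mu> by simp
  ultimately obtain d where d: "d > 0" "\<And>z z'. z \<in> cball 0 P \<times> cball 0 P \<Longrightarrow> z' \<in> cball 0 P \<times> cball 0 P \<Longrightarrow>
    dist z' z < d \<Longrightarrow> dist (H z') (H z) < \<alpha> * \<mu> / 2"
    unfolding uniformly_continuous_on_def by metis
  have H: "H (p, q) < \<alpha> * \<mu> / 2" if "norm p \<le> P" "norm q \<le> P" "norm (p - q) < d" for p q
  proof -
    have "dist (H (p, q)) (H (p, p)) < \<alpha> * \<mu> / 2"
      using that by (intro d(2)) (auto simp: dist_Pair_Pair dist_norm norm_minus_commute)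
    moreover have "H (p, p) = 0" by (simp add: H_def)
    ultimately show ?thesis by (auto simp: dist_real_def)
  qed
  \<comment> \<open>The entries serve in turn: slopes stay below P; the two slopes differ by less
    than d; the Hessians of the penalty cost less than \<mu> / 2; the value at (x1, y1, t1) still
    exceeds S.\<close>
  define \<eta> where "\<eta> = min (min (1/2) (d / 3)) (min (\<mu> / (5 * n)) (\<Delta> / (2 * (\<phi> x1 + \<phi> y1))))"
  have sp: "\<phi> x1 + \<phi> y1 > 0" using \<phi>(1)[of x1] \<phi>(1)[of y1] by linarith
  have \<eta>: "\<eta> > 0" using d(1) \<mu> n \<Delta> sp by (simp add: \<eta>_def)
  have \<eta>1: "\<eta> \<le> 1/2" "\<eta> \<le> d / 3" "\<eta> \<le> \<mu> / (5 * n)" "\<eta> \<le> \<Delta> / (2 * (\<phi> x1 + \<phi> y1))"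
    unfolding \<eta>_def by (meson min.cobounded1 min.cobounded2 order_trans)+
  have \<eta>d: "2 * \<eta> < d" using \<eta>1(2) d(1) by linarith
  have \<eta>n: "2 * n * \<eta> < \<mu> / 2" using \<eta>1(3) n \<mu> by (simp add: field_simps)
  have \<eta>\<Delta>: "\<eta> * (\<phi> x1 + \<phi> y1) < \<Delta>" using \<eta>1(4) sp \<Delta> by (simp add: field_simps)
  define \<Phi> where "\<Phi> x y t = u x t - v y t - (norm (x - y))\<^sup>2 / (2 * \<alpha>) - \<eta> * (\<phi> x + \<phi> y) - \<mu> * t" for x y t
  have \<Phi>1: "\<Phi> x1 y1 t1 > S" using \<eta>\<Delta> by (simp add: \<Phi>_def \<Delta>_def)
  define C' where "C' = C + L\<^sup>2 * \<alpha> / 2"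
  have quad: "L * a - a\<^sup>2 / (2 * \<alpha>) \<le> L\<^sup>2 * \<alpha> / 2" for a
  proof -
    have "0 \<le> (a - L * \<alpha>)\<^sup>2 / (2 * \<alpha>)" using \<alpha> by simp
    also have "\<dots> = L\<^sup>2 * \<alpha> / 2 - (L * a - a\<^sup>2 / (2 * \<alpha>))"
      using \<alpha> by (simp add: field_simps power2_eq_square)
    finally show ?thesis by simp
  qed
  have \<Phi>_le: "\<Phi> x y t \<le> C' - \<eta> * (norm x + norm y)" if "0 \<le> t" "t \<le> T" for x y t
  proof -
    have "\<eta> * (norm x + norm y) \<le> \<eta> * (\<phi> x + \<phi> y)"
      using \<phi>(2)[of x] \<phi>(2)[of y] \<eta> by (intro mult_left_mono) auto
    moreover have "\<mu> * t \<ge> 0" using \<mu> that by simp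
    ultimately show ?thesis
      using growth[OF that, of x y] quad[of "norm (x - y)"] by (simp add: \<Phi>_def C'_def)
  qed
  define r where "r = \<bar>C' - S\<bar> / \<eta> + norm x1 + norm y1"
  let ?B = "(cball (0::'a) r \<times> cball (0::'a) r) \<times> {0..T}"
  have "compact ?B" by (intro compact_Times compact_cball compact_Icc)
  moreover have r0: "\<bar>C' - S\<bar> / \<eta> \<ge> 0" using \<eta> by simp
  then have in1: "((x1, y1), t1) \<in> ?B"
    using t1 by (auto simp: r_def)
  moreover have "continuous_on ?B (\<lambda>z. \<Phi> (fst (fst z)) (snd (fst z)) (snd z))"
    unfolding \<Phi>_def \<phi>_def
    by (intro continuous_intros mcf_continuous[OF u] mcf_continuous[OF v]) (use \<alpha> in auto)
  ultimately obtain z where z: "z \<in> ?B" "\<And>z'. z' \<in> ?B \<Longrightarrow>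
      \<Phi> (fst (fst z')) (snd (fst z')) (snd z') \<le> \<Phi> (fst (fst z)) (snd (fst z)) (snd z)"
    using continuous_attains_sup[of ?B] by blast
  define x y t where "x = fst (fst z)" and "y = snd (fst z)" and "t = snd z"
  have t: "0 \<le> t" "t \<le> T" and mx: "\<And>x' y' t'. norm x' \<le> r \<Longrightarrow> norm y' \<le> r \<Longrightarrow> 0 \<le> t' \<Longrightarrow> t' \<le> T \<Longrightarrow>
      \<Phi> x' y' t' \<le> \<Phi> x y t"
    using z(1) z(2)[of "((_, _), _)"] by (auto simp: x_def y_def t_def)
  have "norm x1 \<le> r" "norm y1 \<le> r" using r0 by (auto simp: r_def)
  then have big: "\<Phi> x y t > S" using \<Phi>1 mx[of x1 y1 t1] t1 by linarith
  have small: "norm x + norm y < r"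
  proof (rule ccontr)
    assume "\<not> norm x + norm y < r"
    then have "norm x + norm y \<ge> \<bar>C' - S\<bar> / \<eta>" using norm_ge_zero[of x1] norm_ge_zero[of y1] unfolding r_def by linarith
    then have "\<eta> * (norm x + norm y) \<ge> \<bar>C' - S\<bar>" using \<eta> by (simp add: field_simps)
    then show False using big \<Phi>_le[OF t, of x y] by linarith
  qed
  then have xr: "norm x < r" "norm y < r" using norm_ge_zero[of x] norm_ge_zero[of y] by linarith+
  have sum_pos: "\<eta> * (\<phi> x + \<phi> y) \<ge> 0" using \<eta> \<phi>(1)[of x] \<phi>(1)[of y] by simp
  have "t \<noteq> 0"
  proof
    assume "t = 0"
    then show False using big init[of x y] sum_pos by (simp add: \<Phi>_def)
  qed
  then have tpos: "t > 0" using t by simp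
  have dist_le: "norm (x - y) \<le> R"
  proof (rule ccontr)
    define \<delta> where "\<delta> = norm (x - y)"
    assume "\<not> norm (x - y) \<le> R"
    then have \<delta>: "\<delta> > R" by (simp add: \<delta>_def)
    have R1: "R \<ge> 1" using \<alpha> L by (simp add: R_def)
    have "S < C + L * \<delta> - \<delta>\<^sup>2 / (2 * \<alpha>)"
      using big growth[OF t, of x y] sum_pos mult_nonneg_nonneg[of \<mu> t] \<mu> t
      unfolding \<Phi>_def \<delta>_def by linarith
    then have "\<delta>\<^sup>2 < 2 * \<alpha> * (L * \<delta> + (C - S))" using \<alpha> by (simp add: field_simps)
    also have "\<dots> \<le> 2 * \<alpha> * (L * \<delta> + \<bar>C - S\<bar> * \<delta>)"
    proof -
      have "\<bar>C - S\<bar> * 1 \<le> \<bar>C - S\<bar> * \<delta>" using \<delta> R1 by (intro mult_left_mono) auto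
      then show ?thesis using \<alpha> by (intro mult_left_mono) auto
    qed
    also have "\<dots> = (R - 1) * \<delta>" by (simp add: R_def algebra_simps)
    finally have "\<delta> * \<delta> < (R - 1) * \<delta>" by (simp add: power2_eq_square)
    then show False using \<delta> R1 by simp
  qed
  obtain pu Xu where pu: "jet2 (\<lambda>y. u y t) x pu Xu" "((\<lambda>s. u x s) has_real_derivative mc_op pu Xu) (at t)"
    using u tpos unfolding mcf_def by blast
  obtain pv Xv where pv: "jet2 (\<lambda>y. v y t) y pv Xv" "((\<lambda>s. v y s) has_real_derivative mc_op pv Xv) (at t)"
    using v tpos unfolding mcf_def by blast
  obtain px Zx where px: "jet2 \<phi> x px Zx" "norm px \<le> 1" "\<And>\<xi>. Zx \<xi> \<le> (norm \<xi>)\<^sup>2"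
    using jet2_sqrt_one_norm_sq unfolding \<phi>_def by blast
  obtain py Zy where py: "jet2 \<phi> y py Zy" "norm py \<le> 1" "\<And>\<xi>. Zy \<xi> \<le> (norm \<xi>)\<^sup>2"
    using jet2_sqrt_one_norm_sq unfolding \<phi>_def by blast
  \<comment> \<open>Lines in the product space with independent directions: setting one of them to 0
    yields the two gradients, and pairs of root vectors yield the curvature estimate.\<close>
  have key: "pu \<bullet> \<xi> - pv \<bullet> \<zeta> - (x - y) \<bullet> (\<xi> - \<zeta>) / \<alpha> - \<eta> * (px \<bullet> \<xi> + py \<bullet> \<zeta>) = 0"
    "Xu \<xi> - Xv \<zeta> - (norm (\<xi> - \<zeta>))\<^sup>2 / \<alpha> - \<eta> * (Zx \<xi> + Zy \<zeta>) \<le> 0" for \<xi> \<zeta>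
  proof -
    let ?g = "\<lambda>s. \<Phi> (x + s *\<^sub>R \<xi>) (y + s *\<^sub>R \<zeta>) t"
    have nrm: "d2 (\<lambda>s. (norm (x - y + s *\<^sub>R (\<xi> - \<zeta>)))\<^sup>2) (2 * ((x - y) \<bullet> (\<xi> - \<zeta>))) (2 * (norm (\<xi> - \<zeta>))\<^sup>2)"
      using jet2_norm_sq[of 0 "x - y"] by (simp add: jet2_def)
    have "d2 (\<lambda>s. u (x + s *\<^sub>R \<xi>) t - v (y + s *\<^sub>R \<zeta>) t
        - 1 / (2 * \<alpha>) * (norm (x - y + s *\<^sub>R (\<xi> - \<zeta>)))\<^sup>2
        - \<eta> * (\<phi> (x + s *\<^sub>R \<xi>) + \<phi> (y + s *\<^sub>R \<zeta>)) - \<mu> * t)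
      (pu \<bullet> \<xi> - pv \<bullet> \<zeta> - 1 / (2 * \<alpha>) * (2 * ((x - y) \<bullet> (\<xi> - \<zeta>))) - \<eta> * (px \<bullet> \<xi> + py \<bullet> \<zeta>) - 0)
      (Xu \<xi> - Xv \<zeta> - 1 / (2 * \<alpha>) * (2 * (norm (\<xi> - \<zeta>))\<^sup>2) - \<eta> * (Zx \<xi> + Zy \<zeta>) - 0)"
      using pu(1) pv(1) px(1) py(1) nrm unfolding jet2_def
      by (intro d2_diff d2_add d2_cmult d2_const) auto
    then have d2: "d2 ?g
      (pu \<bullet> \<xi> - pv \<bullet> \<zeta> - 1 / (2 * \<alpha>) * (2 * ((x - y) \<bullet> (\<xi> - \<zeta>))) - \<eta> * (px \<bullet> \<xi> + py \<bullet> \<zeta>) - 0)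
      (Xu \<xi> - Xv \<zeta> - 1 / (2 * \<alpha>) * (2 * (norm (\<xi> - \<zeta>))\<^sup>2) - \<eta> * (Zx \<xi> + Zy \<zeta>) - 0)"
      by (simp add: \<Phi>_def algebra_simps)
    have "\<forall>\<^sub>F s in nhds 0. x + s *\<^sub>R \<xi> \<in> ball 0 r" "\<forall>\<^sub>F s in nhds 0. y + s *\<^sub>R \<zeta> \<in> ball 0 r"
      using xr by (intro eventually_nhds_line eventually_nhds_in_open; simp)+
    then have "\<forall>\<^sub>F s in nhds 0. ?g s \<le> ?g 0"
      by eventually_elim (use mx t in auto)
    from d2_local_max[OF d2 this]
    show "pu \<bullet> \<xi> - pv \<bullet> \<zeta> - (x - y) \<bullet> (\<xi> - \<zeta>) / \<alpha> - \<eta> * (px \<bullet> \<xi> + py \<bullet> \<zeta>) = 0"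
      "Xu \<xi> - Xv \<zeta> - (norm (\<xi> - \<zeta>))\<^sup>2 / \<alpha> - \<eta> * (Zx \<xi> + Zy \<zeta>) \<le> 0"
      by simp_all
  qed
  have pu_eq: "pu = (1 / \<alpha>) *\<^sub>R (x - y) + \<eta> *\<^sub>R px"
  proof (rule vector_eq_rdot[THEN iffD1], rule allI)
    fix \<xi> show "pu \<bullet> \<xi> = ((1 / \<alpha>) *\<^sub>R (x - y) + \<eta> *\<^sub>R px) \<bullet> \<xi>"
      using key(1)[of \<xi> 0] by (simp add: inner_add_left)
  qed
  have pv_eq: "pv = (1 / \<alpha>) *\<^sub>R (x - y) - \<eta> *\<^sub>R py"
  proof (rule vector_eq_rdot[THEN iffD1], rule allI)
    fix \<xi> show "pv \<bullet> \<xi> = ((1 / \<alpha>) *\<^sub>R (x - y) - \<eta> *\<^sub>R py) \<bullet> \<xi>"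
      using key(1)[of 0 \<xi>] by (simp add: inner_diff_left inner_diff_right diff_divide_distrib)
  qed
  have nxy: "norm ((1 / \<alpha>) *\<^sub>R (x - y)) \<le> R / \<alpha>"
    using divide_right_mono[OF dist_le, of \<alpha>] \<alpha> by (simp only: norm_scaleR) simp
  have npx: "norm (\<eta> *\<^sub>R px) \<le> \<eta>" "norm (\<eta> *\<^sub>R py) \<le> \<eta>"
    using px(2) py(2) \<eta> by (auto simp: mult_left_le)
  have pP: "norm pu \<le> P" "norm pv \<le> P"
    unfolding pu_eq pv_eq P_def
    using norm_triangle_ineq[of "(1 / \<alpha>) *\<^sub>R (x - y)" "\<eta> *\<^sub>R px"]
      norm_triangle_ineq4[of "(1 / \<alpha>) *\<^sub>R (x - y)" "\<eta> *\<^sub>R py"] nxy npx \<eta>1(1) by linarith+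
  have "norm (pu - pv) = norm (\<eta> *\<^sub>R px + \<eta> *\<^sub>R py)" by (simp add: pu_eq pv_eq)
  also have "\<dots> < d" using norm_triangle_ineq[of "\<eta> *\<^sub>R px" "\<eta> *\<^sub>R py"] npx \<eta>d by linarith
  finally have Hpq: "H (pu, pv) < \<alpha> * \<mu> / 2" using H pP by blast
  have "0 \<le> mc_op pu Xu - mc_op pv Xv - \<mu>"
  proof (rule deriv_nonneg_if_left_max[OF _ tpos, of "\<lambda>s. \<Phi> x y s"])
    show "((\<lambda>s. \<Phi> x y s) has_real_derivative mc_op pu Xu - mc_op pv Xv - \<mu>) (at t)"
      unfolding \<Phi>_def using pu(2) pv(2) by (auto intro!: derivative_eq_intros)
    fix s assume "t - t \<le> s" "s \<le> t"
    then show "\<Phi> x y s \<le> \<Phi> x y t" using xr t by (intro mx) auto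
  qed
  also have "mc_op pu Xu - mc_op pv Xv
      = (\<Sum>b\<in>Basis. Xu (metric_root pu b) - Xv (metric_root pv b))"
    by (simp add: mc_op_def sum_subtractf)
  also have "\<dots> \<le> (\<Sum>b\<in>Basis. (norm (metric_root pu b - metric_root pv b))\<^sup>2 / \<alpha> + 2 * \<eta>)"
  proof (rule sum_mono)
    fix b :: 'a assume b: "b \<in> Basis"
    have *: "(norm (metric_root p b))\<^sup>2 \<le> 1" for p
      using norm_metric_root_le[of p b] b by (simp add: power_le_one)
    have "Zx (metric_root pu b) + Zy (metric_root pv b) \<le> 2"
      using px(3)[of "metric_root pu b"] py(3)[of "metric_root pv b"] *[of pu] *[of pv] by linarith
    then have "\<eta> * (Zx (metric_root pu b) + Zy (metric_root pv b)) \<le> \<eta> * 2"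
      using \<eta> by (intro mult_left_mono) auto
    then show "Xu (metric_root pu b) - Xv (metric_root pv b)
      \<le> (norm (metric_root pu b - metric_root pv b))\<^sup>2 / \<alpha> + 2 * \<eta>"
      using key(2)[of "metric_root pu b" "metric_root pv b"] by linarith
  qed
  also have "\<dots> = H (pu, pv) / \<alpha> + 2 * n * \<eta>"
    by (simp add: H_def sum.distrib sum_divide_distrib n_def)
  finally have "\<mu> \<le> H (pu, pv) / \<alpha> + 2 * n * \<eta>" by simp
  moreover have "H (pu, pv) / \<alpha> < \<mu> / 2" using Hpq \<alpha> by (simp add: field_simps)
  ultimately show False using \<eta>n by linarith
qed

lemma le_of_forall_pos_continuous:
  fixes a :: real and f :: "real \<Rightarrow> real"
  assumes "\<And>e. e > 0 \<Longrightarrow> a \<le> f e" "isCont f 0"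
  shows "a \<le> f 0"
proof (rule tendsto_lowerbound)
  show "(f \<longlongrightarrow> f 0) (at_right 0)" using assms(2) by (auto simp: isCont_def intro: tendsto_mono[OF at_le])
  show "\<forall>\<^sub>F e in at_right 0. a \<le> f e"
    using assms(1) by (auto simp: eventually_at_right_field intro: exI[of _ 1])
qed simp

lemma mcf_local_lower_bound:
  fixes u :: "'a::euclidean_space \<Rightarrow> real \<Rightarrow> real" and t \<rho> :: real
  assumes "mcf u" "\<rho> > 0" "\<And>x. dist x c \<le> \<rho> \<Longrightarrow> h \<le> u x 0"
    and "t \<ge> 0" "4 * DIM('a) * t \<le> \<rho>\<^sup>2"
  shows "h - \<rho> \<le> u c t"
  using mcf_local_upper_bound[OF mcf_minus[OF assms(1)], of \<rho> c "-h" t] assms by simp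

text \<open>Local bounds on balls of radius \<rho> turn the initial modulus into linear growth of u
  - v up to time t. Doubling then preserves each quadratic majorant of L |x - y|, and the best
  majorant for the given pair restores the modulus.\<close>

lemma mcf_comparison:
  fixes u v :: "'a::euclidean_space \<Rightarrow> real \<Rightarrow> real"
  assumes u: "mcf u" and v: "mcf v" and L: "L \<ge> 0"
    and init: "\<And>x y. u x 0 - v y 0 \<le> m + L * norm (x - y)" and t: "t \<ge> 0"
  shows "u x t - v y t \<le> m + L * norm (x - y)"
proof -
  define \<rho> where "\<rho> = sqrt (4 * DIM('a) * t) + 1"
  have \<rho>: "\<rho> > 0" using t by (simp add: \<rho>_def add_nonneg_pos)
  have \<rho>t: "4 * DIM('a) * s \<le> \<rho>\<^sup>2" if "s \<le> t" for s :: real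
  proof -
    have "4 * DIM('a) * s \<le> (sqrt (4 * DIM('a) * t))\<^sup>2" using that t by simp
    also have "\<dots> \<le> \<rho>\<^sup>2" unfolding \<rho>_def using t by (intro power_mono) auto
    finally show ?thesis .
  qed
  have growth: "u x s - v y s \<le> (m + 2 * L * \<rho> + 2 * \<rho>) + L * norm (x - y)" if s: "0 \<le> s" "s \<le> t" for x y s
  proof -
    let ?c = "m + L * (norm (x - y) + 2 * \<rho>)"
    have *: "u x' 0 \<le> v y' 0 + ?c" if "dist x' x \<le> \<rho>" "dist y' y \<le> \<rho>" for x' y'
    proof -
      have "norm (x' - y') \<le> norm (x - y) + 2 * \<rho>"
        using that norm_triangle_ineq4[of "x' - x" "y' - y"] norm_triangle_ineq[of "x - y" "(x' - x) - (y' - y)"]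
        by (simp add: dist_norm)
      then have "L * norm (x' - y') \<le> L * (norm (x - y) + 2 * \<rho>)" using L by (rule mult_left_mono)
      then show ?thesis using init[of x' y'] by simp
    qed
    \<comment> \<open>The bound on u holds for all y' near y, hence it is in turn an initial lower
      bound for v on that ball.\<close>
    have "u x s \<le> v y' 0 + ?c + \<rho>" if "dist y' y \<le> \<rho>" for y'
      using mcf_local_upper_bound[OF u \<rho> _ s(1) \<rho>t[OF s(2)]] * that by blast
    then have "u x s - ?c - \<rho> - \<rho> \<le> v y s"
      by (intro mcf_local_lower_bound[OF v \<rho> _ s(1) \<rho>t[OF s(2)]]) (simp add: algebra_simps)
    then show ?thesis by (simp add: algebra_simps)
  qed
  let ?d = "norm (x - y)"
  have "u x t - v y t \<le> m + (L + e) * (?d + e) + e * t" if e: "e > 0" for e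
  proof -
    \<comment> \<open>The sum L^2 \<alpha> / 2 + d^2 / (2 \<alpha>) is least at \<alpha> = d / L,
      with value L d; adding e keeps \<alpha> positive and finite when d or L vanishes.\<close>
    define \<alpha> where "\<alpha> = (?d + e) / (L + e)"
    have \<alpha>: "\<alpha> > 0" using e L by (simp add: \<alpha>_def add_nonneg_pos)
    have "u x 0 - v y 0 \<le> (m + L\<^sup>2 * \<alpha> / 2) + (norm (x - y))\<^sup>2 / (2 * \<alpha>)" for x y
    proof -
      have "0 \<le> (norm (x - y) - L * \<alpha>)\<^sup>2 / (2 * \<alpha>)" using \<alpha> by simp
      also have "\<dots> = L\<^sup>2 * \<alpha> / 2 + (norm (x - y))\<^sup>2 / (2 * \<alpha>) - L * norm (x - y)"
        using \<alpha> by (simp add: field_simps power2_eq_square)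
      finally show ?thesis using init[of x y] by simp
    qed
    from mcf_doubling[OF u v \<alpha> e L growth this t order_refl]
    have "u x t - v y t \<le> m + L\<^sup>2 * \<alpha> / 2 + ?d\<^sup>2 / (2 * \<alpha>) + e * t" by simp
    also have "L\<^sup>2 * \<alpha> / 2 \<le> (L + e)\<^sup>2 * \<alpha> / 2"
      using L e \<alpha> by (intro divide_right_mono mult_right_mono power_mono) auto
    also have "(L + e)\<^sup>2 * \<alpha> / 2 = (L + e) * (?d + e) / 2"
      using L e by (simp add: \<alpha>_def power2_eq_square)
    also have "?d\<^sup>2 / (2 * \<alpha>) \<le> (?d + e)\<^sup>2 / (2 * \<alpha>)"
      using e \<alpha> by (intro divide_right_mono power_mono) auto
    also have "(?d + e)\<^sup>2 / (2 * \<alpha>) = (L + e) * (?d + e) / 2"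
    proof -
      have *: "D\<^sup>2 / (2 * (D / M)) = M * D / 2" if "D \<noteq> 0" "M \<noteq> 0" for D M :: real
        using that by (simp add: power2_eq_square field_simps)
      have "?d + e > 0" "L + e > 0" using e L norm_ge_zero[of "x - y"] by linarith+
      then show ?thesis unfolding \<alpha>_def by (intro *) auto
    qed
    finally show ?thesis by simp
  qed
  from le_of_forall_pos_continuous[of _ "\<lambda>e. m + (L + e) * (?d + e) + e * t", OF this]
  show ?thesis by simp
qed

section \<open>Cones as barriers\<close>

lemma pos_homogeneous_zero:
  assumes "pos_homogeneous k"
  shows "k 0 = 0"
proof -
  have "k ((2::real) *\<^sub>R 0) = 2 * k 0"
    using assms[unfolded pos_homogeneous_def, rule_format, of 2 0] by simp
  then show ?thesis by simp
qed

lemma jet2_norm_unit: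
  fixes \<omega> :: "'a::euclidean_space"
  assumes "norm \<omega> = 1"
  shows "\<exists>X. jet2 norm \<omega> \<omega> X \<and> (\<forall>\<xi>. X \<xi> \<ge> 0)"
proof -
  have ev: "\<forall>\<^sub>F y in nhds ((norm \<omega>)\<^sup>2). (sqrt has_real_derivative inverse (2 * sqrt y)) (at y)"
  proof -
    have "\<forall>\<^sub>F y in nhds ((norm \<omega>)\<^sup>2). (0::real) < y"
      using assms by (intro order_tendstoD[OF filterlim_ident]) simp
    then show ?thesis
    proof eventually_elim
      case (elim y)
      show ?case by (rule DERIV_cong[OF DERIV_real_sqrt[OF elim]]) simp
    qed
  qed
  have d: "((\<lambda>y. inverse (2 * sqrt y)) has_real_derivative - (1/4)) (at ((norm \<omega>)\<^sup>2))"
    using assms by (auto intro!: derivative_eq_intros)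
  from jet2_norm_sq[of 0 \<omega>] have "jet2 (\<lambda>y. (norm y)\<^sup>2) \<omega> (2 *\<^sub>R \<omega>) (\<lambda>\<xi>. 2 * (norm \<xi>)\<^sup>2)" by simp
  from jet2_compose[OF this ev d]
  have "jet2 norm \<omega> \<omega> (\<lambda>\<xi>. (norm \<xi>)\<^sup>2 - (\<omega> \<bullet> \<xi>)\<^sup>2)"
    using assms by (simp add: power_mult_distrib)
  moreover have "(norm \<xi>)\<^sup>2 - (\<omega> \<bullet> \<xi>)\<^sup>2 \<ge> 0" for \<xi>
    using Cauchy_Schwarz_ineq[of \<omega> \<xi>] assms unfolding power2_norm_eq_inner[symmetric] by simp
  ultimately show ?thesis by blast
qed

text \<open>With m the maximum of k - p x on the unit sphere, homogeneity gives k <= p x + m |x|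
  everywhere, with equality at some unit vector. If k lay below p x, then m <= 0 and the right-hand
  side is concave, so the Hessian form of k is nonpositive at the contact point, against mean
  convexity.\<close>

lemma cone_not_below_linear:
  fixes k :: "'a::euclidean_space \<Rightarrow> real"
  assumes hom: "pos_homogeneous k" and cont: "continuous_on UNIV k"
    and jet: "\<And>x. x \<noteq> 0 \<Longrightarrow> jet2 k x (g x) (Z x)"
    and convex: "\<And>x. x \<noteq> 0 \<Longrightarrow> mc_op (g x) (Z x) > 0"
  shows "\<not> (\<forall>x. k x \<le> p \<bullet> x)"
proof
  assume le: "\<forall>x. k x \<le> p \<bullet> x"
  have "continuous_on (sphere 0 1) (\<lambda>x. k x - p \<bullet> x)"
    by (intro continuous_intros continuous_on_subset[OF cont]) auto
  moreover have "sphere (0::'a) 1 \<noteq> {}" by simp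
  ultimately obtain \<omega> where "\<omega> \<in> sphere 0 1" "\<forall>x\<in>sphere 0 1. k x - p \<bullet> x \<le> k \<omega> - p \<bullet> \<omega>"
    using continuous_attains_sup[OF compact_sphere] by blast
  then have \<omega>: "norm \<omega> = 1" "\<And>x. norm x = 1 \<Longrightarrow> k x - p \<bullet> x \<le> k \<omega> - p \<bullet> \<omega>"
    by auto
  define m where "m = k \<omega> - p \<bullet> \<omega>"
  have m: "m \<le> 0" using le by (simp add: m_def)
  have below: "k x - p \<bullet> x - m * norm x \<le> 0" for x
  proof (cases "x = 0")
    case True
    then show ?thesis using pos_homogeneous_zero[OF hom] by simp
  next
    case False
    then have "k x = k (norm x *\<^sub>R (x /\<^sub>R norm x))" by simp
    also have "\<dots> = norm x * k (x /\<^sub>R norm x)"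
      using hom[unfolded pos_homogeneous_def, rule_format, of "norm x" "x /\<^sub>R norm x"] False by simp
    finally have "k x - p \<bullet> x = norm x * (k (x /\<^sub>R norm x) - p \<bullet> (x /\<^sub>R norm x))"
      using False by (simp add: algebra_simps)
    also have "\<dots> \<le> norm x * m"
      using \<omega>(2)[of "x /\<^sub>R norm x"] False by (intro mult_left_mono) (auto simp: m_def)
    finally show ?thesis by (simp add: mult.commute)
  qed
  obtain X where X: "jet2 norm \<omega> \<omega> X" "\<And>\<xi>. X \<xi> \<ge> 0" using jet2_norm_unit[OF \<omega>(1)] by blast
  have \<omega>0: "\<omega> \<noteq> 0" using \<omega> by auto
  have "jet2 (\<lambda>y. k y - p \<bullet> y - m * norm y) \<omega> (g \<omega> - p - m *\<^sub>R \<omega>) (\<lambda>\<xi>. Z \<omega> \<xi> - 0 - m * X \<xi>)"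
    by (intro jet2_diff jet[OF \<omega>0] jet2_inner jet2_cmult X)
  moreover have "\<forall>\<^sub>F y in nhds \<omega>. k y - p \<bullet> y - m * norm y \<le> k \<omega> - p \<bullet> \<omega> - m * norm \<omega>"
    using below \<omega>(1) by (intro always_eventually) (auto simp: m_def)
  ultimately have ZX: "Z \<omega> \<xi> - 0 - m * X \<xi> \<le> 0" for \<xi> by (rule jet2_local_max)
  have "Z \<omega> \<xi> \<le> 0" for \<xi>
    using ZX[of \<xi>] mult_nonpos_nonneg[OF m X(2)[of \<xi>]] by linarith
  then have "mc_op (g \<omega>) (Z \<omega>) \<le> 0" unfolding mc_op_def by (simp add: sum_nonpos)
  then show False using convex[OF \<omega>0] by simp
qed

text \<open>Blow-up at the vertex: along s y the cone equals s k(y) and f equals s p y +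
  o(s).\<close>

lemma cone_touch_at_origin:
  assumes hom: "pos_homogeneous k" and jet: "jet2 f 0 p X" and f0: "f 0 = 0"
    and le: "\<forall>\<^sub>F y in nhds 0. k y \<le> f y"
  shows "k y \<le> p \<bullet> y"
proof (rule ccontr)
  assume neg: "\<not> ?thesis"
  have "((\<lambda>s. f (0 + s *\<^sub>R y)) has_real_derivative p \<bullet> y) (at 0)"
    using jet unfolding jet2_def by (intro d2_deriv) auto
  then have "((\<lambda>s. f (s *\<^sub>R y) - s * k y) has_real_derivative p \<bullet> y - k y) (at 0)"
    by (auto intro!: derivative_eq_intros)
  then obtain d where d: "d > 0" "\<And>h. 0 < h \<Longrightarrow> h < d \<Longrightarrow> f (h *\<^sub>R y) - h * k y < 0"
    using DERIV_neg_dec_right[of "\<lambda>s. f (s *\<^sub>R y) - s * k y" "p \<bullet> y - k y" 0] neg f0 by auto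
  from eventually_nhds_line[OF le, of y] obtain e where e: "e > 0"
    "\<And>s. \<bar>s\<bar> < e \<Longrightarrow> k (0 + s *\<^sub>R y) \<le> f (0 + s *\<^sub>R y)"
    unfolding eventually_nhds_metric dist_real_def by auto
  define h where "h = min d e / 2"
  have h: "0 < h" "h < d" "h < e" using d(1) e(1) by (auto simp: h_def)
  have "k (h *\<^sub>R y) = h * k y" using hom h by (simp add: pos_homogeneous_def)
  then show False using d(2)[OF h(1,2)] e(2)[of h] h by simp
qed

text \<open>The profile of the heat kernel, with \<beta> in place of n / 2 in the power of
  s.\<close>

definition gauss :: "real \<Rightarrow> real \<Rightarrow> 'a::real_inner \<Rightarrow> real \<Rightarrow> real" where
  "gauss N \<beta> x s = N * s powr (- \<beta>) * exp (- (norm x)\<^sup>2 / (4 * s))"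

text \<open>For small \<open>\<beta>\<close> this is a supersolution of every linear equation \<open>f' = a\<^sub>i\<^sub>j f\<^sub>i\<^sub>j\<close> whose coefficients are the
  inverse metric of a graph with slope at most \<open>M\<close>.\<close>

lemma gauss_barrier:
  fixes x :: "'a::euclidean_space"
  assumes N: "N \<ge> 0" and s: "s > 0" and \<beta>: "\<beta> \<le> 1 / (2 * (1 + M\<^sup>2))"
  obtains p X d where "jet2 (\<lambda>y. gauss N \<beta> y s) x p X" "norm p \<le> N * s powr (- \<beta>) / sqrt s"
    "((\<lambda>s. gauss N \<beta> x s) has_real_derivative d) (at s)" "\<And>q. norm q \<le> M \<Longrightarrow> mc_op q X \<le> d"
proof -
  define G where "G = gauss N \<beta> x s"
  have G: "G \<ge> 0" using N by (simp add: G_def gauss_def)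
  define F where "F y = N * s powr (- \<beta>) * exp (- y / (4 * s))" for y
  define F' where "F' y = - (1 / (4 * s)) * F y" for y
  have dF: "(F has_real_derivative F' y) (at y)" for y
    unfolding F'_def F_def using s by (auto intro!: derivative_eq_intros simp: field_simps)
  have FG: "F ((norm x)\<^sup>2) = G" by (simp add: F_def G_def gauss_def)
  have dF': "(F' has_real_derivative G / (16 * s\<^sup>2)) (at ((norm x)\<^sup>2))"
  proof -
    have "(F' has_real_derivative - (1 / (4 * s)) * F' ((norm x)\<^sup>2)) (at ((norm x)\<^sup>2))"
      unfolding F'_def[abs_def] by (intro DERIV_cmult dF[unfolded F'_def])
    moreover have "- (1 / (4 * s)) * F' ((norm x)\<^sup>2) = G / (16 * s\<^sup>2)"
      unfolding F'_def FG using s by (simp add: power2_eq_square)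
    ultimately show ?thesis by simp
  qed
  from jet2_norm_sq[of 0 x] have "jet2 (\<lambda>y. (norm y)\<^sup>2) x (2 *\<^sub>R x) (\<lambda>\<xi>. 2 * (norm \<xi>)\<^sup>2)" by simp
  from jet2_compose[OF this always_eventually dF'] dF
  have "jet2 (\<lambda>y. F ((norm y)\<^sup>2)) x (F' ((norm x)\<^sup>2) *\<^sub>R (2 *\<^sub>R x))
      (\<lambda>\<xi>. F' ((norm x)\<^sup>2) * (2 * (norm \<xi>)\<^sup>2) + G / (16 * s\<^sup>2) * ((2 *\<^sub>R x) \<bullet> \<xi>)\<^sup>2)" by blast
  moreover have "F' ((norm x)\<^sup>2) = - (G / (4 * s))" by (simp add: F'_def FG)
  moreover have "(\<lambda>y. F ((norm y)\<^sup>2)) = (\<lambda>y. gauss N \<beta> y s)" for y :: 'a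
    by (simp add: F_def gauss_def)
  ultimately have jet: "jet2 (\<lambda>y. gauss N \<beta> y s) x (- (G / (2 * s)) *\<^sub>R x)
      (\<lambda>\<xi>. - (G / (2 * s)) * (norm \<xi>)\<^sup>2 + G / (4 * s\<^sup>2) * (x \<bullet> \<xi>)\<^sup>2)"
    by (simp add: F_def gauss_def power_mult_distrib)
  show ?thesis
  proof (rule that[OF jet])
    \<comment> \<open>The self-similar variable: the gradient has length N s^(-\<beta>) / sqrt s
      times z exp (-z^2), so only boundedness of the last factor matters.\<close>
    define z where "z = norm x / (2 * sqrt s)"
    have z: "z \<ge> 0" using s by (simp add: z_def)
    have z2: "z\<^sup>2 = (norm x)\<^sup>2 / (4 * s)" using s by (simp add: z_def power_divide power_mult_distrib)
    have "z * exp (- z\<^sup>2) \<le> 1"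
    proof -
      have "0 \<le> (z - 1/2)\<^sup>2 + 3/4" by simp
      then have "z \<le> 1 + z\<^sup>2" by (simp add: power2_eq_square algebra_simps)
      also have "\<dots> \<le> exp (z\<^sup>2)" by (rule exp_ge_add_one_self)
      finally show ?thesis by (simp add: exp_minus field_simps)
    qed
    have "norm (- (G / (2 * s)) *\<^sub>R x) = G * norm x / (2 * s)" using G s by simp
    also have "\<dots> = N * s powr (- \<beta>) / sqrt s * (z * exp (- z\<^sup>2))"
      unfolding z2 using s by (simp add: G_def gauss_def z_def real_div_sqrt field_simps)
    also have "\<dots> \<le> N * s powr (- \<beta>) / sqrt s * 1"
      using \<open>z * exp (- z\<^sup>2) \<le> 1\<close> N s by (intro mult_left_mono) auto
    finally show "norm (- (G / (2 * s)) *\<^sub>R x) \<le> N * s powr (- \<beta>) / sqrt s" by simp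
    show "((\<lambda>s. gauss N \<beta> x s) has_real_derivative G * (- \<beta> / s + (norm x)\<^sup>2 / (4 * s\<^sup>2))) (at s)"
    proof -
      have p: "((\<lambda>s. s powr (- \<beta>)) has_real_derivative - \<beta> / s * s powr (- \<beta>)) (at s)"
        using s by (auto intro!: derivative_eq_intros simp: powr_diff)
      have e: "((\<lambda>s. exp (- (norm x)\<^sup>2 / (4 * s))) has_real_derivative
          (norm x)\<^sup>2 / (4 * s\<^sup>2) * exp (- (norm x)\<^sup>2 / (4 * s))) (at s)"
        using s by (auto intro!: derivative_eq_intros simp: field_simps power2_eq_square)
      show ?thesis
        unfolding gauss_def G_def
        using DERIV_mult[OF DERIV_cmult[OF p, of N] e]
        by (simp add: algebra_simps)
    qed
    fix q :: 'a assume q: "norm q \<le> M"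
    have \<beta>': "2 * \<beta> \<le> 1 / (1 + M\<^sup>2)"
    proof -
      define c where "c = 1 / (1 + M\<^sup>2)"
      have "1 / (2 * (1 + M\<^sup>2)) = c / 2" by (simp add: c_def)
      then show ?thesis using \<beta> unfolding c_def[symmetric] by linarith
    qed
    have "mc_op q (\<lambda>\<xi>. - (G / (2 * s)) * (norm \<xi>)\<^sup>2 + G / (4 * s\<^sup>2) * (x \<bullet> \<xi>)\<^sup>2)
      = - (G / (2 * s)) * mc_op q (\<lambda>\<xi>. (norm \<xi>)\<^sup>2) + G / (4 * s\<^sup>2) * mc_op q (\<lambda>\<xi>. (x \<bullet> \<xi>)\<^sup>2)"
      by (simp only: mc_op_add mc_op_cmult)
    \<comment> \<open>The isotropic part of the Hessian is negative and needs the lower trace bound,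
      which pays for the decay \<beta> / s; the radial part is positive, and its upper bound is
      exactly the |x|^2 term of the time derivative.\<close>
    also have "\<dots> \<le> - (G / (2 * s)) * (2 * \<beta>) + G / (4 * s\<^sup>2) * (norm x)\<^sup>2"
    proof (rule add_mono)
      show "- (G / (2 * s)) * mc_op q (\<lambda>\<xi>. (norm \<xi>)\<^sup>2) \<le> - (G / (2 * s)) * (2 * \<beta>)"
        using order_trans[OF \<beta>' mc_op_norm_sq_ge[OF q]] G s by (intro mult_left_mono_neg) auto
      show "G / (4 * s\<^sup>2) * mc_op q (\<lambda>\<xi>. (x \<bullet> \<xi>)\<^sup>2) \<le> G / (4 * s\<^sup>2) * (norm x)\<^sup>2"
        using G by (intro mult_left_mono mc_op_inner_sq_le) auto
    qed
    also have "\<dots> = G * (- \<beta> / s + (norm x)\<^sup>2 / (4 * s\<^sup>2))" using s by (simp add: field_simps)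
    finally show "mc_op q (\<lambda>\<xi>. - (G / (2 * s)) * (norm \<xi>)\<^sup>2 + G / (4 * s\<^sup>2) * (x \<bullet> \<xi>)\<^sup>2)
      \<le> G * (- \<beta> / s + (norm x)\<^sup>2 / (4 * s\<^sup>2))" .
  qed
qed

lemma gauss_le: "N \<ge> 0 \<Longrightarrow> s > 0 \<Longrightarrow> gauss N \<beta> x s \<le> N * s powr (- \<beta>)"
  unfolding gauss_def by (simp add: mult_left_le)

text \<open>At a contact point off the vertex the operator has slope g - q, with q the slope of
  Gaussian and penalty. By linearity in the Hessian it splits: the part of k has a sign by
  \<open>robust\<close>, the part of the Gaussian is covered by \<open>gauss_barrier\<close>. At the
  vertex contact would put k below a linear function.\<close>

lemma mcf_above_cone:
  fixes u :: "'a::euclidean_space \<Rightarrow> real \<Rightarrow> real"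
  assumes u: "mcf u" and hom: "pos_homogeneous k" and cont: "continuous_on UNIV k"
    and jet: "\<And>x. x \<noteq> 0 \<Longrightarrow> jet2 k x (g x) (Z x)"
    and gL: "\<And>x. x \<noteq> 0 \<Longrightarrow> norm (g x) \<le> L"
    and robust: "\<And>x q. x \<noteq> 0 \<Longrightarrow> norm q \<le> \<delta> \<Longrightarrow> mc_op (g x - q) (Z x) \<ge> 0"
    and notbelow: "\<And>p. \<not> (\<forall>x. k x \<le> p \<bullet> x)"
    and growth: "\<And>x s. 0 \<le> s \<Longrightarrow> s \<le> t1 \<Longrightarrow> k x - u x s \<le> C"
    and \<delta>: "\<delta> > 0" and N: "N \<ge> 0" and t0: "t0 > 0" and \<beta>: "0 \<le> \<beta>" "\<beta> \<le> 1 / (2 * (1 + (L + \<delta>)\<^sup>2))"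
    and small: "N * t0 powr (- \<beta>) / sqrt t0 \<le> \<delta> / 2"
    and init: "\<And>x. k x - \<epsilon> - gauss N \<beta> x t0 \<le> u x 0"
    and t1: "t1 \<ge> 0"
  shows "k x1 - \<epsilon> - N * (t1 + t0) powr (- \<beta>) \<le> u x1 t1"
proof (rule ccontr)
  assume neg: "\<not> ?thesis"
  define \<Delta> where "\<Delta> = k x1 - \<epsilon> - gauss N \<beta> x1 (t1 + t0) - u x1 t1"
  have \<Delta>: "\<Delta> > 0" using neg gauss_le[of N "t1 + t0" \<beta> x1] N t0 t1 by (simp add: \<Delta>_def)
  define n where "n = real DIM('a)"
  have n: "n > 0" by (simp add: n_def)
  define \<phi> where "\<phi> x = sqrt (1 + (norm x)\<^sup>2)" for x :: 'a
  have \<phi>: "\<phi> x > 0" "norm x \<le> \<phi> x" for x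
    by (auto simp: \<phi>_def real_le_rsqrt add_pos_nonneg)
  \<comment> \<open>In the time slope n + 1 of the penalty, n pays for its curvature and 1 is the
    strict margin.\<close>
  define c where "c = \<phi> x1 + (n + 1) * t1"
  have c: "c > 0" using \<phi>(1)[of x1] n t1 by (simp add: c_def add_pos_nonneg)
  \<comment> \<open>The Gaussian uses the other half of the admissible slope \<delta>; the second
    entry keeps the violation at (x1, t1) positive.\<close>
  define \<eta> where "\<eta> = min (\<delta> / 2) (\<Delta> / (2 * c))"
  have \<eta>: "\<eta> > 0" "\<eta> \<le> \<delta> / 2" "\<eta> \<le> \<Delta> / (2 * c)" using \<delta> \<Delta> c by (auto simp: \<eta>_def)
  have \<eta>\<Delta>: "\<eta> * c < \<Delta>" using \<eta>(3) c \<Delta> by (simp add: field_simps)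
  define \<Phi> where "\<Phi> x t = k x - u x t - \<epsilon> - gauss N \<beta> x (t + t0) - \<eta> * (\<phi> x + (n + 1) * t)" for x t
  have pos1: "\<Phi> x1 t1 > 0" using \<eta>\<Delta> by (simp add: \<Phi>_def \<Delta>_def c_def)
  have gpos: "gauss N \<beta> x s \<ge> 0" for x :: 'a and s using N by (simp add: gauss_def)
  have \<Phi>_le: "\<Phi> x t \<le> C - \<epsilon> - \<eta> * norm x" if "0 \<le> t" "t \<le> t1" for x t
  proof -
    have "norm x \<le> \<phi> x + (n + 1) * t" using \<phi>(2)[of x] that n by (simp add: add_increasing2)
    then have "\<eta> * norm x \<le> \<eta> * (\<phi> x + (n + 1) * t)" using \<eta>(1) by (intro mult_left_mono) auto
    then show ?thesis using growth[OF that, of x] gpos[of x "t + t0"] by (simp add: \<Phi>_def)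
  qed
  define r where "r = \<bar>C - \<epsilon>\<bar> / \<eta> + norm x1 + 1"
  have r: "norm x1 \<le> r" "\<bar>C - \<epsilon>\<bar> / \<eta> < r" using \<eta> by (auto simp: r_def add_nonneg_pos)
  let ?B = "cball (0::'a) r \<times> {0..t1}"
  have cB: "compact ?B" by (intro compact_Times compact_cball compact_Icc)
  have in1: "(x1, t1) \<in> ?B" using r t1 by auto
  have contB: "continuous_on ?B (\<lambda>z. \<Phi> (fst z) (snd z))"
    unfolding \<Phi>_def \<phi>_def gauss_def
    by (intro continuous_intros mcf_continuous[OF u] continuous_on_compose2[OF cont]) (use t0 in auto)
  obtain z where z: "z \<in> ?B" "\<And>z'. z' \<in> ?B \<Longrightarrow> \<Phi> (fst z') (snd z') \<le> \<Phi> (fst z) (snd z)"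
    using continuous_attains_sup[OF cB _ contB] in1 by blast
  define x t where "x = fst z" and "t = snd z"
  have t: "0 \<le> t" "t \<le> t1" and mx: "\<And>x' t'. norm x' \<le> r \<Longrightarrow> 0 \<le> t' \<Longrightarrow> t' \<le> t1 \<Longrightarrow> \<Phi> x' t' \<le> \<Phi> x t"
    using z(1) z(2)[of "(_, _)"] by (auto simp: x_def t_def)
  have big: "\<Phi> x t > 0" using pos1 mx[OF r(1) t1 order_refl] by linarith
  have xr: "norm x < r"
  proof (rule ccontr)
    assume "\<not> norm x < r"
    then have "norm x > \<bar>C - \<epsilon>\<bar> / \<eta>" using r by linarith
    then have "\<eta> * norm x > \<bar>C - \<epsilon>\<bar>" using \<eta> by (simp add: field_simps)
    then show False using big \<Phi>_le[OF t, of x] by linarith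
  qed
  have "t \<noteq> 0"
  proof
    assume "t = 0"
    moreover have "\<eta> * \<phi> x \<ge> 0" using \<eta> \<phi>(1)[of x] by simp
    ultimately show False using big init[of x] by (simp add: \<Phi>_def)
  qed
  then have tpos: "t > 0" using t by simp
  have st: "t + t0 > 0" using tpos t0 by simp
  obtain pg Xg dg where pg: "jet2 (\<lambda>y. gauss N \<beta> y (t + t0)) x pg Xg"
    "norm pg \<le> N * (t + t0) powr (- \<beta>) / sqrt (t + t0)"
    "((\<lambda>s. gauss N \<beta> x s) has_real_derivative dg) (at (t + t0))"
    "\<And>q. norm q \<le> L + \<delta> \<Longrightarrow> mc_op q Xg \<le> dg"
    using gauss_barrier[OF N st \<beta>(2)] by metis
  \<comment> \<open>The slope bound decreases in time, so flatness at t0 persists.\<close>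
  have "norm pg \<le> N * t0 powr (- \<beta>) / sqrt t0"
    using N t0 tpos \<beta>(1) by (intro order_trans[OF pg(2)] frac_le mult_left_mono powr_mono2') auto
  then have pg2: "norm pg \<le> \<delta> / 2" using small by linarith
  obtain px Zx where px: "jet2 \<phi> x px Zx" "norm px \<le> 1" "\<And>\<xi>. Zx \<xi> \<le> (norm \<xi>)\<^sup>2"
    using jet2_sqrt_one_norm_sq unfolding \<phi>_def by blast
  define q where "q = pg + \<eta> *\<^sub>R px"
  have qd: "norm q \<le> \<delta>"
  proof -
    have "norm (\<eta> *\<^sub>R px) \<le> \<eta>" using px(2) \<eta> by (simp add: mult_left_le)
    then show ?thesis using pg2 \<eta>(2) norm_triangle_ineq[of pg "\<eta> *\<^sub>R px"] unfolding q_def by linarith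
  qed
  have near: "\<forall>\<^sub>F y in nhds x. norm y \<le> r"
  proof -
    have "\<forall>\<^sub>F y in nhds x. y \<in> ball 0 r" using xr by (intro eventually_nhds_in_open) auto
    then show ?thesis by eventually_elim auto
  qed
  show False
  proof (cases "x = 0")
    case False
    define w where "w y s = gauss N \<beta> y (s + t0) + \<eta> * \<phi> y + \<eta> * (n + 1) * s + \<epsilon> - k y" for y s
    have \<Phi>w: "\<Phi> y s = - u y s - w y s" for y s by (simp add: \<Phi>_def w_def algebra_simps)
    have jw: "jet2 (\<lambda>y. w y t) x (pg + \<eta> *\<^sub>R px + 0 + 0 - g x) (\<lambda>\<xi>. Xg \<xi> + \<eta> * Zx \<xi> + 0 + 0 - Z x \<xi>)"
      unfolding w_def
      by (intro jet2_diff jet2_add jet2_const jet2_cmult pg(1) px(1) jet[OF False])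
    have "((\<lambda>s. gauss N \<beta> x (s + t0)) has_real_derivative dg) (at t)"
      using DERIV_shift[THEN iffD1, OF pg(3)] .
    then have dw: "((\<lambda>s. w x s) has_real_derivative dg + \<eta> * (n + 1)) (at t)"
      unfolding w_def by (auto intro!: derivative_eq_intros)
    have "dg + \<eta> * (n + 1) \<le> mc_op (pg + \<eta> *\<^sub>R px + 0 + 0 - g x) (\<lambda>\<xi>. Xg \<xi> + \<eta> * Zx \<xi> + 0 + 0 - Z x \<xi>)"
    proof (rule mcf_touch_above[OF mcf_minus[OF u] tpos jw dw _ tpos])
      show "\<forall>\<^sub>F y in nhds x. - u y t - w y t \<le> - u x t - w x t"
        using near unfolding \<Phi>w[symmetric] by eventually_elim (use mx t in auto)
      fix s assume "t - t \<le> s" "s \<le> t"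
      then show "- u x s - w x s \<le> - u x t - w x t"
        unfolding \<Phi>w[symmetric] using xr t by (intro mx) auto
    qed
    also have "\<dots> = mc_op (- (g x - q)) (\<lambda>\<xi>. - (Z x \<xi>)) + mc_op (- (g x - q)) Xg
        + \<eta> * mc_op (- (g x - q)) Zx"
    proof -
      have "pg + \<eta> *\<^sub>R px + 0 + 0 - g x = - (g x - q)" by (simp add: q_def)
      moreover have "(\<lambda>\<xi>. Xg \<xi> + \<eta> * Zx \<xi> + 0 + 0 - Z x \<xi>) = (\<lambda>\<xi>. - (Z x \<xi>) + Xg \<xi> + \<eta> * Zx \<xi>)"
        by (simp add: fun_eq_iff)
      ultimately show ?thesis by (simp only: mc_op_add mc_op_cmult)
    qed
    also have "\<dots> \<le> 0 + dg + \<eta> * n"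
    proof (intro add_mono)
      show "mc_op (- (g x - q)) (\<lambda>\<xi>. - (Z x \<xi>)) \<le> 0"
        using robust[OF False qd] unfolding mc_op_minus by simp
      have "norm (- (g x - q)) \<le> L + \<delta>"
        unfolding norm_minus_cancel using norm_triangle_ineq4[of "g x" q] gL[OF False] qd by linarith
      then show "mc_op (- (g x - q)) Xg \<le> dg" by (rule pg(4))
      have "mc_op (- (g x - q)) Zx \<le> n"
        using mc_op_mono[of Zx _ "- (g x - q)", OF px(3)] mc_op_norm_sq_le[of "- (g x - q)"]
        by (simp add: n_def)
      then show "\<eta> * mc_op (- (g x - q)) Zx \<le> \<eta> * n" using \<eta> by (intro mult_left_mono) auto
    qed
    finally show False using \<eta>(1) by (simp add: algebra_simps)
  next
    case True
    obtain pu Xu where pu: "jet2 (\<lambda>y. u y t) x pu Xu" using u tpos unfolding mcf_def by blast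
    \<comment> \<open>k has no jet assumed at the vertex, but \<open>u\<close> plus the smooth
      corrections does; the added constant makes this sum touch k from above with value 0.\<close>
    let ?f = "\<lambda>y. u y t + gauss N \<beta> y (t + t0) + \<eta> * \<phi> y + (\<eta> * (n + 1) * t + \<epsilon> + \<Phi> x t)"
    have f: "?f y = k y + (\<Phi> x t - \<Phi> y t)" for y by (simp add: \<Phi>_def algebra_simps)
    have "jet2 ?f 0 (pu + pg + \<eta> *\<^sub>R px + 0) (\<lambda>\<xi>. Xu \<xi> + Xg \<xi> + \<eta> * Zx \<xi> + 0)"
      using pu pg(1) px(1) unfolding True by (intro jet2_add jet2_const jet2_cmult)
    moreover have "?f 0 = 0" using pos_homogeneous_zero[OF hom] f[of 0] True by simp
    moreover have "\<forall>\<^sub>F y in nhds 0. k y \<le> ?f y"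
      using near unfolding True
    proof eventually_elim
      case (elim y)
      then show ?case using f[of y] mx[of y t] t True by simp
    qed
    ultimately have "\<forall>y. k y \<le> (pu + pg + \<eta> *\<^sub>R px + 0) \<bullet> y"
      using cone_touch_at_origin[OF hom] by blast
    then show False using notbelow by blast
  qed
qed

section \<open>Short-time behaviour of expanding solutions\<close>

text \<open>The barrier is \<open>k x + t (\<kappa> \<omega> + 2 \<eta>) + B |x - \<omega>|\<^sup>2\<close> on a small ball around \<open>\<omega>\<close>; the growth bound
  keeps \<open>U\<close> below it on the lateral boundary for a short time.\<close>

lemma mcf_short_time_upper:
  fixes U :: "'a::euclidean_space \<Rightarrow> real \<Rightarrow> real"
  assumes U: "mcf U" and cont: "continuous_on UNIV k" and init: "\<And>x. U x 0 \<le> k x"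
    and growth: "\<And>x t. t \<ge> 0 \<Longrightarrow> U x t \<le> k x + C * sqrt t"
    and pos: "C \<ge> 0" "\<eta> > 0" "\<rho> > 0" "B > 0"
    and jet: "\<And>\<omega> x. norm \<omega> = 1 \<Longrightarrow> dist x \<omega> \<le> \<rho> \<Longrightarrow> \<exists>p X. jet2 k x p X \<and>
      mc_op (p + (2 * B) *\<^sub>R (x - \<omega>)) (\<lambda>\<xi>. X \<xi> + 2 * B * (norm \<xi>)\<^sup>2) \<le> \<kappa> \<omega> + \<eta>"
    and K: "\<And>\<omega>. norm \<omega> = 1 \<Longrightarrow> \<bar>\<kappa> \<omega>\<bar> \<le> K" "K \<ge> 0"
  shows "\<exists>\<tau>>0. \<forall>\<omega> t. norm \<omega> = 1 \<longrightarrow> 0 \<le> t \<longrightarrow> t \<le> \<tau> \<longrightarrow> U \<omega> t \<le> k \<omega> + t * (\<kappa> \<omega> + 2 * \<eta>)"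
proof -
  \<comment> \<open>On the lateral boundary the quadratic is worth B \<rho>^2 and has to beat C sqrt
    t + K t, which is at most a (C + K) for sqrt t <= a <= 1. The resulting time a^2 is the same for
    all \<omega>.\<close>
  define a where "a = min 1 (B * \<rho>\<^sup>2 / (C + K + 1))"
  have a: "a > 0" "a \<le> 1" "a * (C + K) \<le> B * \<rho>\<^sup>2"
  proof -
    have D: "C + K + 1 > 0" using pos K by simp
    show "a > 0" "a \<le> 1" using pos D by (auto simp: a_def)
    have "a * (C + K) \<le> a * (C + K + 1)" using \<open>a > 0\<close> by simp
    also have "\<dots> \<le> B * \<rho>\<^sup>2 / (C + K + 1) * (C + K + 1)"
      using D by (intro mult_right_mono) (auto simp: a_def)
    finally show "a * (C + K) \<le> B * \<rho>\<^sup>2" using D by simp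
  qed
  have small: "C * sqrt t + K * t \<le> B * \<rho>\<^sup>2" if "0 \<le> t" "t \<le> a\<^sup>2" for t
  proof -
    have st: "sqrt t \<le> a" using that a by (intro real_le_lsqrt) auto
    have "t = sqrt t * sqrt t" using that by simp
    also have "\<dots> \<le> 1 * sqrt t" using order_trans[OF st a(2)] that by (intro mult_right_mono) simp_all
    finally have "t \<le> a" using st by simp
    then have "C * sqrt t + K * t \<le> C * a + K * a"
      using st pos K by (intro add_mono mult_left_mono) auto
    then show ?thesis using a(3) by (simp add: algebra_simps)
  qed
  have "U \<omega> t1 \<le> k \<omega> + t1 * (\<kappa> \<omega> + 2 * \<eta>)" if \<omega>: "norm \<omega> = 1" and t1: "0 \<le> t1" "t1 \<le> a\<^sup>2" for \<omega> t1
  proof (rule ccontr)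
    assume neg: "\<not> ?thesis"
    define w where "w x t = k x + t * (\<kappa> \<omega> + 2 * \<eta>) + B * (norm (x - \<omega>))\<^sup>2" for x t
    let ?B = "cball \<omega> \<rho> \<times> {0..t1}"
    have cB: "compact ?B" by (intro compact_Times compact_cball compact_Icc)
    have in1: "(\<omega>, t1) \<in> ?B" using t1 pos by auto
    have contB: "continuous_on ?B (\<lambda>z. U (fst z) (snd z) - w (fst z) (snd z))"
      unfolding w_def
      by (intro continuous_intros mcf_continuous[OF U] continuous_on_compose2[OF cont]) auto
    obtain z where z: "z \<in> ?B" "\<And>z'. z' \<in> ?B \<Longrightarrow>
        U (fst z') (snd z') - w (fst z') (snd z') \<le> U (fst z) (snd z) - w (fst z) (snd z)"
      using continuous_attains_sup[OF cB _ contB] in1 by blast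
    define x t where "x = fst z" and "t = snd z"
    have t: "0 \<le> t" "t \<le> t1" and x: "dist x \<omega> \<le> \<rho>"
      and mx: "\<And>x' t'. dist x' \<omega> \<le> \<rho> \<Longrightarrow> 0 \<le> t' \<Longrightarrow> t' \<le> t1 \<Longrightarrow> U x' t' - w x' t' \<le> U x t - w x t"
      using z(1) z(2)[of "(_, _)"] by (auto simp: x_def t_def dist_commute)
    have "U \<omega> t1 - w \<omega> t1 > 0" using neg by (simp add: w_def)
    then have big: "U x t - w x t > 0" using mx[of \<omega> t1] t1 pos by auto
    have sq: "B * (norm (x - \<omega>))\<^sup>2 \<ge> 0" using pos by simp
    have "t \<noteq> 0"
    proof
      assume "t = 0"
      then show False using big init[of x] sq by (simp add: w_def)
    qed
    then have tpos: "t > 0" using t by simp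
    have lt: "dist x \<omega> < \<rho>"
    proof (rule ccontr)
      assume "\<not> dist x \<omega> < \<rho>"
      then have "norm (x - \<omega>) = \<rho>" using x by (simp add: dist_norm)
      moreover have "t * (\<kappa> \<omega> + 2 * \<eta>) \<ge> t * (- K)"
        using K(1)[OF \<omega>] pos t by (intro mult_left_mono) auto
      ultimately have "w x t \<ge> k x - K * t + B * \<rho>\<^sup>2" by (simp add: w_def mult.commute)
      then show False using big growth[OF t(1), of x] small[OF t(1)] t t1 by simp
    qed
    obtain p X where X: "jet2 k x p X"
      "mc_op (p + (2 * B) *\<^sub>R (x - \<omega>)) (\<lambda>\<xi>. X \<xi> + 2 * B * (norm \<xi>)\<^sup>2) \<le> \<kappa> \<omega> + \<eta>"
      using jet[OF \<omega> x] by blast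
    have jw: "jet2 (\<lambda>y. w y t) x (p + 0 + B *\<^sub>R (2 *\<^sub>R (x - \<omega>))) (\<lambda>\<xi>. X \<xi> + 0 + B * (2 * (norm \<xi>)\<^sup>2))"
      unfolding w_def by (intro jet2_add jet2_const jet2_cmult jet2_norm_sq X)
    have dw: "((\<lambda>s. w x s) has_real_derivative \<kappa> \<omega> + 2 * \<eta>) (at t)"
      unfolding w_def by (auto intro!: derivative_eq_intros)
    \<comment> \<open>One \<eta> covers the curvature error of the barrier, the other is the strict
      margin.\<close>
    have "\<kappa> \<omega> + 2 * \<eta> \<le> mc_op (p + 0 + B *\<^sub>R (2 *\<^sub>R (x - \<omega>))) (\<lambda>\<xi>. X \<xi> + 0 + B * (2 * (norm \<xi>)\<^sup>2))"
    proof (rule mcf_touch_above[OF U tpos jw dw _ tpos])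
      have "\<forall>\<^sub>F y in nhds x. y \<in> ball \<omega> \<rho>"
        using lt by (intro eventually_nhds_in_open) (auto simp: dist_commute)
      then show "\<forall>\<^sub>F y in nhds x. U y t - w y t \<le> U x t - w x t"
        by eventually_elim (use mx t in \<open>auto simp: dist_commute\<close>)
      fix s assume "t - t \<le> s" "s \<le> t"
      then show "U x s - w x s \<le> U x t - w x t" using x t by (intro mx) auto
    qed
    then show False using X(2) pos by (simp add: mult.assoc mult.left_commute[of B] mult.commute[of B 2])
  qed
  then show ?thesis using a(1) by (intro exI[of _ "a\<^sup>2"]) auto
qed

text \<open>A one-sided bound suffices: both comparisons leave a later expander minus an earlier
  one. On |x| <= \<delta> t the shift is undone by a dilation close to 1, elsewhere by the dilation
  that sends x to the unit sphere.\<close>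

lemma expander_time_shift:
  fixes U :: "'a::euclidean_space \<Rightarrow> real \<Rightarrow> real"
  assumes self: "\<And>x t. t > 0 \<Longrightarrow> U x t = sqrt t * U (x /\<^sub>R sqrt t) 1"
    and lip: "\<And>x y t. t \<ge> 0 \<Longrightarrow> U x t - U y t \<le> L * norm (x - y)" and L: "L \<ge> 0"
    and short: "\<And>\<eta>. \<eta> > 0 \<Longrightarrow> \<exists>\<tau>>0. \<forall>\<omega> t. norm \<omega> = 1 \<longrightarrow> 0 \<le> t \<longrightarrow> t \<le> \<tau> \<longrightarrow>
      \<bar>U \<omega> t - (k \<omega> + t * \<kappa> \<omega>)\<bar> \<le> \<eta> * t"
    and K: "\<And>\<omega>. norm \<omega> = 1 \<Longrightarrow> \<bar>\<kappa> \<omega>\<bar> \<le> K" "K \<ge> 0"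
    and \<tau>: "\<tau> > 0" and e: "e > 0"
  shows "\<exists>T>0. \<forall>t\<ge>T. \<forall>x. U x (t + \<tau>) - U x t \<le> e"
proof -
  \<comment> \<open>Parabolic scaling by any r, applied below with r = sqrt ((t + \<tau>) / t) to
    match the two times and with r = |x| to reach the short-time expansion.\<close>
  have scale: "U x t = r * U (x /\<^sub>R r) (t / r\<^sup>2)" if "r > 0" "t > 0" for x r t
  proof -
    have s: "sqrt (t / r\<^sup>2) = sqrt t / r" using that by (simp add: real_sqrt_divide)
    have "U (x /\<^sub>R r) (t / r\<^sup>2) = sqrt t / r * U ((x /\<^sub>R r) /\<^sub>R (sqrt t / r)) 1"
      using self[of "t / r\<^sup>2" "x /\<^sub>R r"] that unfolding s by simp
    also have "(x /\<^sub>R r) /\<^sub>R (sqrt t / r) = x /\<^sub>R sqrt t" using that by (simp add: divide_inverse)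
    finally show ?thesis using self[OF that(2), of x] that by simp
  qed
  define f where "f = \<bar>U 0 1\<bar>"
  \<comment> \<open>The inner region costs \<tau> L \<delta>, to be at most e / 2; the added 1
    covers L = 0.\<close>
  define \<delta> where "\<delta> = e / (2 * (\<tau> * L + 1))"
  have tL: "\<tau> * L + 1 > 0" using \<tau> L by (simp add: add_nonneg_pos)
  have \<delta>: "\<delta> > 0" "\<tau> * L * \<delta> \<le> e / 2"
  proof -
    show "\<delta> > 0" using tL e by (simp add: \<delta>_def)
    have "\<tau> * L * \<delta> \<le> (\<tau> * L + 1) * \<delta>" using \<open>\<delta> > 0\<close> by simp
    also have "\<dots> = e / 2"
      using tL nonzero_mult_div_cancel_left[of "\<tau> * L + 1" "e / 2"] unfolding \<delta>_def by simp
    finally show "\<tau> * L * \<delta> \<le> e / 2" .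
  qed
  \<comment> \<open>In the outer region the two expansion errors add up to at most 3 \<eta> /
    \<delta>, which is e / 2.\<close>
  define \<eta> where "\<eta> = e * \<delta> / 6"
  have \<eta>: "\<eta> > 0" using e \<delta> by (simp add: \<eta>_def)
  obtain \<tau>0 where \<tau>0: "\<tau>0 > 0" "\<And>\<omega> t. norm \<omega> = 1 \<Longrightarrow> 0 \<le> t \<Longrightarrow> t \<le> \<tau>0 \<Longrightarrow>
      \<bar>U \<omega> t - (k \<omega> + t * \<kappa> \<omega>)\<bar> \<le> \<eta> * t"
    using short[OF \<eta>] by blast
  \<comment> \<open>The summands ensure in turn: t + \<tau> <= 2 t; \<tau> f / (2 sqrt t) <= e / 2
    from the value at the vertex; rescaled times below \<tau>0; \<tau> K / (\<delta> t) <= e /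
    2.\<close>
  define T where "T = \<tau> + (\<tau> * f / e)\<^sup>2 + 2 / (\<tau>0 * \<delta>\<^sup>2) + 2 * \<tau> * K / (\<delta> * e)"
  have terms: "(\<tau> * f / e)\<^sup>2 \<ge> 0" "2 / (\<tau>0 * \<delta>\<^sup>2) \<ge> 0" "2 * \<tau> * K / (\<delta> * e) \<ge> 0"
    using \<tau> \<tau>0 K \<delta> e by auto
  have T: "T > 0" using terms \<tau> unfolding T_def by linarith
  have "U x (t + \<tau>) - U x t \<le> e" if t: "t \<ge> T" for t x
  proof -
    have tp: "t > 0" "t \<ge> \<tau>" "t \<ge> (\<tau> * f / e)\<^sup>2" "t \<ge> 2 / (\<tau>0 * \<delta>\<^sup>2)" "t \<ge> 2 * \<tau> * K / (\<delta> * e)"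
      using t terms \<tau> unfolding T_def by linarith+
    show ?thesis
    proof (cases "norm x \<le> \<delta> * t")
      case True
      define l where "l = sqrt ((t + \<tau>) / t)"
      have l1: "l \<ge> 1" using tp \<tau> by (simp add: l_def)
      have l2: "l\<^sup>2 = (t + \<tau>) / t" using tp \<tau> by (simp add: l_def)
      have "l \<le> 1 + \<tau> / (2 * t)"
        unfolding l_def
      proof (rule real_le_lsqrt)
        have "(1 + \<tau> / (2 * t))\<^sup>2 = 1 + \<tau> / t + (\<tau> / (2 * t))\<^sup>2"
          using tp by (simp add: power2_eq_square field_simps)
        then show "(t + \<tau>) / t \<le> (1 + \<tau> / (2 * t))\<^sup>2" using tp by (simp add: add_divide_distrib)
      qed (use tp \<tau> in auto)
      then have l3: "l - 1 \<le> \<tau> / (2 * t)" by simp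
      have Ul: "U x (t + \<tau>) = l * U (x /\<^sub>R l) t"
        using scale[of l "t + \<tau>" x] l1 tp \<tau> by (simp add: l2)
      have n1: "norm (x /\<^sub>R l) \<le> norm x"
        using l1 mult_right_mono[of "inverse l" 1 "norm x"] by (simp add: inverse_le_1_iff)
      have "U (x /\<^sub>R l) t \<le> U 0 t + L * norm (x /\<^sub>R l)" using lip[of t "x /\<^sub>R l" 0] tp by simp
      also have "L * norm (x /\<^sub>R l) \<le> L * norm x" using n1 L by (rule mult_left_mono)
      also have "U 0 t \<le> sqrt t * f"
        using self[of t 0] tp by (simp add: f_def)
      finally have A: "U (x /\<^sub>R l) t \<le> sqrt t * f + L * norm x" by simp
      have "x /\<^sub>R l - x = - ((1 - 1 / l) *\<^sub>R x)" by (simp add: algebra_simps divide_inverse)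
      then have "norm (x /\<^sub>R l - x) = (1 - 1 / l) * norm x" using l1 by simp
      also have "\<dots> \<le> (l - 1) * norm x"
      proof (rule mult_right_mono)
        have "0 \<le> (l - 1)\<^sup>2 / l" using l1 by simp
        also have "\<dots> = (l - 1) - (1 - 1 / l)" using l1 by (simp add: field_simps power2_eq_square)
        finally show "1 - 1 / l \<le> l - 1" by simp
      qed simp
      finally have "L * norm (x /\<^sub>R l - x) \<le> L * ((l - 1) * norm x)" using L by (rule mult_left_mono)
      then have Bd: "U (x /\<^sub>R l) t - U x t \<le> (l - 1) * (L * norm x)"
        using lip[of t "x /\<^sub>R l" x] tp by (simp add: mult_ac)
      \<comment> \<open>Dilating the value and dilating the argument each cost at most (l - 1) L
        |x|, the former also (l - 1) sqrt t f.\<close>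
      have "U x (t + \<tau>) - U x t = (l - 1) * U (x /\<^sub>R l) t + (U (x /\<^sub>R l) t - U x t)"
        unfolding Ul by (simp add: algebra_simps)
      also have "\<dots> \<le> (l - 1) * (sqrt t * f + L * norm x) + (l - 1) * (L * norm x)"
        using A l1 by (intro add_mono Bd mult_left_mono) auto
      also have "\<dots> = (l - 1) * (sqrt t * f + 2 * L * norm x)" by (simp add: algebra_simps)
      also have "\<dots> \<le> \<tau> / (2 * t) * (sqrt t * f + 2 * L * (\<delta> * t))"
        using l3 l1 True L tp by (intro mult_mono add_mono mult_left_mono) (auto simp: f_def)
      also have "\<dots> = \<tau> * f / (2 * sqrt t) + \<tau> * L * \<delta>"
      proof -
        define s where "s = sqrt t"
        have "t = s * s" "s \<noteq> 0" using tp by (auto simp: s_def)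
        then show ?thesis unfolding s_def[symmetric] by (simp add: field_simps)
      qed
      also have "\<tau> * f / (2 * sqrt t) \<le> e / 2"
      proof -
        have "\<tau> * f / e \<le> sqrt t" using tp by (intro real_le_rsqrt) auto
        then show ?thesis using e tp by (simp add: field_simps)
      qed
      finally show ?thesis using \<delta>(2) by simp
    next
      case False
      define r where "r = norm x"
      have r: "r > \<delta> * t" "r > 0" using False tp \<delta> by (auto simp: r_def intro: order_less_trans[rotated])
      define \<omega> where "\<omega> = x /\<^sub>R r"
      have \<omega>: "norm \<omega> = 1" using r by (simp add: \<omega>_def r_def)
      have r2: "r\<^sup>2 > 0" using r by simp
      have dt: "\<delta> * t > 0" using \<delta> tp by simp
      have "2 \<le> t * (\<tau>0 * \<delta>\<^sup>2)" using tp(4) \<tau>0 \<delta> by (simp add: field_simps)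
      then have "2 * t \<le> \<tau>0 * (\<delta> * t)\<^sup>2"
        using mult_right_mono[of 2 "t * (\<tau>0 * \<delta>\<^sup>2)" t] tp by (simp add: power2_eq_square mult_ac)
      also have "\<dots> \<le> \<tau>0 * r\<^sup>2" using \<tau>0 r dt by (intro mult_left_mono power_mono) auto
      finally have "t + \<tau> \<le> \<tau>0 * r\<^sup>2" using tp by simp
      then have s1: "(t + \<tau>) / r\<^sup>2 \<le> \<tau>0" using r2 by (simp add: field_simps)
      then have s2: "t / r\<^sup>2 \<le> \<tau>0" using \<tau> r2 divide_right_mono[of t "t + \<tau>" "r\<^sup>2"] by linarith
      \<comment> \<open>The values of k cancel and the linear terms leave \<tau> \<kappa> / r; the
        two errors do not cancel and leave \<eta> (2 t + \<tau>) / r.\<close>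
      have "U x (t + \<tau>) - U x t = r * (U \<omega> ((t + \<tau>) / r\<^sup>2) - U \<omega> (t / r\<^sup>2))"
        unfolding \<omega>_def using scale[of r "t + \<tau>" x] scale[of r t x] r tp \<tau> by (simp add: algebra_simps)
      also have "\<dots> \<le> r * (((t + \<tau>) / r\<^sup>2) * \<kappa> \<omega> - (t / r\<^sup>2) * \<kappa> \<omega> + \<eta> * ((t + \<tau>) / r\<^sup>2) + \<eta> * (t / r\<^sup>2))"
      proof (rule mult_left_mono)
        have "0 \<le> (t + \<tau>) / r\<^sup>2" "0 \<le> t / r\<^sup>2" using tp \<tau> r2 by auto
        then have "\<bar>U \<omega> ((t + \<tau>) / r\<^sup>2) - (k \<omega> + (t + \<tau>) / r\<^sup>2 * \<kappa> \<omega>)\<bar> \<le> \<eta> * ((t + \<tau>) / r\<^sup>2)"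
          "\<bar>U \<omega> (t / r\<^sup>2) - (k \<omega> + t / r\<^sup>2 * \<kappa> \<omega>)\<bar> \<le> \<eta> * (t / r\<^sup>2)"
          using \<tau>0(2)[OF \<omega>] s1 s2 by blast+
        moreover have "v1 - v2 \<le> a1 * c - a2 * c + \<eta> * a1 + \<eta> * a2"
          if "\<bar>v1 - (k \<omega> + a1 * c)\<bar> \<le> \<eta> * a1" "\<bar>v2 - (k \<omega> + a2 * c)\<bar> \<le> \<eta> * a2" for v1 v2 a1 a2 c
          using that by linarith
        ultimately show "U \<omega> ((t + \<tau>) / r\<^sup>2) - U \<omega> (t / r\<^sup>2)
          \<le> ((t + \<tau>) / r\<^sup>2) * \<kappa> \<omega> - (t / r\<^sup>2) * \<kappa> \<omega> + \<eta> * ((t + \<tau>) / r\<^sup>2) + \<eta> * (t / r\<^sup>2)"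
          by blast
      qed (use r in auto)
      also have "\<dots> = (\<tau> * \<kappa> \<omega> + \<eta> * (2 * t + \<tau>)) / r"
        using r by (simp add: field_simps power2_eq_square)
      also have "\<dots> \<le> (\<tau> * K + \<eta> * (3 * t)) / r"
        using K(1)[OF \<omega>] \<tau> \<eta> tp r by (intro divide_right_mono add_mono mult_left_mono) auto
      also have "\<dots> \<le> (\<tau> * K + \<eta> * (3 * t)) / (\<delta> * t)"
        using \<tau> K \<eta> tp r dt by (intro divide_left_mono add_nonneg_nonneg) auto
      also have "\<dots> = \<tau> * K / (\<delta> * t) + e / 2"
        using \<delta> tp by (simp add: \<eta>_def field_simps)
      also have "\<tau> * K / (\<delta> * t) \<le> e / 2"
        using tp(1,5) \<delta> e by (simp add: field_simps)
      finally show ?thesis by simp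
    qed
  qed
  then show ?thesis using T by blast
qed

text \<open>With one fixed \<rho> this bounds u - k on a whole time interval, as the maximum
  principles require; with C = 0 and \<rho> of order sqrt t it gives the parabolic rate near time
  0.\<close>

lemma mcf_lipschitz_growth:
  fixes u :: "'a::euclidean_space \<Rightarrow> real \<Rightarrow> real" and t \<rho> :: real
  assumes u: "mcf u" and lip: "\<And>x y. \<bar>k x - k y\<bar> \<le> L * norm (x - y)" and L: "L \<ge> 0"
    and close: "\<And>x. \<bar>u x 0 - k x\<bar> \<le> C" and t: "t \<ge> 0" and \<rho>: "\<rho> > 0" "4 * DIM('a) * t \<le> \<rho>\<^sup>2"
  shows "\<bar>u x t - k x\<bar> \<le> C + (L + 1) * \<rho>"
proof -
  have *: "\<bar>u y 0 - k x\<bar> \<le> C + L * \<rho>" if "dist y x \<le> \<rho>" for y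
  proof -
    have "\<bar>k y - k x\<bar> \<le> L * \<rho>"
      using lip[of y x] mult_left_mono[OF that L] by (simp add: dist_norm)
    then show ?thesis using close[of y] by linarith
  qed
  have "u x t \<le> (k x + C + L * \<rho>) + \<rho>"
    by (rule mcf_local_upper_bound[OF u \<rho>(1) _ t \<rho>(2)]) (use * in \<open>force dest: abs_le_D1\<close>)
  moreover have "(k x - C - L * \<rho>) - \<rho> \<le> u x t"
    by (rule mcf_local_lower_bound[OF u \<rho>(1) _ t \<rho>(2)]) (use * in \<open>force dest: abs_le_D2\<close>)
  ultimately show ?thesis by (simp add: algebra_simps abs_le_iff)
qed

section \<open>Stability\<close>

lemma expander_stability:
  fixes k :: "'a::euclidean_space \<Rightarrow> real" and U u :: "'a \<Rightarrow> real \<Rightarrow> real"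
  assumes hom: "pos_homogeneous k" and lip: "\<And>x y. \<bar>k x - k y\<bar> \<le> L * norm (x - y)" and L: "L \<ge> 0"
    and jet: "\<And>x. x \<noteq> 0 \<Longrightarrow> jet2 k x (g x) (Z x)"
    and gL: "\<And>x. x \<noteq> 0 \<Longrightarrow> norm (g x) \<le> L"
    and convex: "\<And>x. x \<noteq> 0 \<Longrightarrow> mc_op (g x) (Z x) > 0"
    and robust: "\<And>x q. x \<noteq> 0 \<Longrightarrow> norm q \<le> \<delta> \<Longrightarrow> mc_op (g x - q) (Z x) \<ge> 0" and \<delta>: "\<delta> > 0"
    and U: "mcf U" "\<And>x. U x 0 = k x" and self: "\<And>x t. t > 0 \<Longrightarrow> U x t = sqrt t * U (x /\<^sub>R sqrt t) 1"
    and short: "\<And>\<eta>. \<eta> > 0 \<Longrightarrow> \<exists>\<tau>>0. \<forall>\<omega> t. norm \<omega> = 1 \<longrightarrow> 0 \<le> t \<longrightarrow> t \<le> \<tau> \<longrightarrow>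
      \<bar>U \<omega> t - (k \<omega> + t * \<kappa> \<omega>)\<bar> \<le> \<eta> * t"
    and K: "\<And>\<omega>. norm \<omega> = 1 \<Longrightarrow> \<bar>\<kappa> \<omega>\<bar> \<le> K" "K \<ge> 0"
    and u: "mcf u" and close: "\<And>e. e > 0 \<Longrightarrow> \<exists>R. \<forall>x. norm x \<ge> R \<longrightarrow> \<bar>u x 0 - k x\<bar> \<le> e"
    and e: "e > 0"
  shows "\<exists>T. \<forall>t\<ge>T. \<forall>x. \<bar>u x t - U x t\<bar> \<le> e"
proof -
  have cont: "continuous_on UNIV k"
  proof (rule lipschitz_on_continuous_on)
    show "L-lipschitz_on UNIV k"
      using lip L by (auto intro!: lipschitz_onI simp: dist_norm)
  qed
  note notbelow = cone_not_below_linear[OF hom cont jet convex]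
  \<comment> \<open>U is compared with itself, so the Lipschitz constant of the cone is inherited at
    all times.\<close>
  have lipU: "U x t - U y t \<le> L * norm (x - y)" if "t \<ge> 0" for x y t
    using mcf_comparison[OF U(1) U(1) L _ that, of 0 x y] lip U(2) by (auto dest: abs_le_D1)
  have rad: "\<exists>\<rho>>0. \<forall>s::real. s \<le> t \<longrightarrow> 4 * DIM('a) * s \<le> \<rho>\<^sup>2" if "t \<ge> 0" for t :: real
  proof (intro exI[of _ "4 * DIM('a) * t + 1"] conjI allI impI)
    define a where "a = 4 * DIM('a) * t"
    have a: "a \<ge> 0" using that by (simp add: a_def)
    show "4 * DIM('a) * t + 1 > 0" using a unfolding a_def by linarith
    fix s :: real assume "s \<le> t"
    then have "4 * DIM('a) * s \<le> a" by (simp add: a_def)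
    also have "a \<le> (a + 1)\<^sup>2" using a by (simp add: power2_eq_square algebra_simps add_nonneg_nonneg)
    finally show "4 * DIM('a) * s \<le> (4 * DIM('a) * t + 1)\<^sup>2" by (simp add: a_def)
  qed
  have growth: "\<exists>C. \<forall>x s. 0 \<le> s \<longrightarrow> s \<le> t \<longrightarrow> \<bar>v x s - k x\<bar> \<le> C"
    if v: "mcf v" "\<And>x. \<bar>v x 0 - k x\<bar> \<le> C" and t: "t \<ge> 0" for v C t
  proof -
    obtain \<rho> where \<rho>: "\<rho> > 0" "\<forall>s::real. s \<le> t \<longrightarrow> 4 * DIM('a) * s \<le> \<rho>\<^sup>2" using rad[OF t] by blast
    then show ?thesis
      using mcf_lipschitz_growth[OF v(1) lip L v(2)] by blast
  qed
  have U_ge: "k x \<le> U x t" if t: "t \<ge> 0" for x t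
  proof -
    obtain C where C: "\<And>x s. 0 \<le> s \<Longrightarrow> s \<le> t \<Longrightarrow> \<bar>U x s - k x\<bar> \<le> C"
      using growth[OF U(1), of 0 t] U(2) t by auto
    have C': "k x - U x s \<le> C" if "0 \<le> s" "s \<le> t" for x s
      using C[OF that, of x] by linarith
    have init: "k x - 0 - gauss 0 0 x 1 \<le> U x 0" for x by (simp add: gauss_def U(2))
    \<comment> \<open>With N = 0 and \<epsilon> = 0 the barrier is the cone itself.\<close>
    have "k x - 0 - 0 * (t + 1) powr (- 0) \<le> U x t"
      by (rule mcf_above_cone[OF U(1) hom cont jet gL robust notbelow C' \<delta> _ _ _ _ _ init t])
        (use \<delta> in simp_all)
    then show ?thesis by simp
  qed
  have U01: "U 0 1 > 0"
  proof (rule ccontr)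
    assume "\<not> U 0 1 > 0"
    then have U0: "U 0 1 = 0" using U_ge[of 1 0] pos_homogeneous_zero[OF hom] by simp
    obtain p X where "jet2 (\<lambda>y. U y 1) 0 p X" using U(1) unfolding mcf_def by (meson zero_less_one)
    from cone_touch_at_origin[OF hom this U0 always_eventually] U_ge have "\<forall>x. k x \<le> p \<bullet> x" by simp
    then show False using notbelow by blast
  qed
  obtain C0 where C0: "\<And>x. \<bar>u x 0 - k x\<bar> \<le> C0"
  proof -
    obtain R where R: "\<And>x. norm x \<ge> R \<Longrightarrow> \<bar>u x 0 - k x\<bar> \<le> 1" using close[of 1] by auto
    have "continuous_on (cball 0 R) (\<lambda>x. u x 0 - k x)"
      by (intro continuous_intros mcf_continuous[OF u] continuous_on_subset[OF cont]) auto
    then have "bounded ((\<lambda>x. u x 0 - k x) ` cball 0 R)"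
      using compact_continuous_image compact_imp_bounded compact_cball by blast
    then obtain C where "\<forall>x\<in>cball 0 R. \<bar>u x 0 - k x\<bar> \<le> C"
      unfolding bounded_iff by auto
    then have C: "\<And>x. norm x \<le> R \<Longrightarrow> \<bar>u x 0 - k x\<bar> \<le> C" by simp
    have "\<bar>u x 0 - k x\<bar> \<le> max C 1" for x
      using C[of x] R[of x] by (cases "norm x \<le> R") auto
    then show ?thesis by (rule that)
  qed
  have C0pos: "C0 \<ge> 0" using C0[of 0] by linarith
  have shift: "\<exists>T>0. \<forall>t\<ge>T. \<forall>x. U x (t + \<tau>) - U x t \<le> e / 2" if "\<tau> > 0" for \<tau>
    by (rule expander_time_shift[OF self lipU L short K that]) (use e in simp_all)
  have upper: "\<exists>T. \<forall>t\<ge>T. \<forall>x. u x t - U x t \<le> e"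
  proof -
    obtain R0 where R0: "\<And>x. norm x \<ge> R0 \<Longrightarrow> \<bar>u x 0 - k x\<bar> \<le> e / 2" using close[of "e / 2"] e by auto
    define R where "R = max R0 0"
    \<comment> \<open>On |x| <= R the initial value is at most L R + C0, while
      \<open>U (\<cdot>, a\<^sup>2)\<close> is at least a \<open>U 0 1\<close> - L R; this a makes
      the latter the larger. Outside, U >= k already suffices.\<close>
    define a where "a = (2 * L * R + C0) / U 0 1 + 1"
    have R: "R \<ge> 0" by (simp add: R_def)
    have a: "a > 0" "2 * L * R + C0 \<le> a * U 0 1"
    proof -
      have "2 * L * R + C0 \<ge> 0" using L R C0pos by simp
      then have "(2 * L * R + C0) / U 0 1 \<ge> 0" using U01 by simp
      then show "a > 0" unfolding a_def by linarith
      have "a * U 0 1 = 2 * L * R + C0 + U 0 1"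
        unfolding a_def distrib_right using U01 by simp
      then show "2 * L * R + C0 \<le> a * U 0 1" using U01 by simp
    qed
    have init: "u x 0 \<le> U x (a\<^sup>2) + e / 2" for x
    proof (cases "norm x \<le> R")
      case True
      have Lx: "L * norm x \<le> L * R" using True L by (rule mult_left_mono)
      have "u x 0 \<le> k x + C0" using C0[of x] by linarith
      also have "k x \<le> L * R"
        using lip[of x 0] pos_homogeneous_zero[OF hom] Lx by simp
      finally have "u x 0 \<le> L * R + C0" by simp
      moreover have "U 0 (a\<^sup>2) - U x (a\<^sup>2) \<le> L * R" using lipU[of "a\<^sup>2" 0 x] Lx by simp
      moreover have "U 0 (a\<^sup>2) = a * U 0 1" using self[of "a\<^sup>2" 0] a by simp
      ultimately show ?thesis using a(2) e by simp
    next
      case False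
      then have "\<bar>u x 0 - k x\<bar> \<le> e / 2" by (intro R0) (simp add: R_def)
      then have "u x 0 \<le> k x + e / 2" by linarith
      then show ?thesis using U_ge[of "a\<^sup>2" x] by simp
    qed
    have a2: "a\<^sup>2 > 0" using a by simp
    obtain T where T: "T > 0" "\<And>t x. t \<ge> T \<Longrightarrow> U x (t + a\<^sup>2) - U x t \<le> e / 2"
      using shift[OF a2] by blast
    have A: "u x t - U x (t + a\<^sup>2) \<le> e / 2" if t: "t \<ge> 0" for x t
    proof -
      have "u x 0 - U y (0 + a\<^sup>2) \<le> e / 2 + L * norm (x - y)" for x y
        using init[of x] lipU[of "a\<^sup>2" x y] by simp
      from mcf_comparison[OF u mcf_time_shift[OF U(1)] L this t, of x x] show ?thesis by simp
    qed
    have "u x t - U x t \<le> e" if "t \<ge> T" for x t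
      using T(2)[OF that, of x] T(1) that A[of t x] by simp
    then show ?thesis by blast
  qed
  have lower: "\<exists>T. \<forall>t\<ge>T. \<forall>x. U x t - u x t \<le> e"
  proof -
    obtain R where R: "\<And>x. norm x \<ge> R \<Longrightarrow> \<bar>u x 0 - k x\<bar> \<le> e / 4" using close[of "e / 4"] e by auto
    define \<beta> where "\<beta> = 1 / (2 * (1 + (L + \<delta>)\<^sup>2))"
    have \<beta>: "\<beta> > 0" by (simp add: \<beta>_def add_pos_nonneg)
    \<comment> \<open>With t0 = b^2, the bound b >= |R| / 2 keeps the Gaussian exponent above -1
      where |x| < R, so the factor exp 1 in N makes the Gaussian at least C0 there. Its slope is
      then at most C0 exp 1 / b, and the last summand makes this at most \<delta> / 2.\<close>
    define b where "b = 1 + \<bar>R\<bar> / 2 + 2 * C0 * exp 1 / \<delta>"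
    define t0 where "t0 = b\<^sup>2"
    have "2 * C0 * exp 1 / \<delta> \<ge> 0" using C0pos \<delta> by simp
    then have b: "b \<ge> 1" "b \<ge> \<bar>R\<bar> / 2" "b \<ge> 2 * C0 * exp 1 / \<delta>" by (auto simp: b_def)
    have t0: "t0 > 0" "sqrt t0 = b" using b by (auto simp: t0_def)
    define N where "N = C0 * exp 1 * t0 powr \<beta>"
    have N: "N \<ge> 0" using C0pos by (simp add: N_def)
    have Nt0: "N * t0 powr (- \<beta>) = C0 * exp 1"
      using t0 by (simp add: N_def powr_minus)
    have small: "N * t0 powr (- \<beta>) / sqrt t0 \<le> \<delta> / 2"
      unfolding Nt0 t0(2) using b \<delta> by (simp add: field_simps)
    have init: "k x - e / 4 - gauss N \<beta> x t0 \<le> u x 0" for x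
    proof (cases "norm x \<ge> R")
      case True
      have "gauss N \<beta> x t0 \<ge> 0" using N by (simp add: gauss_def)
      then show ?thesis using R[OF True] by linarith
    next
      case False
      have "norm x \<le> 2 * b" using False b by linarith
      then have "(norm x)\<^sup>2 \<le> (2 * b)\<^sup>2" by (intro power_mono) auto
      then have "(norm x)\<^sup>2 / (4 * t0) \<le> 1" using t0 b by (simp add: t0_def field_simps)
      then have "exp (- (norm x)\<^sup>2 / (4 * t0)) \<ge> exp (- 1)" by simp
      then have "C0 * exp 1 * exp (- (norm x)\<^sup>2 / (4 * t0)) \<ge> C0 * exp 1 * exp (- 1)"
        using C0pos by (intro mult_left_mono) auto
      then have "gauss N \<beta> x t0 \<ge> C0"
        unfolding gauss_def Nt0 by (simp only: mult.assoc exp_add[symmetric]) simp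
      then show ?thesis using C0[of x] e by linarith
    qed
    have bound: "k x - e / 4 - N * (t + t0) powr (- \<beta>) \<le> u x t" if t: "t \<ge> 0" for x t
    proof -
      obtain C where C: "\<And>x s. 0 \<le> s \<Longrightarrow> s \<le> t \<Longrightarrow> \<bar>u x s - k x\<bar> \<le> C"
        using growth[OF u C0 t] by blast
      have "k x - u x s \<le> C" if "0 \<le> s" "s \<le> t" for x s
        using C[OF that, of x] by linarith
      from mcf_above_cone[OF u hom cont jet gL robust notbelow this \<delta> N t0(1) _ _ small init t]
      show ?thesis using \<beta> by (simp add: \<beta>_def)
    qed
    have "filterlim (\<lambda>t::real. t0 + t) at_top at_top"
      by (rule filterlim_tendsto_add_at_top[OF tendsto_const filterlim_ident])
    then have "((\<lambda>t. (t0 + t) powr (- \<beta>)) \<longlongrightarrow> 0) at_top"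
      using \<beta> by (intro tendsto_neg_powr) auto
    then have "((\<lambda>t. N * (t + t0) powr (- \<beta>)) \<longlongrightarrow> N * 0) at_top"
      by (intro tendsto_mult tendsto_const) (simp add: add.commute)
    then have "\<forall>\<^sub>F t in at_top. N * (t + t0) powr (- \<beta>) < e / 4"
      using e by (intro order_tendstoD(2)) auto
    then obtain T0 where T0: "\<And>t. t \<ge> T0 \<Longrightarrow> N * (t + t0) powr (- \<beta>) < e / 4"
      unfolding eventually_at_top_linorder by blast
    define T1 where "T1 = max T0 1"
    have T1: "T1 > 0" by (simp add: T1_def)
    have kT: "k x - u x T1 \<le> e / 2" for x
    proof -
      have "T0 \<le> T1" by (simp add: T1_def)
      from T0[OF this] bound[OF less_imp_le[OF T1], of x] show ?thesis by linarith
    qed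
    \<comment> \<open>The solution u is restarted at T1, when it has recovered to k up to e / 2, and
      compared with U started from k; the mismatch of times is paid by \<open>shift\<close>.\<close>
    have "U x 0 - u y (0 + T1) \<le> e / 2 + L * norm (x - y)" for x y
      using U(2)[of x] lip[of x y] kT[of y] unfolding add_0 by linarith
    note cmp = mcf_comparison[OF U(1) mcf_time_shift[OF u less_imp_le[OF T1]] L this]
    have A: "U x t - u x (t + T1) \<le> e / 2" if "t \<ge> 0" for x t
      using cmp[OF that, of x x] by simp
    obtain T where T: "T > 0" "\<And>t x. t \<ge> T \<Longrightarrow> U x (t + T1) - U x t \<le> e / 2"
      using shift[OF T1] by blast
    have "U x t - u x t \<le> e" if "t \<ge> T + T1" for x t
      using A[of "t - T1" x] T(2)[of "t - T1" x] T(1) that by simp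
    then show ?thesis by blast
  qed
  obtain T where T: "\<And>t x. t \<ge> T \<Longrightarrow> u x t - U x t \<le> e" using upper by blast
  obtain T' where T': "\<And>t x. t \<ge> T' \<Longrightarrow> U x t - u x t \<le> e" using lower by blast
  show ?thesis
    by (rule exI[of _ "max T T'"]) (auto simp: abs_le_iff intro: T T')
qed

section \<open>From Frechet derivatives to jets\<close>

text \<open>A derivative of the slice in direction v is the slice of the derivative in direction (v,
  0), so the induction runs over all F at once.\<close>

lemma C_on_slice:
  assumes "C_on m (UNIV \<times> {0<..}) F" "t > (0::real)"
  shows "C_on m UNIV (\<lambda>x. F (x, t))"
  using assms
proof (induction m arbitrary: F)
  case 0
  have "continuous_on UNIV (F \<circ> (\<lambda>x. (x, t)))"
    using 0 by (intro continuous_on_compose continuous_intros) (auto elim!: continuous_on_subset)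
  then show ?case by (simp add: o_def)
next
  case (Suc m)
  have d: "((\<lambda>x. F (x, t)) has_derivative (\<lambda>v. frechet_derivative F (at (x, t)) (v, 0))) (at x)" for x
  proof -
    have "F differentiable (at (x, t))" using Suc.prems by auto
    then have "(F has_derivative frechet_derivative F (at (x, t))) (at (x, t))"
      by (simp add: frechet_derivative_works)
    then show ?thesis
      by (rule has_derivative_compose[rotated]) (auto intro!: derivative_eq_intros)
  qed
  have "frechet_derivative (\<lambda>x. F (x, t)) (at x) v = frechet_derivative F (at (x, t)) (v, 0)" for x v
    using frechet_derivative_at[OF d, of x] by metis
  moreover have "C_on m UNIV (\<lambda>x. frechet_derivative F (at (x, t)) (v, 0))" for v
    using Suc.IH[of "\<lambda>z. frechet_derivative F (at z) (v, 0)"] Suc.prems by simp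
  moreover have "(\<lambda>x. F (x, t)) differentiable (at x)" for x
    using d unfolding differentiable_def by blast
  ultimately show ?case by simp
qed

lemma has_real_derivative_along_line:
  assumes "(f has_derivative f') (at (x + s *\<^sub>R \<xi>))"
  shows "((\<lambda>s. f (x + s *\<^sub>R \<xi>)) has_real_derivative f' \<xi>) (at s)"
proof -
  have "((\<lambda>s. x + s *\<^sub>R \<xi>) has_derivative (\<lambda>h. h *\<^sub>R \<xi>)) (at s)"
    by (auto intro!: derivative_eq_intros)
  from has_derivative_compose[OF this assms]
  have "((\<lambda>s. f (x + s *\<^sub>R \<xi>)) has_derivative (\<lambda>h. f' (h *\<^sub>R \<xi>))) (at s)" .
  moreover have "f' (h *\<^sub>R \<xi>) = f' \<xi> * h" for h
    using assms by (simp add: linear_cmul[OF has_derivative_linear])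
  ultimately show ?thesis by (simp add: has_field_derivative_def)
qed

section \<open>Gradient, Hessian and the trace form of mean curvature\<close>

lemma sum_Basis_vec:
  fixes f :: "real ^ 'n \<Rightarrow> 'b::comm_monoid_add"
  shows "(\<Sum>b\<in>Basis. f b) = (\<Sum>i\<in>UNIV. f (axis i 1))"
proof -
  have B: "(Basis :: (real ^ 'n) set) = range (\<lambda>i. axis i 1)" by (auto simp: Basis_vec_def)
  have "inj (\<lambda>i. axis i 1 :: real ^ 'n)" by (simp add: inj_def axis_eq_axis)
  from sum.reindex[OF this, of f] show ?thesis unfolding B by (simp add: o_def)
qed

definition hess :: "(real ^ 'n \<Rightarrow> real) \<Rightarrow> real ^ 'n \<Rightarrow> real ^ 'n \<Rightarrow> real ^ 'n" where
  "hess v x \<zeta> = (\<chi> i. frechet_derivative (\<lambda>y. frechet_derivative v (at y) (axis i 1)) (at x) \<zeta>)"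

lemma C_on_2D:
  assumes "C_on 2 S v" 
  shows "\<And>x. x \<in> S \<Longrightarrow> v differentiable (at x)"
    "\<And>x \<xi>. x \<in> S \<Longrightarrow> (\<lambda>y. frechet_derivative v (at y) \<xi>) differentiable (at x)"
    "\<And>\<xi> \<zeta>. continuous_on S (\<lambda>x. frechet_derivative (\<lambda>y. frechet_derivative v (at y) \<xi>) (at x) \<zeta>)"
  using assms by (auto simp: numeral_2_eq_2)

context
  fixes v :: "real ^ 'n \<Rightarrow> real" and S
  assumes S: "open S" and C2: "C_on 2 S v"
begin

lemma has_derivative_grad:
  assumes "x \<in> S"
  shows "(v has_derivative (\<lambda>\<xi>. grad v x \<bullet> \<xi>)) (at x)"
proof -
  let ?f = "frechet_derivative v (at x)"
  have d: "(v has_derivative ?f) (at x)"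
    using C_on_2D(1)[OF C2 assms] by (simp add: frechet_derivative_works)
  interpret linear ?f using d by (rule has_derivative_linear)
  have "?f = (\<lambda>\<xi>. grad v x \<bullet> \<xi>)"
  proof
    fix \<xi>
    have "?f \<xi> = ?f (\<Sum>i\<in>UNIV. (\<xi> $ i) *\<^sub>R axis i 1)"
      using basis_expansion[of \<xi>] by (simp add: scalar_mult_eq_scaleR)
    also have "\<dots> = (\<Sum>i\<in>UNIV. \<xi> $ i * ?f (axis i 1))" by (simp add: sum scale)
    finally show "?f \<xi> = grad v x \<bullet> \<xi>" by (simp add: grad_def inner_vec_def mult.commute)
  qed
  then show ?thesis using d by (simp only:)
qed

lemma has_derivative_hess:
  assumes "x \<in> S"
  shows "(grad v has_derivative hess v x) (at x)"
  unfolding has_derivative_componentwise_within[of "grad v"]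
proof
  fix b :: "real ^ 'n" assume "b \<in> Basis"
  then obtain i where b: "b = axis i 1" by (auto simp: Basis_vec_def)
  show "((\<lambda>y. grad v y \<bullet> b) has_derivative (\<lambda>\<zeta>. hess v x \<zeta> \<bullet> b)) (at x)"
    using C_on_2D(2)[OF C2 assms, of "axis i 1"]
    by (simp add: b inner_axis grad_def hess_def frechet_derivative_works)
qed

lemma jet2_C2:
  assumes x: "x \<in> S"
  shows "jet2 v x (grad v x) (\<lambda>\<xi>. hess v x \<xi> \<bullet> \<xi>)"
  unfolding jet2_def
proof
  fix \<xi>
  have "\<forall>\<^sub>F y in nhds x. y \<in> S" using S x by (rule eventually_nhds_in_open)
  from eventually_nhds_line[OF this, of \<xi>]
  have "\<forall>\<^sub>F s in nhds 0. ((\<lambda>s. v (x + s *\<^sub>R \<xi>)) has_real_derivative grad v (x + s *\<^sub>R \<xi>) \<bullet> \<xi>) (at s)"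
    by eventually_elim (rule has_real_derivative_along_line[OF has_derivative_grad])
  moreover have "((\<lambda>s. grad v (x + s *\<^sub>R \<xi>) \<bullet> \<xi>) has_real_derivative hess v x \<xi> \<bullet> \<xi>) (at 0)"
  proof -
    have "((\<lambda>y. grad v y \<bullet> \<xi>) has_derivative (\<lambda>\<zeta>. hess v x \<zeta> \<bullet> \<xi>)) (at (x + 0 *\<^sub>R \<xi>))"
      using has_derivative_hess[OF x] by (auto intro!: derivative_eq_intros)
    from has_real_derivative_along_line[OF this] show ?thesis .
  qed
  ultimately show "d2 (\<lambda>s. v (x + s *\<^sub>R \<xi>)) (grad v x \<bullet> \<xi>) (hess v x \<xi> \<bullet> \<xi>)"
    unfolding d2_def by (intro exI[of _ "\<lambda>s. grad v (x + s *\<^sub>R \<xi>) \<bullet> \<xi>"]) simp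
qed

text \<open>With W = sqrt (1 + |p|^2), the product rule for the divergence of p / W gives tr A / W -
  (A p) p / W^3, the second term coming from the derivative of 1 / W. Multiplying by W leaves the
  trace against the inverse metric.\<close>

lemma mean_curvature_eq_mc_op:
  assumes x: "x \<in> S"
  shows "sqrt (1 + (norm (grad v x))\<^sup>2) * mean_curvature v x = mc_op (grad v x) (\<lambda>\<xi>. hess v x \<xi> \<bullet> \<xi>)"
proof -
  define p A W where "p = grad v x" and "A = hess v x" and "W = slope_factor p"
  have dp: "(grad v has_derivative A) (at x)" using has_derivative_hess[OF x] by (simp add: A_def)
  interpret linear A using dp by (rule has_derivative_linear)
  have W: "W > 0" "W\<^sup>2 = 1 + (norm p)\<^sup>2" "sqrt (1 + p \<bullet> p) = W"
    by (simp_all add: W_def slope_factor_pos slope_factor_sq) (simp add: slope_factor_def power2_norm_eq_inner)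
  have pp: "1 + p \<bullet> p > 0" by (simp add: add_pos_nonneg)
  have dN: "((\<lambda>z. inverse (sqrt (1 + z))) has_real_derivative - (1 / (2 * W ^ 3))) (at (p \<bullet> p))"
    using pp W(1) by (auto intro!: derivative_eq_intros simp: W(3) field_simps power3_eq_cube)
  have "((\<lambda>y. grad v y \<bullet> grad v y) has_derivative (\<lambda>\<zeta>. p \<bullet> A \<zeta> + A \<zeta> \<bullet> p)) (at x)"
    using has_derivative_inner[OF dp dp] by (simp add: p_def)
  from DERIV_compose_FDERIV[OF dN[unfolded p_def] this]
  have "((\<lambda>y. inverse (sqrt (1 + grad v y \<bullet> grad v y))) has_derivative
      (\<lambda>\<zeta>. (p \<bullet> A \<zeta> + A \<zeta> \<bullet> p) * - (1 / (2 * W ^ 3)))) (at x)" .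
  from has_derivative_scaleR[OF this dp]
  have "((\<lambda>y. grad v y /\<^sub>R sqrt (1 + (norm (grad v y))\<^sup>2)) has_derivative
      (\<lambda>\<zeta>. inverse W *\<^sub>R A \<zeta> + ((p \<bullet> A \<zeta> + A \<zeta> \<bullet> p) * - (1 / (2 * W ^ 3))) *\<^sub>R p)) (at x)"
    by (simp add: power2_norm_eq_inner p_def[symmetric] W(3))
  from frechet_derivative_at[OF this, symmetric]
  have "mean_curvature v x = (\<Sum>i\<in>UNIV. inverse W * (A (axis i 1) $ i)
      + ((p \<bullet> A (axis i 1) + A (axis i 1) \<bullet> p) * - (1 / (2 * W ^ 3))) * (p $ i))"
    unfolding mean_curvature_def divergence_def by simp
  also have "\<dots> = inverse W * (\<Sum>i\<in>UNIV. A (axis i 1) $ i) - (1 / W ^ 3) * (\<Sum>i\<in>UNIV. p $ i * (p \<bullet> A (axis i 1)))"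
    by (simp add: sum.distrib sum_distrib_left sum_subtractf[symmetric] inner_commute[of _ p] mult.commute)
  also have "(\<Sum>i\<in>UNIV. p $ i * (p \<bullet> A (axis i 1))) = A p \<bullet> p"
  proof -
    have "A p = A (\<Sum>i\<in>UNIV. (p $ i) *\<^sub>R axis i 1)"
      using basis_expansion[of p] by (simp add: scalar_mult_eq_scaleR)
    also have "\<dots> = (\<Sum>i\<in>UNIV. (p $ i) *\<^sub>R A (axis i 1))" by (simp add: sum scale)
    finally show ?thesis by (simp add: inner_sum_right inner_commute[of _ p])
  qed
  finally have "W * mean_curvature v x = (\<Sum>i\<in>UNIV. A (axis i 1) $ i) - (A p \<bullet> p) / W\<^sup>2"
    using W(1) by (simp add: right_diff_distrib power2_eq_square power3_eq_cube)
  moreover have "(\<Sum>b\<in>Basis. A b \<bullet> b) = (\<Sum>i\<in>UNIV. A (axis i 1) $ i)"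
    by (simp add: sum_Basis_vec inner_axis)
  ultimately show ?thesis
    using mc_op_bilinear[OF linear_axioms, of p]
    by (simp add: W_def p_def A_def slope_factor_def)
qed

text \<open>Continuity of the Hessian is available for fixed directions, so the term A p with moving
  p is expanded in the basis first. Joint continuity in point and slope perturbation is what the
  compactness arguments below use.\<close>

lemma continuous_on_mc_op:
  "continuous_on (S \<times> UNIV) (\<lambda>(x, q). mc_op (grad v x + q) (\<lambda>\<xi>. hess v x \<xi> \<bullet> \<xi>))"
proof -
  have lin: "linear (hess v x)" if "x \<in> S" for x
    using has_derivative_hess[OF that] by (rule has_derivative_linear)
  have cg: "continuous_on S (grad v)"
    using has_derivative_hess by (intro continuous_at_imp_continuous_on) (auto intro: has_derivative_continuous)
  have ch: "continuous_on S (\<lambda>x. hess v x \<zeta>)" for \<zeta>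
    unfolding hess_def by (intro continuous_on_vec_lambda C_on_2D(3)[OF C2])
  let ?p = "\<lambda>z. grad v (fst z) + snd z" and ?D = "S \<times> (UNIV :: (real ^ 'n) set)"
  have cp: "continuous_on ?D ?p"
    by (intro continuous_intros continuous_on_compose2[OF cg]) auto
  have ch': "continuous_on ?D (\<lambda>z. hess v (fst z) \<zeta>)" for \<zeta>
    by (intro continuous_on_compose2[OF ch] continuous_intros) auto
  have sf: "slope_factor (?p z) \<noteq> 0" for z using slope_factor_pos[of "?p z"] by linarith
  have "continuous_on ?D (\<lambda>z. (\<Sum>b\<in>Basis. hess v (fst z) b \<bullet> b)
      - (\<Sum>b\<in>Basis. (?p z \<bullet> b) * (hess v (fst z) b \<bullet> ?p z)) / (slope_factor (?p z))\<^sup>2)"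
    using sf unfolding slope_factor_def by (intro continuous_intros ch' cp) auto
  moreover have "mc_op (?p z) (\<lambda>\<xi>. hess v (fst z) \<xi> \<bullet> \<xi>) = (\<Sum>b\<in>Basis. hess v (fst z) b \<bullet> b)
      - (\<Sum>b\<in>Basis. (?p z \<bullet> b) * (hess v (fst z) b \<bullet> ?p z)) / (slope_factor (?p z))\<^sup>2" if "z \<in> ?D" for z
  proof -
    interpret linear "hess v (fst z)" using lin that by auto
    have "hess v (fst z) (?p z) = hess v (fst z) (\<Sum>b\<in>Basis. (?p z \<bullet> b) *\<^sub>R b)"
      by (simp only: euclidean_representation)
    also have "\<dots> = (\<Sum>b\<in>Basis. (?p z \<bullet> b) *\<^sub>R hess v (fst z) b)" by (simp add: sum scale)
    finally have "hess v (fst z) (?p z) \<bullet> ?p z = (\<Sum>b\<in>Basis. (?p z \<bullet> b) * (hess v (fst z) b \<bullet> ?p z))"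
      by (simp only: inner_sum_left inner_scaleR_left)
    then show ?thesis by (simp only: mc_op_bilinear[OF linear_axioms])
  qed
  ultimately show ?thesis by (simp add: split_def cong: continuous_on_cong)
qed

end

lemma gmcf_solution_imp_mcf:
  fixes u :: "real ^ 'n \<Rightarrow> real \<Rightarrow> real"
  assumes "gmcf_solution u"
  shows "mcf u"
  unfolding mcf_def
proof (intro conjI allI impI)
  show "continuous_on (UNIV \<times> {0..}) (\<lambda>(x, t). u x t)" using assms by (simp add: gmcf_solution_def)
  fix x t assume t: "t > (0::real)"
  have "C_on 2 (UNIV \<times> {0<..}) (\<lambda>(x, t). u x t)"
    using assms by (simp add: gmcf_solution_def smooth_on_def)
  from C_on_slice[OF this t] have C: "C_on 2 UNIV (\<lambda>y. u y t)" by simp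
  have "((\<lambda>s. u x s) has_real_derivative
      sqrt (1 + (norm (grad (\<lambda>y. u y t) x))\<^sup>2) * mean_curvature (\<lambda>y. u y t) x) (at t)"
    using assms t unfolding gmcf_solution_def by blast
  then have "((\<lambda>s. u x s) has_real_derivative
      mc_op (grad (\<lambda>y. u y t) x) (\<lambda>\<xi>. hess (\<lambda>y. u y t) x \<xi> \<bullet> \<xi>)) (at t)"
    by (simp only: mean_curvature_eq_mc_op[OF open_UNIV C UNIV_I])
  then show "\<exists>p X. jet2 (\<lambda>y. u y t) x p X \<and> ((\<lambda>s. u x s) has_real_derivative mc_op p X) (at t)"
    using jet2_C2[OF open_UNIV C, of x] by blast
qed

section \<open>Smooth homogeneous cones\<close>

locale smooth_cone =
  fixes k :: "real ^ 'n \<Rightarrow> real"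
  assumes smooth: "C_on 2 (- {0}) k" and hom: "pos_homogeneous k"
begin

abbreviation (input) "hess_form x \<equiv> (\<lambda>\<xi>. hess k x \<xi> \<bullet> \<xi>)"

lemma open_punctured: "open (- {0 :: real ^ 'n})"
  by (simp add: open_Compl)

lemma jet: "x \<noteq> 0 \<Longrightarrow> jet2 k x (grad k x) (hess_form x)"
  using jet2_C2[OF open_punctured smooth] by simp

lemma scaling: "l > 0 \<Longrightarrow> k (l *\<^sub>R x) = l * k x"
  using hom by (simp add: pos_homogeneous_def)

text \<open>Degrees 0 and -1 of the first two derivatives, read off from uniqueness of the jet of
  k(l x) = l k(x).\<close>

lemma grad_hess_scaling:
  assumes "l > 0" "x \<noteq> 0"
  shows "grad k (l *\<^sub>R x) = grad k x" "l * (hess k (l *\<^sub>R x) \<xi> \<bullet> \<xi>) = hess k x \<xi> \<bullet> \<xi>"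
proof -
  have "l *\<^sub>R x \<noteq> 0" using assms by simp
  from jet2_dilation[OF jet[OF this] refl]
  have "jet2 (\<lambda>y. l * k y) x (l *\<^sub>R grad k (l *\<^sub>R x)) (\<lambda>\<xi>. l\<^sup>2 * (hess k (l *\<^sub>R x) \<xi> \<bullet> \<xi>))"
    using assms by (simp add: scaling)
  note * = jet2_unique[OF this jet2_cmult[OF jet[OF assms(2)]]]
  show "grad k (l *\<^sub>R x) = grad k x" using *(1) assms by simp
  have "l\<^sup>2 * (hess k (l *\<^sub>R x) \<xi> \<bullet> \<xi>) = l * (hess k x \<xi> \<bullet> \<xi>)"
    using *(2) by (rule fun_cong)
  then show "l * (hess k (l *\<^sub>R x) \<xi> \<bullet> \<xi>) = hess k x \<xi> \<bullet> \<xi>"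
    using assms by (simp add: power2_eq_square)
qed

lemma continuous_on_punctured: "continuous_on (- {0}) k" "continuous_on (- {0}) (grad k)"
proof -
  show "continuous_on (- {0}) k"
    using C_on_2D(1)[OF smooth] by (intro continuous_at_imp_continuous_on ballI differentiable_imp_continuous_within) auto
  show "continuous_on (- {0}) (grad k)"
    using has_derivative_hess[OF open_punctured smooth]
    by (intro continuous_at_imp_continuous_on ballI has_derivative_continuous) auto
qed

lemma bounded_on_sphere:
  fixes f :: "real ^ 'n \<Rightarrow> 'b::real_normed_vector"
  assumes "continuous_on (- {0}) f"
  obtains B where "B \<ge> 0" "\<And>\<omega>. norm \<omega> = 1 \<Longrightarrow> norm (f \<omega>) \<le> B"
proof -
  have "continuous_on (sphere 0 1) f" by (rule continuous_on_subset[OF assms]) auto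
  then have "bounded (f ` sphere 0 1)"
    using compact_continuous_image compact_imp_bounded compact_sphere by blast
  then obtain B where "\<forall>\<omega>\<in>sphere 0 1. norm (f \<omega>) \<le> B" unfolding bounded_iff by auto
  then have "norm (f \<omega>) \<le> max B 0" if "norm \<omega> = 1" for \<omega> using that by (simp add: le_max_iff_disj)
  then show ?thesis by (intro that[of "max B 0"]) auto
qed

text \<open>The mean value inequality fails to apply only on segments through the vertex, and there
  |x - y| = |x| + |y|, so |k| <= L |x| at both ends suffices. Hence L also bounds |k| on the unit
  sphere.\<close>

lemma lipschitz:
  obtains L where "L \<ge> 0" "\<And>x. x \<noteq> 0 \<Longrightarrow> norm (grad k x) \<le> L" "\<And>x y. \<bar>k x - k y\<bar> \<le> L * norm (x - y)"
proof -
  obtain L1 where L1: "L1 \<ge> 0" "\<And>\<omega>. norm \<omega> = 1 \<Longrightarrow> norm (grad k \<omega>) \<le> L1"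
    using bounded_on_sphere[OF continuous_on_punctured(2)] by blast
  obtain L2 where L2: "L2 \<ge> 0" "\<And>\<omega>. norm \<omega> = 1 \<Longrightarrow> norm (k \<omega>) \<le> L2"
    using bounded_on_sphere[OF continuous_on_punctured(1)] by blast
  define L where "L = max L1 L2"
  have unit: "norm x *\<^sub>R (x /\<^sub>R norm x) = x" "norm (x /\<^sub>R norm x) = 1" "x /\<^sub>R norm x \<noteq> 0"
    if "x \<noteq> 0" for x :: "real ^ 'n" using that by simp_all
  have g: "norm (grad k x) \<le> L" if "x \<noteq> 0" for x
  proof -
    have "grad k x = grad k (x /\<^sub>R norm x)"
      using grad_hess_scaling(1)[of "norm x" "x /\<^sub>R norm x"] unit[OF that] that by simp
    then show ?thesis using L1(2)[OF unit(2)[OF that]] by (simp add: L_def)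
  qed
  have k: "\<bar>k x\<bar> \<le> L * norm x" for x
  proof (cases "x = 0")
    case True
    then show ?thesis using pos_homogeneous_zero[OF hom] by simp
  next
    case False
    then have "k x = norm x * k (x /\<^sub>R norm x)"
      using scaling[of "norm x" "x /\<^sub>R norm x"] by simp
    then have "\<bar>k x\<bar> = norm x * \<bar>k (x /\<^sub>R norm x)\<bar>" by (simp only: abs_mult abs_norm_cancel)
    also have "\<dots> \<le> norm x * L" using L2(2)[OF unit(2)[OF False]] by (intro mult_left_mono) (auto simp: L_def)
    finally show ?thesis by (simp add: mult.commute)
  qed
  have "\<bar>k x - k y\<bar> \<le> L * norm (x - y)" for x y
  proof (cases "0 \<in> closed_segment x y")
    case True
    then have "dist x y = dist x 0 + dist 0 y"
      using between[of x y 0] by (simp add: between_mem_segment)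
    then have "norm (x - y) = norm x + norm y" by (simp add: dist_norm)
    then show ?thesis using k[of x] k[of y] by (simp add: distrib_left)
  next
    case False
    have "norm (k x - k y) \<le> L * norm (x - y)"
    proof (rule differentiable_bound[of "closed_segment x y" k "\<lambda>z \<xi>. grad k z \<bullet> \<xi>"])
      fix z assume "z \<in> closed_segment x y"
      then have z: "z \<noteq> 0" using False by auto
      show "(k has_derivative (\<lambda>\<xi>. grad k z \<bullet> \<xi>)) (at z within closed_segment x y)"
        by (rule has_derivative_at_withinI, rule has_derivative_grad[OF open_punctured smooth]) (use z in simp)
      show "onorm (\<lambda>\<xi>. grad k z \<bullet> \<xi>) \<le> L"
      proof (rule onorm_bound)
        show "0 \<le> L" using L1(1) by (simp add: L_def)
        fix \<xi>
        have "norm (grad k z \<bullet> \<xi>) \<le> norm (grad k z) * norm \<xi>" by (simp add: Cauchy_Schwarz_ineq2)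
        also have "\<dots> \<le> L * norm \<xi>" using g[OF z] by (intro mult_right_mono) auto
        finally show "norm (grad k z \<bullet> \<xi>) \<le> L * norm \<xi>" .
      qed
    qed auto
    then show ?thesis by simp
  qed
  then show ?thesis using g L1(1) by (intro that[of L]) (auto simp: L_def)
qed

lemma continuous_mc_op: "continuous_on ((- {0}) \<times> UNIV) (\<lambda>(x, q). mc_op (grad k x + q) (hess_form x))"
  by (rule continuous_on_mc_op[OF open_punctured smooth])

lemma continuous_mc_op_grad: "continuous_on (- {0}) (\<lambda>x. mc_op (grad k x + 0) (hess_form x))"
proof -
  have "continuous_on (- {0}) ((\<lambda>(x, q). mc_op (grad k x + q) (hess_form x)) \<circ> (\<lambda>x. (x, 0)))"
  proof (rule continuous_on_compose)
    show "continuous_on (- {0}) (\<lambda>x :: real ^ 'n. (x, 0 :: real ^ 'n))" by (intro continuous_intros)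
    show "continuous_on ((\<lambda>x. (x, 0)) ` (- {0})) (\<lambda>(x, q). mc_op (grad k x + q) (hess_form x))"
      by (rule continuous_on_subset[OF continuous_mc_op]) auto
  qed
  then show ?thesis by (simp add: o_def)
qed

text \<open>Uniform continuity on a compact annulus times a ball of slopes; d <= 1/2 keeps all
  points near the unit sphere inside the annulus, away from the vertex.\<close>

lemma uniform_mc_op:
  assumes e: "e > 0"
  obtains d where "d > 0" "d \<le> 1/2" "\<And>\<omega> x q. norm \<omega> = 1 \<Longrightarrow> dist x \<omega> \<le> d \<Longrightarrow> norm q \<le> d \<Longrightarrow>
    \<bar>mc_op (grad k x + q) (hess_form x) - mc_op (grad k \<omega>) (hess_form \<omega>)\<bar> < e"
proof -
  define H where "H z = mc_op (grad k (fst z) + snd z) (hess_form (fst z))" for z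
  define D where "D = (cball (0 :: real ^ 'n) 2 - ball 0 (1/2)) \<times> cball (0 :: real ^ 'n) 1"
  have "compact D" unfolding D_def by (intro compact_Times compact_diff compact_cball open_ball)
  moreover have "continuous_on D H"
  proof -
    have "continuous_on D (\<lambda>(x, q). mc_op (grad k x + q) (hess_form x))"
      by (rule continuous_on_subset[OF continuous_mc_op]) (auto simp: D_def)
    then show ?thesis by (simp add: H_def[abs_def] split_def)
  qed
  ultimately have "uniformly_continuous_on D H" by (rule compact_uniformly_continuous[rotated])
  then obtain d where d: "d > 0" "\<And>z z'. z \<in> D \<Longrightarrow> z' \<in> D \<Longrightarrow> dist z' z < d \<Longrightarrow> dist (H z') (H z) < e"
    unfolding uniformly_continuous_on_def using e by metis
  define d' where "d' = min (1/2) (d / 3)"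
  have d': "d' > 0" "d' \<le> 1/2" "2 * d' < d" using d(1) unfolding d'_def by linarith+
  have "\<bar>mc_op (grad k x + q) (hess_form x) - mc_op (grad k \<omega>) (hess_form \<omega>)\<bar> < e"
    if h: "norm \<omega> = 1" "dist x \<omega> \<le> d'" "norm q \<le> d'" for \<omega> x q
  proof -
    have "norm x \<le> norm \<omega> + dist x \<omega>" "norm \<omega> \<le> norm x + dist x \<omega>"
      using norm_triangle_sub[of x \<omega>] norm_triangle_sub[of \<omega> x] by (auto simp: dist_norm norm_minus_commute)
    then have "(x, q) \<in> D" "(\<omega>, 0) \<in> D" using h d'(2) by (auto simp: D_def)
    moreover have "dist (x, q) (\<omega>, 0) < d"
      using h d'(3) norm_Pair_le[of "x - \<omega>" q] by (simp add: dist_norm)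
    ultimately have "dist (H (x, q)) (H (\<omega>, 0)) < e" by (intro d(2))
    then show ?thesis by (simp add: dist_real_def H_def)
  qed
  from that[OF d'(1,2) this] show ?thesis .
qed

text \<open>On the unit sphere the operator has a positive minimum, which serves as tolerance in
  \<open>uniform_mc_op\<close>. Scaling leaves the gradient unchanged and multiplies the Hessian
  form by a positive factor, so the sign carries over to all x.\<close>

lemma robust_mean_convexity:
  assumes convex: "\<And>x. x \<noteq> 0 \<Longrightarrow> mc_op (grad k x) (hess_form x) > 0"
  obtains \<delta> where "\<delta> > 0" "\<And>x q. x \<noteq> 0 \<Longrightarrow> norm q \<le> \<delta> \<Longrightarrow> mc_op (grad k x - q) (hess_form x) \<ge> 0"
proof -
  let ?h = "\<lambda>x. mc_op (grad k x + 0) (hess_form x)"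
  have "continuous_on (sphere 0 1) ?h"
    using continuous_on_subset[OF continuous_mc_op_grad] by auto
  moreover have "sphere (0 :: real ^ 'n) 1 \<noteq> {}" by simp
  ultimately obtain \<omega>0 where \<omega>0: "\<omega>0 \<in> sphere 0 1" "\<forall>\<omega>\<in>sphere 0 1. ?h \<omega>0 \<le> ?h \<omega>"
    using continuous_attains_inf[OF compact_sphere] by blast
  have "\<omega>0 \<noteq> 0" using \<omega>0(1) by auto
  then have pos: "?h \<omega>0 > 0" using convex[of \<omega>0] by simp
  obtain d where d: "d > 0" "d \<le> 1/2" "\<And>\<omega> x q. norm \<omega> = 1 \<Longrightarrow> dist x \<omega> \<le> d \<Longrightarrow> norm q \<le> d \<Longrightarrow>
    \<bar>mc_op (grad k x + q) (hess_form x) - mc_op (grad k \<omega>) (hess_form \<omega>)\<bar> < ?h \<omega>0"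
    by (rule uniform_mc_op[OF pos]) (rule that)
  have "mc_op (grad k x - q) (hess_form x) \<ge> 0" if x: "x \<noteq> 0" and q: "norm q \<le> d" for x q
  proof -
    define \<omega> where "\<omega> = x /\<^sub>R norm x"
    have \<omega>: "norm \<omega> = 1" "\<omega> \<noteq> 0" "norm x *\<^sub>R \<omega> = x" using x by (auto simp: \<omega>_def)
    have "\<bar>mc_op (grad k \<omega> + - q) (hess_form \<omega>) - mc_op (grad k \<omega>) (hess_form \<omega>)\<bar> < ?h \<omega>0"
      by (rule d(3)[OF \<omega>(1)]) (use d(1) q in auto)
    moreover have "?h \<omega>0 \<le> mc_op (grad k \<omega>) (hess_form \<omega>)" using \<omega>0(2) \<omega>(1) by simp
    ultimately have "0 \<le> mc_op (grad k \<omega> - q) (hess_form \<omega>)" by simp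
    also have "hess_form \<omega> = (\<lambda>\<xi>. norm x * hess_form x \<xi>)"
      using grad_hess_scaling(2)[of "norm x" \<omega>] x \<omega> by (simp add: fun_eq_iff)
    also have "grad k \<omega> = grad k x" using grad_hess_scaling(1)[of "norm x" \<omega>] x \<omega> by simp
    finally show ?thesis using x by (simp add: mc_op_cmult zero_le_mult_iff)
  qed
  from that[OF d(1) this] show ?thesis .
qed

lemma mc_op_bounded_on_sphere:
  obtains K where "K \<ge> 0" "\<And>\<omega>. norm \<omega> = 1 \<Longrightarrow> \<bar>mc_op (grad k \<omega>) (hess_form \<omega>)\<bar> \<le> K"
proof -
  from bounded_on_sphere[OF continuous_mc_op_grad] obtain B where "B \<ge> 0"
    "\<And>\<omega>. norm \<omega> = 1 \<Longrightarrow> norm (mc_op (grad k \<omega> + 0) (hess_form \<omega>)) \<le> B" by blast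
  then show ?thesis by (intro that[of B]) simp_all
qed

text \<open>The cone starts to move with the speed of its graph. Both inequalities come from the
  upper barrier, applied to U over k and to -U over -k.\<close>

lemma short_time_expansion:
  assumes U: "mcf U" "\<And>x. U x 0 = k x" and \<eta>: "\<eta> > 0"
  shows "\<exists>\<tau>>0. \<forall>\<omega> t. norm \<omega> = 1 \<longrightarrow> 0 \<le> t \<longrightarrow> t \<le> \<tau> \<longrightarrow>
    \<bar>U \<omega> t - (k \<omega> + t * mc_op (grad k \<omega>) (hess_form \<omega>))\<bar> \<le> \<eta> * t"
proof -
  define \<kappa> where "\<kappa> \<omega> = mc_op (grad k \<omega>) (hess_form \<omega>)" for \<omega>
  obtain L where L: "L \<ge> 0" "\<And>x. x \<noteq> 0 \<Longrightarrow> norm (grad k x) \<le> L" "\<And>x y. \<bar>k x - k y\<bar> \<le> L * norm (x - y)"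
    by (rule lipschitz) (rule that)
  obtain K where "K \<ge> 0" "\<And>\<omega>. norm \<omega> = 1 \<Longrightarrow> \<bar>mc_op (grad k \<omega>) (hess_form \<omega>)\<bar> \<le> K"
    by (rule mc_op_bounded_on_sphere) (rule that)
  note K = this[folded \<kappa>_def]
  have cont: "continuous_on UNIV k"
  proof (rule lipschitz_on_continuous_on)
    show "L-lipschitz_on UNIV k" using L by (auto intro!: lipschitz_onI simp: dist_norm)
  qed
  define n where "n = real CARD('n)"
  have n: "n > 0" by (simp add: n_def)
  \<comment> \<open>The rate obtained from balls of radius sqrt (4 n t), the smallest that the local
    bounds admit.\<close>
  define C where "C = (L + 1) * sqrt (4 * n)"
  have C: "C \<ge> 0" using L n by (simp add: C_def)
  have growth: "\<bar>U x t - k x\<bar> \<le> C * sqrt t" if "t \<ge> 0" for x t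
  proof (cases "t = 0")
    case True
    then show ?thesis using U(2) by simp
  next
    case False
    then have t: "4 * n * t > 0" using that n by simp
    have "\<bar>U x t - k x\<bar> \<le> 0 + (L + 1) * sqrt (4 * n * t)"
    proof (rule mcf_lipschitz_growth[OF U(1) L(3,1) _ that])
      show "sqrt (4 * n * t) > 0" using t by simp
      show "real (4 * DIM(real ^ 'n)) * t \<le> (sqrt (4 * n * t))\<^sup>2" using t by (simp add: n_def)
    qed (simp add: U(2))
    also have "\<dots> = C * sqrt t" unfolding C_def real_sqrt_mult by simp
    finally show ?thesis .
  qed
  have "\<eta> / 4 > 0" using \<eta> by simp
  then obtain d where "d > 0" "d \<le> 1/2" "\<And>\<omega> x q. norm \<omega> = 1 \<Longrightarrow> dist x \<omega> \<le> d \<Longrightarrow> norm q \<le> d \<Longrightarrow>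
    \<bar>mc_op (grad k x + q) (hess_form x) - mc_op (grad k \<omega>) (hess_form \<omega>)\<bar> < \<eta> / 4"
    by (rule uniform_mc_op) (rule that)
  note d = this[folded \<kappa>_def]
  \<comment> \<open>2 B <= 1 keeps the added slope within d, and the second entry keeps the
    curvature of the quadratic within \<eta> / 4; with the \<eta> / 4 from uniform continuity the
    error is \<eta> / 2.\<close>
  define B where "B = min (1/2) (\<eta> / (8 * n))"
  have B: "B > 0" "2 * B \<le> 1" "2 * B * n \<le> \<eta> / 4"
  proof -
    show "B > 0" "2 * B \<le> 1" using n \<eta> by (auto simp: B_def)
    have "B * n \<le> \<eta> / (8 * n) * n" using n by (intro mult_right_mono) (auto simp: B_def)
    then show "2 * B * n \<le> \<eta> / 4" using n by simp
  qed
  \<comment> \<open>Both signs of b occur: b = B for U, and b = -B for -U once its barrier is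
    reflected.\<close>
  have est: "\<bar>mc_op (grad k x + (2 * b) *\<^sub>R (x - \<omega>)) (\<lambda>\<xi>. hess_form x \<xi> + 2 * b * (norm \<xi>)\<^sup>2) - \<kappa> \<omega>\<bar> \<le> \<eta> / 2"
    if \<omega>: "norm \<omega> = 1" "dist x \<omega> \<le> d" and b: "\<bar>b\<bar> \<le> B" for \<omega> x b
  proof -
    let ?p = "grad k x + (2 * b) *\<^sub>R (x - \<omega>)"
    have "\<bar>2 * b\<bar> * norm (x - \<omega>) \<le> 1 * d" using b B(2) \<omega>(2) by (intro mult_mono) (auto simp: dist_norm)
    then have "\<bar>mc_op ?p (hess_form x) - \<kappa> \<omega>\<bar> < \<eta> / 4" using \<omega> by (intro d(3)) auto
    moreover have "\<bar>2 * b * mc_op ?p (\<lambda>\<xi>. (norm \<xi>)\<^sup>2)\<bar> \<le> \<eta> / 4"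
    proof -
      have "0 \<le> mc_op ?p (\<lambda>\<xi>. (norm \<xi>)\<^sup>2)" unfolding mc_op_def by (simp add: sum_nonneg)
      moreover have "mc_op ?p (\<lambda>\<xi>. (norm \<xi>)\<^sup>2) \<le> n" using mc_op_norm_sq_le[of ?p] by (simp add: n_def)
      ultimately have "\<bar>2 * b\<bar> * \<bar>mc_op ?p (\<lambda>\<xi>. (norm \<xi>)\<^sup>2)\<bar> \<le> (2 * B) * n"
        using b B by (intro mult_mono) auto
      then show ?thesis using B(3) by (simp add: abs_mult)
    qed
    ultimately show ?thesis unfolding mc_op_add mc_op_cmult by linarith
  qed
  have nz: "x \<noteq> 0" if "norm \<omega> = 1" "dist x \<omega> \<le> d" for x \<omega> :: "real ^ 'n"
    using that d(2) by auto
  have "\<exists>\<tau>>0. \<forall>\<omega> t. norm \<omega> = 1 \<longrightarrow> 0 \<le> t \<longrightarrow> t \<le> \<tau> \<longrightarrow> U \<omega> t \<le> k \<omega> + t * (\<kappa> \<omega> + 2 * (\<eta> / 2))"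
  proof (rule mcf_short_time_upper[OF U(1) cont _ _ C _ d(1) B(1) _ K(2,1)])
    show "U x t \<le> k x + C * sqrt t" if "t \<ge> 0" for x t using growth[OF that, of x] by linarith
    show "\<exists>p X. jet2 k x p X \<and> mc_op (p + (2 * B) *\<^sub>R (x - \<omega>)) (\<lambda>\<xi>. X \<xi> + 2 * B * (norm \<xi>)\<^sup>2) \<le> \<kappa> \<omega> + \<eta> / 2"
      if "norm \<omega> = 1" "dist x \<omega> \<le> d" for \<omega> x
    proof (intro exI conjI)
      show "jet2 k x (grad k x) (hess_form x)" by (rule jet[OF nz[OF that]])
      have "\<bar>B\<bar> \<le> B" using B(1) by simp
      from est[OF that this]
      show "mc_op (grad k x + (2 * B) *\<^sub>R (x - \<omega>)) (\<lambda>\<xi>. hess_form x \<xi> + 2 * B * (norm \<xi>)\<^sup>2) \<le> \<kappa> \<omega> + \<eta> / 2"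
        by linarith
    qed
  qed (use U \<eta> in auto)
  then obtain \<tau>1 where \<tau>1: "\<tau>1 > 0" "\<And>\<omega> t. norm \<omega> = 1 \<Longrightarrow> 0 \<le> t \<Longrightarrow> t \<le> \<tau>1 \<Longrightarrow> U \<omega> t \<le> k \<omega> + t * (\<kappa> \<omega> + 2 * (\<eta> / 2))"
    by blast
  have "\<exists>\<tau>>0. \<forall>\<omega> t. norm \<omega> = 1 \<longrightarrow> 0 \<le> t \<longrightarrow> t \<le> \<tau> \<longrightarrow> - U \<omega> t \<le> - k \<omega> + t * (- \<kappa> \<omega> + 2 * (\<eta> / 2))"
  proof (rule mcf_short_time_upper[OF mcf_minus[OF U(1)] _ _ _ C _ d(1) B(1) _ _ K(1)])
    show "- U x t \<le> - k x + C * sqrt t" if "t \<ge> 0" for x t using growth[OF that, of x] by linarith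
    show "\<exists>p X. jet2 (\<lambda>x. - k x) x p X \<and>
      mc_op (p + (2 * B) *\<^sub>R (x - \<omega>)) (\<lambda>\<xi>. X \<xi> + 2 * B * (norm \<xi>)\<^sup>2) \<le> - \<kappa> \<omega> + \<eta> / 2"
      if "norm \<omega> = 1" "dist x \<omega> \<le> d" for \<omega> x
    proof (intro exI conjI)
      show "jet2 (\<lambda>x. - k x) x (- grad k x) (\<lambda>\<xi>. - hess_form x \<xi>)" by (rule jet2_minus[OF jet[OF nz[OF that]]])
      have "- grad k x + (2 * B) *\<^sub>R (x - \<omega>) = - (grad k x + (2 * - B) *\<^sub>R (x - \<omega>))" by simp
      moreover have "(\<lambda>\<xi>. - hess_form x \<xi> + 2 * B * (norm \<xi>)\<^sup>2) = (\<lambda>\<xi>. - (hess_form x \<xi> + 2 * - B * (norm \<xi>)\<^sup>2))"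
        by simp
      ultimately show "mc_op (- grad k x + (2 * B) *\<^sub>R (x - \<omega>)) (\<lambda>\<xi>. - hess_form x \<xi> + 2 * B * (norm \<xi>)\<^sup>2) \<le> - \<kappa> \<omega> + \<eta> / 2"
        using est[OF that, of "- B"] B(1) by (simp only: mc_op_minus) linarith
    qed
  qed (use U \<eta> K cont in \<open>auto intro: continuous_intros\<close>)
  then obtain \<tau>2 where \<tau>2: "\<tau>2 > 0" "\<And>\<omega> t. norm \<omega> = 1 \<Longrightarrow> 0 \<le> t \<Longrightarrow> t \<le> \<tau>2 \<Longrightarrow> - U \<omega> t \<le> - k \<omega> + t * (- \<kappa> \<omega> + 2 * (\<eta> / 2))"
    by blast
  have "\<bar>U \<omega> t - (k \<omega> + t * \<kappa> \<omega>)\<bar> \<le> \<eta> * t" if "norm \<omega> = 1" "0 \<le> t" "t \<le> min \<tau>1 \<tau>2" for \<omega> t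
    using \<tau>1(2)[of \<omega> t] \<tau>2(2)[of \<omega> t] that by (simp add: abs_le_iff algebra_simps)
  then show ?thesis using \<tau>1(1) \<tau>2(1) unfolding \<kappa>_def by (intro exI[of _ "min \<tau>1 \<tau>2"]) auto
qed

end

section \<open>Convergence of the suprema\<close>

theorem theorem1p1:
  fixes k u0 :: "real ^ 'n \<Rightarrow> real"
    and U u :: "real ^ 'n \<Rightarrow> real \<Rightarrow> real"
  assumes "smooth_on (- {0}) k"
    and "pos_homogeneous k"
    and "\<exists>S :: ((real ^ 'n) \<times> real) set. halfspace S \<and> range (\<lambda>x. (x, k x)) \<subseteq> S"
    and "\<And>x. x \<noteq> 0 \<Longrightarrow> mean_curvature k x > 0"
    and "homothetically_expanding_solution k U"
    and "gmcf_solution u"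
    and "\<And>x. u x 0 = u0 x"
    and "((\<lambda>r. SUP x\<in>- ball 0 r. ereal \<bar>u0 x - k x\<bar>) \<longlongrightarrow> 0) at_top"
  shows "((\<lambda>t. SUP x. ereal \<bar>u x t - U x t\<bar>) \<longlongrightarrow> 0) at_top"
proof -
  interpret smooth_cone k using assms(1,2) by unfold_locales (simp_all add: smooth_on_def)
  have convex: "mc_op (grad k x) (hess_form x) > 0" if "x \<noteq> 0" for x
  proof -
    have "sqrt (1 + (norm (grad k x))\<^sup>2) * mean_curvature k x > 0"
      using assms(4)[OF that] by (intro mult_pos_pos) (simp_all add: add_pos_nonneg)
    then show ?thesis using mean_curvature_eq_mc_op[OF open_punctured smooth, of x] that by simp
  qed
  obtain L where L: "L \<ge> 0" "\<And>x. x \<noteq> 0 \<Longrightarrow> norm (grad k x) \<le> L" "\<And>x y. \<bar>k x - k y\<bar> \<le> L * norm (x - y)"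
    by (rule lipschitz) (rule that)
  obtain \<delta> where \<delta>: "\<delta> > 0" "\<And>x q. x \<noteq> 0 \<Longrightarrow> norm q \<le> \<delta> \<Longrightarrow> mc_op (grad k x - q) (hess_form x) \<ge> 0"
    by (rule robust_mean_convexity[OF convex], assumption, rule that)
  obtain K where K: "K \<ge> 0" "\<And>\<omega>. norm \<omega> = 1 \<Longrightarrow> \<bar>mc_op (grad k \<omega>) (hess_form \<omega>)\<bar> \<le> K"
    by (rule mc_op_bounded_on_sphere) (rule that)
  have U: "mcf U" "\<And>x. U x 0 = k x" "\<And>x t. t > 0 \<Longrightarrow> U x t = sqrt t * U (x /\<^sub>R sqrt t) 1"
    using assms(5) gmcf_solution_imp_mcf unfolding homothetically_expanding_solution_def by blast+
  have u: "mcf u" using assms(6) by (rule gmcf_solution_imp_mcf)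
  have close: "\<exists>R. \<forall>x. norm x \<ge> R \<longrightarrow> \<bar>u x 0 - k x\<bar> \<le> e" if "e > 0" for e
  proof -
    have "\<forall>\<^sub>F r in at_top. (SUP x\<in>- ball 0 r. ereal \<bar>u0 x - k x\<bar>) < ereal e"
      using that by (intro order_tendstoD(2)[OF assms(8)]) simp
    then obtain R where R: "(SUP x\<in>- ball 0 R. ereal \<bar>u0 x - k x\<bar>) < ereal e"
      unfolding eventually_at_top_linorder by blast
    have "\<bar>u x 0 - k x\<bar> \<le> e" if "norm x \<ge> R" for x
    proof -
      have "ereal \<bar>u0 x - k x\<bar> \<le> (SUP x\<in>- ball 0 R. ereal \<bar>u0 x - k x\<bar>)"
        using that by (intro SUP_upper) auto
      then have "ereal \<bar>u0 x - k x\<bar> < ereal e" using R by (rule order_le_less_trans)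
      then show ?thesis using assms(7)[of x] by simp
    qed
    then show ?thesis by blast
  qed
  have stable: "\<exists>T. \<forall>t\<ge>T. \<forall>x. \<bar>u x t - U x t\<bar> \<le> e" if "e > 0" for e
    by (rule expander_stability[OF assms(2) L(3,1) jet L(2) convex \<delta>(2,1) U(1,2) U(3)
          short_time_expansion[OF U(1,2)] K(2,1) u close that])
  show ?thesis
  proof (rule order_tendstoI)
    fix a :: ereal assume "a < 0"
    moreover have "0 \<le> (SUP x. ereal \<bar>u x t - U x t\<bar>)" for t
      by (rule SUP_upper2[of 0]) auto
    ultimately show "\<forall>\<^sub>F t in at_top. a < (SUP x. ereal \<bar>u x t - U x t\<bar>)"
      by (intro always_eventually) (auto intro: order_less_le_trans)
  next
    fix a :: ereal assume "0 < a"
    \<comment> \<open>\<open>a\<close> may be infinite; a real e strictly between 0 and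
      \<open>a\<close> also turns the bound by e into a strict one.\<close>
    then obtain e where e: "0 < e" "ereal e < a" using ereal_dense2[of 0 a] by auto
    obtain T where T: "\<And>t x. t \<ge> T \<Longrightarrow> \<bar>u x t - U x t\<bar> \<le> e" using stable[OF e(1)] by blast
    have "(SUP x. ereal \<bar>u x t - U x t\<bar>) < a" if "t \<ge> T" for t
      using T[OF that] e(2) by (intro order_le_less_trans[OF SUP_least]) auto
    then show "\<forall>\<^sub>F t in at_top. (SUP x. ereal \<bar>u x t - U x t\<bar>) < a"
      unfolding eventually_at_top_linorder by blast
  qed
qed

end
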